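(* Let $[S,T]\subseteq\mathbb{R}$ be an interval and let $m,n\in\mathbb{N}$. Let $p\in[1,3)$, let $\omega$ be a control function on $[S,T]$, and let $X$ be an $n$-dimensional branched rough path on $[S,T]$ with regularity $p$ and control $\omega$. Let $M$ be an $m$-dimensional manifold, let $f:M\to R_n^2M$ be an admissible rough velocity field, and let $Y_1$ and $Y_2$ be two integral curves of $f$ driven by $X$ defined on $[S,T]$ such that $Y_1(S)=Y_2(S)$. Then $Y_1=Y_2$ on the whole interval $[S,T]$.
   Context: Smooth means $C^\infty$; manifolds are smooth and finite-dimensional; superscripts $i$ denote coordinates. For $I\subseteq\mathbb{R}$, $\Delta I:=\{(s,t)\in I^2: s\le t\}$. A control function on $[S,T]$ is a continuous function $\omega:\Delta[S,T]\to[0,\infty)$ with $\omega(s,s)=0$ for all $s$ and $\omega(s,t)\ge\omega(s,u)+\omega(u,t)$ for all $S\le s\le u\le t\le T$. $\mathcal{F}_n^2$ is the set of non-empty forests of rooted trees with at most two vertices, with vertices labeled by $\{1,\dots,n\}$. Its elements are: the one-vertex trees, written $\alpha$; the forests made of two one-vertex trees, written $\alpha\cdot\beta=\beta\cdot\alpha$ (unordered, $\alpha=\beta$ allowed); and the two-vertex trees, written $\alpha|\beta$ (top vertex $\alpha$, bottom vertex $\beta$). The symmetry factor is $\sigma(\alpha)=1$, $\sigma(\alpha|\beta)=1$, $\sigma(\alpha\cdot\beta)=1$ if $\alpha\ne\beta$, and $\sigma(\alpha\cdot\alpha)=2$. For $p\in[1,3)$, an $n$-dimensional branched rough path on $[S,T]$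 with regularity $p$ and control $\omega$ is a tuple $X=(X^\tau)_{\tau\in\mathcal{F}_n^2}$ of functions $X^\tau:\Delta[S,T]\to\mathbb{R}$ such that for all $\alpha,\beta$ and all $S\le s\le u\le t\le T$: $X^\alpha(s,t)=X^\alpha(s,u)+X^\alpha(u,t)$; $X^{\alpha\cdot\beta}(s,t)=X^\alpha(s,t)X^\beta(s,t)$; $X^{\alpha|\beta}(s,t)=X^{\alpha|\beta}(s,u)+X^{\alpha|\beta}(u,t)+X^\alpha(s,u)X^\beta(u,t)$; and such that for some $C\in(0,\infty)$, $|X^\alpha(s,t)|\le C\omega(s,t)^{1/p}$, $|X^{\alpha\cdot\beta}(s,t)|\le C\omega(s,t)^{2/p}$, $|X^{\alpha|\beta}(s,t)|\le C\omega(s,t)^{2/p}$ for all $\alpha,\beta$ and $(s,t)\in\Delta[S,T]$. Rough velocity bundle. $F_{mn}^2$ is the real vector space of tuples $(f^i_\tau)$, $i\in\{1,\dots,m\}$, $\tau\in\mathcal{F}_n^2$. $G_m^2$ is the Lie group of invertible $2$-jets of smooth maps $\mathbb{R}^m\to\mathbb{R}^m$ with source and target $0$; a jet $a$ is written $(a^i_j,a^i_{jk})$ with $a^i_{jk}=a^i_{kj}$ (first and second partial derivatives at $0$). It acts on $F_{mn}^2$ from the left by $af=g$, $g^i_\alpha=\sum_j a^i_jf^j_\alpha$, $g^i_{\alpha\cdot\beta}=\sum_j a^i_jf^j_{\alpha\cdot\beta}+\sum_{j,k}a^i_{jk}f^j_\alpha f^k_\beta$, $g^i_{\alpha|\beta}=\sum_j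 a^i_jf^j_{\alpha|\beta}$. For an $m$-dimensional manifold $M$, let $P^2M$ be the second-order frame bundle ($2$-jets $j^2_0\psi$ at $0$ of local diffeomorphisms $\psi:\mathbb{R}^m\to M$), a principal $G_m^2$-bundle; $R_n^2M$ is the associated bundle with fiber $F_{mn}^2$, i.e. the set of classes $[(j_0^2\psi,f)]$ under $(j^2_0\psi,f)\sim(j^2_0(\psi\circ a),a^{-1}f)$, with projection $\pi[(j_0^2\psi,f)]=\psi(0)$. A chart $(U,x)$ on $M$ induces coordinates $(x^i,f^i_\tau)$ on $\pi^{-1}(U)$: the class $[(j_0^2\psi,f)]$ has base coordinates $x(\psi(0))$ and fiber coordinates $af$, where $a\in G_m^2$ consists of the first and second derivatives of $x\circ\psi$ at $0$. Under a change of charts from $(U,x)$ to $(V,y)$ the fiber coordinates at $p$ change by the action of the jet with $a^i_j=\frac{\partial y^i}{\partial x^j}(p)$, $a^i_{jk}=\frac{\partial^2y^i}{\partial x^j\partial x^k}(p)$. A rough velocity field on $M$ is a smooth section $f:M\to R_n^2M$; in a chart $(U,x)$ it is represented by smooth functions $f^i_\tau:U\to\mathbb{R}$. It is admissible if for every $p\in M$ there is a chart $(U,x)$ around $p$ in which $\sum_j\frac{\partial f^i_\beta}{\partial x^j}(p)f^j_\alpha(p)=f^i_{\alpha\cdot\beta}(p)+f^i_{\alpha|\beta}(p)$ for all $i,\alpha,\beta$ (this condition does not depend on the chart). A function $Y:[S,T]\to M$ is an integral curve of $f$ driven by $X$ if it is continuous and if for every compact interval $I\subseteq[S,T]$ and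 every chart $(U,x)$ with $Y(I)\subseteq U$ there exists $C\in(0,\infty)$ such that $\left|Y^i(t)-Y^i(s)-\sum_{\tau\in\mathcal{F}_n^2}\frac{1}{\sigma(\tau)}f^i_\tau(Y(s))X^\tau(s,t)\right|\le C\omega(s,t)^{3/p}$ for every $i$ and $(s,t)\in\Delta I$, where $Y^i=x^i\circ Y$ and $(f^i_\tau)$ represents $f$ in the chart induced by $(U,x)$. *)

theory Defs
  imports "HOL-Analysis.Analysis" "HOL-Library.Uprod"
begin

section \<open>Forests with at most two vertices\<close>

text \<open>
  The label set \<open>{1,\<dots>,n}\<close> is a finite type \<open>'n\<close>. The forest made of two one-vertex
  trees is an unordered pair of labels; in \<open>Ladder \<alpha> \<beta>\<close> the top vertex is \<open>\<alpha>\<close> and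
  the bottom vertex is \<open>\<beta>\<close>.
\<close>

datatype 'n forest = Vtx 'n | Dots "'n uprod" | Ladder 'n 'n

abbreviation Dot :: "'n \<Rightarrow> 'n \<Rightarrow> 'n forest"
  where "Dot \<alpha> \<beta> \<equiv> Dots (Upair \<alpha> \<beta>)"

instance forest :: (finite) finite
proof
  have "(UNIV :: 'a forest set) \<subseteq> range Vtx \<union> range Dots \<union> range (\<lambda>(a, b). Ladder a b)"
  proof
    fix x :: "'a forest"
    show "x \<in> range Vtx \<union> range Dots \<union> range (\<lambda>(a, b). Ladder a b)"
      by (cases x) auto
  qed
  moreover have "finite (range (Dots :: 'a uprod \<Rightarrow> 'a forest))"
    by (rule finite_imageI) simp
  ultimately show "finite (UNIV :: 'a forest set)"
    by (meson finite finite_UnI finite_imageI finite_subset)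
qed

definition sym_factor :: "'n forest \<Rightarrow> real"
  where "sym_factor \<tau> =
    (case \<tau> of Vtx \<alpha> \<Rightarrow> 1 | Dots P \<Rightarrow> (if proper_uprod P then 1 else 2) | Ladder \<alpha> \<beta> \<Rightarrow> 1)"

lemma sym_factor_simps [simp]:
  "sym_factor (Vtx \<alpha>) = 1"
  "sym_factor (Ladder \<alpha> \<beta>) = 1"
  "sym_factor (Dot \<alpha> \<beta>) = (if \<alpha> = \<beta> then 2 else 1)"
  by (simp_all add: sym_factor_def)


section \<open>Control functions and branched rough paths\<close>

definition simplex2 :: "real set \<Rightarrow> (real \<times> real) set"
  where "simplex2 I = {(s, t). s \<in> I \<and> t \<in> I \<and> s \<le> t}"

definition control_function :: "real \<Rightarrow> real \<Rightarrow> (real \<times> real \<Rightarrow> real) \<Rightarrow> bool"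
  where "control_function S T \<omega> \<longleftrightarrow>
    continuous_on (simplex2 {S..T}) \<omega> \<and>
    (\<forall>z \<in> simplex2 {S..T}. 0 \<le> \<omega> z) \<and>
    (\<forall>s \<in> {S..T}. \<omega> (s, s) = 0) \<and>
    (\<forall>s u t. S \<le> s \<and> s \<le> u \<and> u \<le> t \<and> t \<le> T \<longrightarrow> \<omega> (s, t) \<ge> \<omega> (s, u) + \<omega> (u, t))"

definition branched_rough_path ::
    "real \<Rightarrow> real \<Rightarrow> real \<Rightarrow> (real \<times> real \<Rightarrow> real) \<Rightarrow> ('n::finite forest \<Rightarrow> real \<times> real \<Rightarrow> real) \<Rightarrow> bool"
  where "branched_rough_path S T p \<omega> X \<longleftrightarrow>
    (\<forall>\<alpha> \<beta> s u t. S \<le> s \<and> s \<le> u \<and> u \<le> t \<and> t \<le> T \<longrightarrow>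
       X (Vtx \<alpha>) (s, t) = X (Vtx \<alpha>) (s, u) + X (Vtx \<alpha>) (u, t) \<and>
       X (Dot \<alpha> \<beta>) (s, t) = X (Vtx \<alpha>) (s, t) * X (Vtx \<beta>) (s, t) \<and>
       X (Ladder \<alpha> \<beta>) (s, t) =
         X (Ladder \<alpha> \<beta>) (s, u) + X (Ladder \<alpha> \<beta>) (u, t) + X (Vtx \<alpha>) (s, u) * X (Vtx \<beta>) (u, t)) \<and>
    (\<exists>C > 0. \<forall>\<alpha> \<beta>. \<forall>z \<in> simplex2 {S..T}.
       \<bar>X (Vtx \<alpha>) z\<bar> \<le> C * \<omega> z powr (1 / p) \<and>
       \<bar>X (Dot \<alpha> \<beta>) z\<bar> \<le> C * \<omega> z powr (2 / p) \<and>
       \<bar>X (Ladder \<alpha> \<beta>) z\<bar> \<le> C * \<omega> z powr (2 / p))"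


section \<open>Smooth functions between Euclidean spaces\<close>

text \<open>On an open set in finite dimension the following says that \<open>f\<close> is of class \<open>C\<^sup>k\<close>.\<close>

primrec Ck_on ::
    "nat \<Rightarrow> 'e::real_normed_vector set \<Rightarrow> ('e \<Rightarrow> 'f::real_normed_vector) \<Rightarrow> bool"
  where
    "Ck_on 0 W f \<longleftrightarrow> continuous_on W f"
  | "Ck_on (Suc k) W f \<longleftrightarrow>
       (\<forall>v \<in> W. f differentiable (at v)) \<and> (\<forall>h. Ck_on k W (\<lambda>v. frechet_derivative f (at v) h))"

definition smooth_on :: "'e::real_normed_vector set \<Rightarrow> ('e \<Rightarrow> 'f::real_normed_vector) \<Rightarrow> bool"
  where "smooth_on W f \<longleftrightarrow> open W \<and> (\<forall>k. Ck_on k W f)"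

definition pderiv_at :: "'m::finite \<Rightarrow> (real^'m \<Rightarrow> real) \<Rightarrow> real^'m \<Rightarrow> real"
  where "pderiv_at j f v = frechet_derivative f (at v) (axis j 1)"


section \<open>Smooth manifolds\<close>

text \<open>
  A manifold of dimension \<open>CARD('m)\<close> is a topological space together with its set of all smooth
  charts (a maximal atlas). A chart is a pair \<open>(U, x)\<close>; only the values of \<open>x\<close> on \<open>U\<close> matter.
\<close>

type_synonym ('a, 'm) chart = "'a set \<times> ('a \<Rightarrow> real^'m)"

record ('a, 'm) manifold =
  mtop :: "'a topology"
  charts :: "('a, 'm) chart set"

definition topological_chart :: "'a topology \<Rightarrow> ('a, 'm::finite) chart \<Rightarrow> bool"
  where "topological_chart X = (\<lambda>(U, x).
    openin X U \<and> open (x ` U) \<and> homeomorphic_map (subtopology X U) (top_of_set (x ` U)) x)"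

definition smooth_compatible :: "('a, 'm::finite) chart \<Rightarrow> ('a, 'm) chart \<Rightarrow> bool"
  where "smooth_compatible = (\<lambda>(U, x) (V, y).
    smooth_on (x ` (U \<inter> V)) (y \<circ> inv_into U x) \<and> smooth_on (y ` (U \<inter> V)) (x \<circ> inv_into V y))"

definition smooth_manifold :: "('a, 'm::finite) manifold \<Rightarrow> bool"
  where "smooth_manifold M \<longleftrightarrow>
    Hausdorff_space (mtop M) \<and> second_countable (mtop M) \<and>
    (\<forall>c \<in> charts M. topological_chart (mtop M) c) \<and>
    (\<Union>(U, x) \<in> charts M. U) = topspace (mtop M) \<and>
    (\<forall>c \<in> charts M. \<forall>d \<in> charts M. smooth_compatible c d) \<and>
    (\<forall>c. topological_chart (mtop M) c \<and> (\<forall>d \<in> charts M. smooth_compatible c d) \<longrightarrow> c \<in> charts M)"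


section \<open>The group of invertible 2-jets and its action\<close>

type_synonym 'm jet = "(real^'m^'m) \<times> (real^'m^'m^'m)"

text \<open>
  A 2-jet at \<open>0\<close> is identified with its coordinates \<open>(a\<^sup>i\<^sub>j, a\<^sup>i\<^sub>j\<^sub>k)\<close>, where
  \<open>fst a $ i $ j = a\<^sup>i\<^sub>j\<close> and \<open>snd a $ i $ j $ k = a\<^sup>i\<^sub>j\<^sub>k\<close>.
\<close>

definition jet2 :: "(real^'m::finite \<Rightarrow> real^'m) \<Rightarrow> 'm jet"
  where "jet2 \<phi> =
    ((\<chi> i j. pderiv_at j (\<lambda>v. \<phi> v $ i) 0),
     (\<chi> i j k. pderiv_at j (pderiv_at k (\<lambda>v. \<phi> v $ i)) 0))"

text \<open>Smooth germs \<open>\<real>\<^sup>m \<rightarrow> \<real>\<^sup>m\<close> with source and target \<open>0\<close>.\<close>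

definition pointed_germ :: "(real^'m::finite \<Rightarrow> real^'m) \<Rightarrow> bool"
  where "pointed_germ \<phi> \<longleftrightarrow> (\<exists>W. 0 \<in> W \<and> smooth_on W \<phi>) \<and> \<phi> 0 = 0"

definition jet_group :: "'m::finite jet set"
  where "jet_group = {jet2 \<phi> | \<phi>. pointed_germ \<phi> \<and>
    (\<exists>\<theta>. pointed_germ \<theta> \<and> jet2 (\<phi> \<circ> \<theta>) = jet2 id \<and> jet2 (\<theta> \<circ> \<phi>) = jet2 id)}"

type_synonym ('m, 'n) rv_fiber = "real^('n forest)^'m"

text \<open>
  The description is satisfied by exactly one vector whenever \<open>a\<^sup>i\<^sub>j\<^sub>k = a\<^sup>i\<^sub>k\<^sub>j\<close>, as is the case for
  jets of smooth maps; symmetry is what makes the second equation independent of the order of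
  \<open>\<alpha>\<close> and \<open>\<beta>\<close>.
\<close>

definition jet_act :: "'m::finite jet \<Rightarrow> ('m, 'n::finite) rv_fiber \<Rightarrow> ('m, 'n) rv_fiber"
  where "jet_act a f = (THE g. \<forall>i \<alpha> \<beta>.
    g $ i $ Vtx \<alpha> = (\<Sum>j\<in>UNIV. fst a $ i $ j * f $ j $ Vtx \<alpha>) \<and>
    g $ i $ Dot \<alpha> \<beta> = (\<Sum>j\<in>UNIV. fst a $ i $ j * f $ j $ Dot \<alpha> \<beta>)
      + (\<Sum>j\<in>UNIV. \<Sum>k\<in>UNIV. snd a $ i $ j $ k * f $ j $ Vtx \<alpha> * f $ k $ Vtx \<beta>) \<and>
    g $ i $ Ladder \<alpha> \<beta> = (\<Sum>j\<in>UNIV. fst a $ i $ j * f $ j $ Ladder \<alpha> \<beta>))"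

lemma jet_act:
  fixes a :: "'m::finite jet" and f :: "('m, 'n::finite) rv_fiber"
  assumes sym: "\<And>i j k. snd a $ i $ j $ k = snd a $ i $ k $ j"
  shows "jet_act a f $ i $ Vtx \<alpha> = (\<Sum>j\<in>UNIV. fst a $ i $ j * f $ j $ Vtx \<alpha>)" (is ?V)
    and "jet_act a f $ i $ Dot \<alpha> \<beta> = (\<Sum>j\<in>UNIV. fst a $ i $ j * f $ j $ Dot \<alpha> \<beta>)
      + (\<Sum>j\<in>UNIV. \<Sum>k\<in>UNIV. snd a $ i $ j $ k * f $ j $ Vtx \<alpha> * f $ k $ Vtx \<beta>)" (is ?D)
    and "jet_act a f $ i $ Ladder \<alpha> \<beta> = (\<Sum>j\<in>UNIV. fst a $ i $ j * f $ j $ Ladder \<alpha> \<beta>)" (is ?L)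
proof -
  define Q where "Q i \<alpha> \<beta> = (\<Sum>j\<in>UNIV. \<Sum>k\<in>UNIV. snd a $ i $ j $ k * f $ j $ Vtx \<alpha> * f $ k $ Vtx \<beta>)"
    for i \<alpha> \<beta>
  define P where "P g \<longleftrightarrow> (\<forall>i \<alpha> \<beta>.
    g $ i $ Vtx \<alpha> = (\<Sum>j\<in>UNIV. fst a $ i $ j * f $ j $ Vtx \<alpha>) \<and>
    g $ i $ Dot \<alpha> \<beta> = (\<Sum>j\<in>UNIV. fst a $ i $ j * f $ j $ Dot \<alpha> \<beta>) + Q i \<alpha> \<beta> \<and>
    g $ i $ Ladder \<alpha> \<beta> = (\<Sum>j\<in>UNIV. fst a $ i $ j * f $ j $ Ladder \<alpha> \<beta>))"
    for g :: "('m, 'n) rv_fiber"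
  have Qsym: "Q i \<alpha> \<beta> = Q i \<beta> \<alpha>" for i \<alpha> \<beta>
    unfolding Q_def
    by (subst sum.swap) (simp add: sym [of i] mult.commute mult.left_commute cong: sum.cong)
  define g :: "('m, 'n) rv_fiber" where "g = (\<chi> i \<tau>. (\<Sum>j\<in>UNIV. fst a $ i $ j * f $ j $ \<tau>) +
     (case \<tau> of Dots p \<Rightarrow> (THE q. \<exists>\<alpha> \<beta>. p = Upair \<alpha> \<beta> \<and> q = Q i \<alpha> \<beta>) | _ \<Rightarrow> 0))"
  have "(THE q. \<exists>\<alpha>' \<beta>'. Upair \<alpha> \<beta> = Upair \<alpha>' \<beta>' \<and> q = Q i \<alpha>' \<beta>') = Q i \<alpha> \<beta>" for i \<alpha> \<beta>
    by (rule the_equality) (use Qsym in auto)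
  then have "P g"
    by (simp add: P_def g_def)
  moreover have "h = g" if "P h" for h
  proof -
    have "h $ i $ \<tau> = g $ i $ \<tau>" for i \<tau>
    proof (cases \<tau>)
      case (Dots p)
      then show ?thesis
        using that \<open>P g\<close> by (cases p) (simp add: P_def)
    qed (use that \<open>P g\<close> in \<open>simp_all add: P_def\<close>)
    then show ?thesis
      by (simp add: vec_eq_iff)
  qed
  ultimately have "P (THE g. P g)"
    by (rule theI)
  moreover have "jet_act a f = (THE g. P g)"
    by (simp add: jet_act_def P_def Q_def)
  ultimately have "P (jet_act a f)"
    by simp
  then show ?V ?D ?L
    by (auto simp: P_def Q_def)
qed


section \<open>The second-order frame bundle and the rough velocity bundle\<close>

text \<open>
  \<open>local_diffeo M \<psi>\<close>: the restriction of \<open>\<psi>\<close> to some open neighbourhood \<open>W\<close> of \<open>0\<close> is a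
  diffeomorphism onto an open subset of \<open>M\<close>. Values of \<open>\<psi>\<close> outside \<open>W\<close> are irrelevant.
\<close>

definition local_diffeo :: "('a, 'm::finite) manifold \<Rightarrow> (real^'m \<Rightarrow> 'a) \<Rightarrow> bool"
  where "local_diffeo M \<psi> \<longleftrightarrow> (\<exists>W. open W \<and> 0 \<in> W \<and> inj_on \<psi> W \<and> openin (mtop M) (\<psi> ` W) \<and>
    (\<forall>(U, x) \<in> charts M.
       smooth_on (W \<inter> \<psi> -` U) (x \<circ> \<psi>) \<and>
       smooth_on (x ` (U \<inter> \<psi> ` W)) (inv_into W \<psi> \<circ> inv_into U x)))"

type_synonym ('a, 'm) frame = "(real^'m \<Rightarrow> 'a) set"

definition frame_jet :: "('a, 'm::finite) manifold \<Rightarrow> (real^'m \<Rightarrow> 'a) \<Rightarrow> ('a, 'm) frame"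
  where "frame_jet M \<psi> = {\<phi>. local_diffeo M \<phi> \<and> \<phi> 0 = \<psi> 0 \<and>
    (\<forall>(U, x) \<in> charts M. \<psi> 0 \<in> U \<longrightarrow> jet2 (x \<circ> \<phi>) = jet2 (x \<circ> \<psi>))}"

definition frame_bundle :: "('a, 'm::finite) manifold \<Rightarrow> ('a, 'm) frame set"
  where "frame_bundle M = {frame_jet M \<psi> | \<psi>. local_diffeo M \<psi>}"

text \<open>
  The relation \<open>(j\<^sup>2\<psi>, f) \<sim> (j\<^sup>2(\<psi> \<circ> a), a\<^sup>-\<^sup>1 f)\<close>: here \<open>\<theta>\<close> is a germ representing the jet \<open>a\<close>, and
  \<open>g = a\<^sup>-\<^sup>1 f\<close> is expressed as \<open>a g = f\<close>.
\<close>

definition rv_rel ::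
    "('a, 'm::finite) manifold \<Rightarrow>
      ((('a, 'm) frame \<times> ('m, 'n::finite) rv_fiber) \<times> (('a, 'm) frame \<times> ('m, 'n) rv_fiber)) set"
  where "rv_rel M = {((frame_jet M \<psi>, f), (frame_jet M (\<psi> \<circ> \<theta>), g)) | \<psi> \<theta> f g.
    local_diffeo M \<psi> \<and> pointed_germ \<theta> \<and> jet2 \<theta> \<in> jet_group \<and> jet_act (jet2 \<theta>) g = f}"

type_synonym ('a, 'm, 'n) rough_velocity = "(('a, 'm) frame \<times> ('m, 'n) rv_fiber) set"

definition rv_bundle :: "('a, 'm::finite) manifold \<Rightarrow> ('a, 'm, 'n::finite) rough_velocity set"
  where "rv_bundle M = (frame_bundle M \<times> UNIV) // rv_rel M"

definition rv_proj :: "('a, 'm::finite) manifold \<Rightarrow> ('a, 'm, 'n::finite) rough_velocity \<Rightarrow> 'a"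
  where "rv_proj M c = (THE q. \<exists>\<psi> f. local_diffeo M \<psi> \<and> (frame_jet M \<psi>, f) \<in> c \<and> q = \<psi> 0)"

text \<open>
  The fiber coordinates of the class \<open>c\<close> in the chart of \<open>rv_bundle M\<close> induced by the chart
  \<open>(U, x)\<close> of \<open>M\<close>, meaningful for \<open>rv_proj M c \<in> U\<close>.
\<close>

definition fiber_coords ::
    "('a, 'm::finite) manifold \<Rightarrow> ('a \<Rightarrow> real^'m) \<Rightarrow> ('a, 'm, 'n::finite) rough_velocity
      \<Rightarrow> ('m, 'n) rv_fiber"
  where "fiber_coords M x c =
    (THE h. \<exists>\<psi> f. local_diffeo M \<psi> \<and> (frame_jet M \<psi>, f) \<in> c \<and> h = jet_act (jet2 (x \<circ> \<psi>)) f)"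


section \<open>Rough velocity fields and their integral curves\<close>

definition rough_velocity_field ::
    "('a, 'm::finite) manifold \<Rightarrow> ('a \<Rightarrow> ('a, 'm, 'n::finite) rough_velocity) \<Rightarrow> bool"
  where "rough_velocity_field M f \<longleftrightarrow>
    (\<forall>q \<in> topspace (mtop M). f q \<in> rv_bundle M \<and> rv_proj M (f q) = q) \<and>
    (\<forall>(U, x) \<in> charts M. smooth_on (x ` U) (\<lambda>v. fiber_coords M x (f (inv_into U x v))))"

definition admissible ::
    "('a, 'm::finite) manifold \<Rightarrow> ('a \<Rightarrow> ('a, 'm, 'n::finite) rough_velocity) \<Rightarrow> bool"
  where "admissible M f \<longleftrightarrow>
    (\<forall>q \<in> topspace (mtop M). \<exists>(U, x) \<in> charts M. q \<in> U \<and>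
      (\<forall>i \<alpha> \<beta>.
        (\<Sum>j\<in>UNIV. pderiv_at j (\<lambda>v. fiber_coords M x (f (inv_into U x v)) $ i $ Vtx \<beta>) (x q)
                   * fiber_coords M x (f q) $ j $ Vtx \<alpha>)
        = fiber_coords M x (f q) $ i $ Dot \<alpha> \<beta> + fiber_coords M x (f q) $ i $ Ladder \<alpha> \<beta>))"

definition integral_curve ::
    "('a, 'm::finite) manifold \<Rightarrow> real \<Rightarrow> real \<Rightarrow> real \<Rightarrow> (real \<times> real \<Rightarrow> real) \<Rightarrow>
      ('n::finite forest \<Rightarrow> real \<times> real \<Rightarrow> real) \<Rightarrow> ('a \<Rightarrow> ('a, 'm, 'n) rough_velocity) \<Rightarrow>
      (real \<Rightarrow> 'a) \<Rightarrow> bool"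
  where "integral_curve M S T p \<omega> X f Y \<longleftrightarrow>
    continuous_map (top_of_set {S..T}) (mtop M) Y \<and>
    (\<forall>a b. {a..b} \<subseteq> {S..T} \<longrightarrow>
      (\<forall>(U, x) \<in> charts M. Y ` {a..b} \<subseteq> U \<longrightarrow>
        (\<exists>C > 0. \<forall>i. \<forall>(s, t) \<in> simplex2 {a..b}.
          \<bar>x (Y t) $ i - x (Y s) $ i
             - (\<Sum>\<tau>\<in>UNIV. 1 / sym_factor \<tau> * fiber_coords M x (f (Y s)) $ i $ \<tau> * X \<tau> (s, t))\<bar>
          \<le> C * \<omega> (s, t) powr (3 / p))))"

end

theory Submission
  imports Defs
begin

text \<open>
  In a chart, two integral curves \<open>z\<close> and \<open>w\<close> with \<open>z a = w a\<close> are compared as in A. M. Davie's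
  uniqueness argument for rough differential equations. Let \<open>R s t\<close> be the remainder of \<open>D = z - w\<close>
  in the difference of the two local expansions, and let \<open>\<kappa>\<close> be a constant with
  \<open>\<bar>R s t\<bar> \<le> \<kappa> \<omega>(s, t) powr (3 / p)\<close> on \<open>[a, c]\<close>. Since \<open>R a t = D t\<close>, this also controls
  \<open>D\<close>. By the algebraic relations of the rough path and admissibility, the defect
  \<open>R s t - R s u - R u t\<close> is of size \<open>\<kappa> \<epsilon> \<omega>(s, t) powr (3 / p)\<close> with
  \<open>\<epsilon> = \<omega>(a, c) powr (1 / p)\<close>. Choosing \<open>u\<close> so that both halves carry at most half of \<open>\<omega>(s, t)\<close>
  improves \<open>\<kappa>\<close> to \<open>(2 powr (1 - 3 / p) + M \<epsilon>) \<kappa>\<close>. As \<open>3 / p > 1\<close>, the factor is less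
  than 1 for \<open>c\<close> near \<open>a\<close>, hence \<open>R = 0\<close> and \<open>z = w\<close> there. The set of times up to which the
  curves agree is therefore open in \<open>[S, T]\<close>, and it is closed because the manifold is Hausdorff.
  The argument needs admissibility at all points of one chart, which follows from its invariance
  under changes of charts.
\<close>

section \<open>Difference estimates for functions of class \<open>C\<^sup>3\<close>\<close>

text \<open>The small factor \<epsilon> in the defect appears only if every term of the defect is
  linear in the distance between the two curves. Bounding the Taylor remainders of each curve
  separately is too crude for this: it gives a power of the step size but no factor \<kappa>. The
  remainders are therefore compared along two segments at once, which costs one derivative more than
  an estimate for a single curve; this is why the fields enter as functions of class C^3. The
  midpoint estimate is iterated on a fixed interval, so no sums over partitions occur, and the first
  value of \<kappa> is just the sum of the error constants of the two curves. On the manifold, fiber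
  coordinates are given by definite descriptions over classes of 2-jets. The second-order chain rule
  is the common source of their being well defined, of their change under charts and of the
  invariance of admissibility; symmetry of second derivatives is what allows the action of a jet to
  be evaluated.\<close>

abbreviation fderiv :: "('e::real_normed_vector \<Rightarrow> 'f::real_normed_vector) \<Rightarrow> 'e \<Rightarrow> 'e \<Rightarrow> 'f"
  where "fderiv f v h \<equiv> frechet_derivative f (at v) h"

lemma fderiv_bounded_linear: "f differentiable (at v) \<Longrightarrow> bounded_linear (fderiv f v)"
  by (rule has_derivative_bounded_linear[of f _ "at v"]) (simp add: frechet_derivative_works[symmetric])

lemma fderiv_eqI: "(f has_derivative f') (at v) \<Longrightarrow> fderiv f v h = f' h"
  by (simp add: frechet_derivative_at[symmetric])

lemma fderiv_basis:
  fixes f :: "'e::euclidean_space \<Rightarrow> 'f::real_normed_vector"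
  assumes "f differentiable (at v)"
  shows "fderiv f v h = (\<Sum>b\<in>Basis. (h \<bullet> b) *\<^sub>R fderiv f v b)"
proof -
  interpret bounded_linear "fderiv f v" by (rule fderiv_bounded_linear[OF assms])
  have "fderiv f v h = fderiv f v (\<Sum>b\<in>Basis. (h \<bullet> b) *\<^sub>R b)" by (simp add: euclidean_representation)
  then show ?thesis by (simp add: sum scale)
qed

lemma Ck_on_SucD: "Ck_on (Suc k) W f \<Longrightarrow> Ck_on k W f"
proof (induction k arbitrary: f)
  case 0
  then show ?case
    by (auto intro!: continuous_at_imp_continuous_on differentiable_imp_continuous_within)
next
  case (Suc k)
  then show ?case by simp
qed

lemma Ck_on_differentiable: "Ck_on (Suc k) W f \<Longrightarrow> v \<in> W \<Longrightarrow> f differentiable (at v)"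
  by simp

lemma Ck_on_fderiv: "Ck_on (Suc k) W f \<Longrightarrow> Ck_on k W (\<lambda>v. fderiv f v h)"
  by simp

lemma Ck_on_cong:
  assumes "open W" and "\<And>v. v \<in> W \<Longrightarrow> f v = g v" and "Ck_on k W f"
  shows "Ck_on k W g"
  using assms(2,3)
proof (induction k arbitrary: f g)
  case 0
  then show ?case using continuous_on_cong by fastforce
next
  case (Suc k)
  have *: "(g has_derivative fderiv f v) (at v)" if "v \<in> W" for v
  proof (rule has_derivative_transform_within_open[OF _ \<open>open W\<close> that])
    show "(f has_derivative fderiv f v) (at v)"
      using Suc.prems that by (simp add: frechet_derivative_works)
  qed (use Suc.prems in auto)
  then have "fderiv g v h = fderiv f v h" if "v \<in> W" for v h
    using fderiv_eqI that by metis
  with Suc.IH[of "\<lambda>v. fderiv f v h" "\<lambda>v. fderiv g v h" for h] Suc.prems(2) have "Ck_on k W (\<lambda>v. fderiv g v h)" for h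
    by simp
  with * show ?case by (auto simp: differentiable_def)
qed

lemma Ck_on_bounded_linear:
  assumes "open W" "bounded_linear B" "Ck_on k W f"
  shows "Ck_on k W (\<lambda>v. B (f v))"
  using assms(3)
proof (induction k arbitrary: f)
  case 0
  then show ?case
    using assms(2) by (simp add: bounded_linear.continuous_on)
next
  case (Suc k)
  have *: "((\<lambda>v. B (f v)) has_derivative (\<lambda>h. B (fderiv f v h))) (at v)" if "v \<in> W" for v
    using Suc.prems that by (auto intro!: bounded_linear.has_derivative[OF assms(2)] simp: frechet_derivative_works)
  have "Ck_on k W (\<lambda>v. fderiv (\<lambda>v. B (f v)) v h)" for h
  proof (rule Ck_on_cong[OF assms(1)])
    show "Ck_on k W (\<lambda>v. B (fderiv f v h))" using Suc by simp
  qed (use fderiv_eqI[OF *] in simp)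
  with * show ?case by (auto simp: differentiable_def)
qed

text \<open>\<open>Ck_on\<close> provides continuity of the derivative one direction at a time. The
  bound is therefore taken on the compact set for each basis vector, and the sum of these bounds
  takes the place of an operator norm.\<close>

lemma C1_fderiv_bound:
  fixes f :: "'e::euclidean_space \<Rightarrow> 'f::real_normed_vector"
  assumes "Ck_on (Suc 0) W f" "compact K" "K \<subseteq> W"
  obtains L where "L \<ge> 0" "\<And>v h. v \<in> K \<Longrightarrow> norm (fderiv f v h) \<le> L * norm h"
proof -
  have "\<exists>B. \<forall>v\<in>K. norm (fderiv f v b) \<le> B" for b
  proof -
    have "compact ((\<lambda>v. fderiv f v b) ` K)"
      using assms by (intro compact_continuous_image) (auto intro: continuous_on_subset)
    then show ?thesis by (fastforce dest: compact_imp_bounded simp: bounded_iff)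
  qed
  then obtain B where B: "\<And>b v. v \<in> K \<Longrightarrow> norm (fderiv f v b) \<le> B b" by metis
  show thesis
  proof
    show "(\<Sum>b\<in>Basis. \<bar>B b\<bar>) \<ge> 0" by (simp add: sum_nonneg)
    fix v h assume v: "v \<in> K"
    then have "fderiv f v h = (\<Sum>b\<in>Basis. (h \<bullet> b) *\<^sub>R fderiv f v b)"
      using assms by (intro fderiv_basis) auto
    also have "norm \<dots> \<le> (\<Sum>b\<in>Basis. norm h * \<bar>B b\<bar>)"
      by (intro sum_norm_le) (auto intro!: mult_mono Basis_le_norm order.trans[OF B[OF v]])
    finally show "norm (fderiv f v h) \<le> (\<Sum>b\<in>Basis. \<bar>B b\<bar>) * norm h"
      by (simp add: sum_distrib_left mult.commute)
  qed
qed

lemma C1_lipschitz: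
  fixes f :: "'e::euclidean_space \<Rightarrow> 'f::real_normed_vector"
  assumes "Ck_on (Suc 0) W f" "compact K" "K \<subseteq> W" "convex K"
  obtains L where "L \<ge> 0" "\<And>v w. v \<in> K \<Longrightarrow> w \<in> K \<Longrightarrow> norm (f v - f w) \<le> L * norm (v - w)"
proof -
  obtain L where L: "L \<ge> 0" "\<And>v h. v \<in> K \<Longrightarrow> norm (fderiv f v h) \<le> L * norm h"
    using C1_fderiv_bound[OF assms(1-3)] by blast
  show thesis
  proof
    show "L \<ge> 0" by (rule L)
    fix v w assume "v \<in> K" "w \<in> K"
    then show "norm (f v - f w) \<le> L * norm (v - w)"
    proof (intro differentiable_bound[OF assms(4), of f "fderiv f"])
      show "(f has_derivative fderiv f x) (at x within K)" if "x \<in> K" for x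
        using Ck_on_differentiable[OF assms(1)] assms(3) that
        by (meson frechet_derivative_works has_derivative_at_withinI subsetD)
      show "onorm (fderiv f x) \<le> L" if "x \<in> K" for x
        using L that by (intro onorm_le) auto
    qed auto
  qed
qed

lemma C2_fderiv_lipschitz:
  fixes f :: "'e::euclidean_space \<Rightarrow> 'f::real_normed_vector"
  assumes "Ck_on (Suc (Suc 0)) W f" "compact K" "K \<subseteq> W" "convex K"
  obtains L where "L \<ge> 0"
    "\<And>v w h. v \<in> K \<Longrightarrow> w \<in> K \<Longrightarrow> norm (fderiv f v h - fderiv f w h) \<le> L * norm (v - w) * norm h"
proof -
  have "\<exists>L\<ge>0. \<forall>v\<in>K. \<forall>w\<in>K. norm (fderiv f v b - fderiv f w b) \<le> L * norm (v - w)" for b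
    using C1_lipschitz[OF Ck_on_fderiv[OF assms(1)] assms(2-4)] by metis
  then obtain L where L: "\<And>b. L b \<ge> 0"
    "\<And>b v w. v \<in> K \<Longrightarrow> w \<in> K \<Longrightarrow> norm (fderiv f v b - fderiv f w b) \<le> L b * norm (v - w)" by metis
  show thesis
  proof
    show "(\<Sum>b\<in>Basis. L b) \<ge> 0" by (simp add: sum_nonneg L)
    fix v w h assume v: "v \<in> K" "w \<in> K"
    have "fderiv f u h = (\<Sum>b\<in>Basis. (h \<bullet> b) *\<^sub>R fderiv f u b)" if "u \<in> {v, w}" for u
      using Ck_on_differentiable[OF assms(1)] assms(3) that v by (intro fderiv_basis) blast
    then have "fderiv f v h - fderiv f w h = (\<Sum>b\<in>Basis. (h \<bullet> b) *\<^sub>R (fderiv f v b - fderiv f w b))"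
      by (simp add: sum_subtractf scaleR_diff_right)
    also have "norm \<dots> \<le> (\<Sum>b\<in>Basis. norm h * (L b * norm (v - w)))"
      by (intro sum_norm_le) (auto intro!: mult_mono Basis_le_norm L v)
    finally show "norm (fderiv f v h - fderiv f w h) \<le> (\<Sum>b\<in>Basis. L b) * norm (v - w) * norm h"
      by (simp add: sum_distrib_left sum_distrib_right mult_ac)
  qed
qed

lemma segment_in_convex:
  assumes "convex K" "z \<in> K" "z' \<in> K" "0 \<le> (r::real)" "r \<le> 1"
  shows "z + r *\<^sub>R (z' - z) \<in> K"
  using convexD_alt[OF assms(1-3), of r] assms by (simp add: algebra_simps)

lemma differentiable_along_segment:
  assumes "f differentiable (at (z + r *\<^sub>R h))"
  shows "((\<lambda>r. f (z + r *\<^sub>R h)) has_derivative (\<lambda>d. d *\<^sub>R fderiv f (z + r *\<^sub>R h) h)) (at r)"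
proof -
  have "(f has_derivative fderiv f (z + r *\<^sub>R h)) (at (z + r *\<^sub>R h))"
    using assms by (simp add: frechet_derivative_works)
  then have "((\<lambda>r. f (z + r *\<^sub>R h)) has_derivative (\<lambda>d. fderiv f (z + r *\<^sub>R h) (d *\<^sub>R h))) (at r)"
    by (rule has_derivative_compose[rotated]) (auto intro!: derivative_eq_intros)
  then show ?thesis
    by (simp add: bounded_linear.linear[OF fderiv_bounded_linear[OF assms]] linear_cmul)
qed

lemma mvt_unit_interval:
  fixes g :: "real \<Rightarrow> 'f::real_inner"
  assumes "\<And>r. 0 \<le> r \<Longrightarrow> r \<le> 1 \<Longrightarrow> (g has_derivative (\<lambda>d. d *\<^sub>R g' r)) (at r)"
    and "\<And>r. 0 \<le> r \<Longrightarrow> r \<le> 1 \<Longrightarrow> norm (g' r) \<le> B"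
  shows "norm (g 1 - g 0) \<le> B"
proof -
  have "\<exists>r\<in>{0<..<1}. norm (g 1 - g 0) \<le> norm ((1 - 0) *\<^sub>R g' r)"
  proof (rule mvt_general)
    show "continuous_on {0..1} g"
      using assms(1) by (auto intro!: continuous_at_imp_continuous_on has_derivative_continuous)
  qed (use assms(1) in auto)
  then obtain r where "0 < r" "r < 1" "norm (g 1 - g 0) \<le> norm (g' r)" by auto
  with assms(2)[of r] show ?thesis by simp
qed

text \<open>Both increments are traversed simultaneously by
  \<open>r \<mapsto> f (z + r h) - f (w + r k)\<close>. Its derivative splits into Df at the first
  point applied to \<open>h - k\<close>, and a difference of Df at the two points applied to
  \<open>k\<close>; the points are at most \<open>norm (z - w) + norm (h - k)\<close> apart.\<close>

lemma C2_four_point_bound: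
  fixes f :: "'e::euclidean_space \<Rightarrow> 'f::real_inner"
  assumes f: "Ck_on (Suc (Suc 0)) W f" and K: "compact K" "K \<subseteq> W" "convex K"
  obtains L where "L \<ge> 0"
    "\<And>z z' w w'. z \<in> K \<Longrightarrow> z' \<in> K \<Longrightarrow> w \<in> K \<Longrightarrow> w' \<in> K \<Longrightarrow>
      norm ((f z' - f z) - (f w' - f w))
        \<le> L * (norm ((z' - z) - (w' - w)) + norm (z - w) * norm (w' - w))"
proof -
  obtain L1 where L1: "L1 \<ge> 0" "\<And>v h. v \<in> K \<Longrightarrow> norm (fderiv f v h) \<le> L1 * norm h"
    using C1_fderiv_bound[OF Ck_on_SucD[OF f] K(1,2)] by blast
  obtain L2 where L2: "L2 \<ge> 0"
    "\<And>v w h. v \<in> K \<Longrightarrow> w \<in> K \<Longrightarrow> norm (fderiv f v h - fderiv f w h) \<le> L2 * norm (v - w) * norm h"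
    using C2_fderiv_lipschitz[OF f K] by blast
  \<comment> \<open>A bound on the diameter of \<open>K\<close>; it absorbs the mixed term
    \<open>\<rho> * norm k\<close> into a multiple of \<rho>.\<close>
  obtain d where d: "d > 0" "\<And>v w. v \<in> K \<Longrightarrow> w \<in> K \<Longrightarrow> norm (v - w) \<le> d"
    using bounded_two_points[of K] compact_imp_bounded[OF K(1)]
    by (metis dist_norm gt_ex less_le_not_le order.trans nle_le)
  show thesis
  proof
    show "L1 + L2 + L2 * d \<ge> 0" using L1 L2 d by simp
    fix z z' w w' assume in_K: "z \<in> K" "z' \<in> K" "w \<in> K" "w' \<in> K"
    define h k \<rho> where "h = z' - z" and "k = w' - w" and "\<rho> = norm (h - k)"
    have "norm (f (z + 1 *\<^sub>R h) - f (w + 1 *\<^sub>R k) - (f (z + 0 *\<^sub>R h) - f (w + 0 *\<^sub>R k)))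
        \<le> L1 * \<rho> + L2 * (norm (z - w) + \<rho>) * norm k"
    proof (rule mvt_unit_interval)
      fix r :: real assume r: "0 \<le> r" "r \<le> 1"
      let ?z = "z + r *\<^sub>R h" and ?w = "w + r *\<^sub>R k"
      have zw: "?z \<in> K" "?w \<in> K"
        using segment_in_convex[OF K(3)] in_K r by (auto simp: h_def k_def)
      then have diff: "f differentiable (at ?z)" "f differentiable (at ?w)"
        using Ck_on_differentiable[OF f] K(2) by blast+
      show "((\<lambda>r. f (z + r *\<^sub>R h) - f (w + r *\<^sub>R k)) has_derivative
          (\<lambda>d. d *\<^sub>R (fderiv f ?z h - fderiv f ?w k))) (at r)"
        unfolding scaleR_diff_right using diff by (intro has_derivative_diff differentiable_along_segment)
      have "fderiv f ?z h - fderiv f ?w k = fderiv f ?z (h - k) + (fderiv f ?z k - fderiv f ?w k)"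
        using bounded_linear.linear[OF fderiv_bounded_linear[OF diff(1)]] by (simp add: linear_diff)
      also have "norm \<dots> \<le> L1 * \<rho> + L2 * norm (?z - ?w) * norm k"
        using L1(2)[OF zw(1)] L2(2)[OF zw] unfolding \<rho>_def by (intro norm_triangle_mono)
      also have "norm (?z - ?w) \<le> norm (z - w) + \<rho>"
      proof -
        have "?z - ?w = (z - w) + r *\<^sub>R (h - k)" by (simp add: algebra_simps)
        also have "norm \<dots> \<le> norm (z - w) + \<bar>r\<bar> * \<rho>"
          by (rule norm_triangle_mono) (auto simp: \<rho>_def)
        also have "\<dots> \<le> norm (z - w) + \<rho>" using r by (simp add: \<rho>_def mult_left_le_one_le)
        finally show ?thesis .
      qed
      finally show "norm (fderiv f ?z h - fderiv f ?w k) \<le> L1 * \<rho> + L2 * (norm (z - w) + \<rho>) * norm k"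
        using L2(1) by (simp add: mult_left_mono mult_right_mono)
    qed
    also have "\<dots> \<le> L1 * \<rho> + L2 * (norm (z - w) * norm k + \<rho> * d)"
    proof -
      have "\<rho> * norm k \<le> \<rho> * d"
        using d(2)[OF in_K(4,3)] by (simp add: k_def \<rho>_def mult_left_mono)
      then have "L2 * (norm (z - w) * norm k + \<rho> * norm k) \<le> L2 * (norm (z - w) * norm k + \<rho> * d)"
        using L2(1) by (simp add: mult_left_mono)
      then show ?thesis by (simp add: algebra_simps)
    qed
    also have "\<dots> \<le> (L1 + L2 + L2 * d) * (\<rho> + norm (z - w) * norm k)"
    proof -
      have "0 \<le> L1 * (norm (z - w) * norm k) + L2 * \<rho> + L2 * d * (norm (z - w) * norm k)"
        using L1 L2 d by (simp add: \<rho>_def)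
      then show ?thesis by (simp add: algebra_simps)
    qed
    finally show "norm ((f z' - f z) - (f w' - f w))
        \<le> (L1 + L2 + L2 * d) * (norm ((z' - z) - (w' - w)) + norm (z - w) * norm (w' - w))"
      by (simp add: h_def k_def \<rho>_def algebra_simps)
  qed
qed

text \<open>The four-point bound is applied to each directional derivative, which is where the third
  order of differentiability is spent.\<close>

lemma C2_fderiv_four_point_bound:
  fixes f :: "'e::euclidean_space \<Rightarrow> 'f::real_inner"
  assumes f: "Ck_on (Suc (Suc (Suc 0))) W f" and K: "compact K" "K \<subseteq> W" "convex K"
  obtains L where "L \<ge> 0"
    "\<And>z z' w w' k. z \<in> K \<Longrightarrow> z' \<in> K \<Longrightarrow> w \<in> K \<Longrightarrow> w' \<in> K \<Longrightarrow>
      norm ((fderiv f z' k - fderiv f z k) - (fderiv f w' k - fderiv f w k))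
        \<le> L * (norm ((z' - z) - (w' - w)) + norm (z - w) * norm (w' - w)) * norm k"
proof -
  have "\<exists>L\<ge>0. \<forall>z\<in>K. \<forall>z'\<in>K. \<forall>w\<in>K. \<forall>w'\<in>K.
     norm ((fderiv f z' b - fderiv f z b) - (fderiv f w' b - fderiv f w b))
        \<le> L * (norm ((z' - z) - (w' - w)) + norm (z - w) * norm (w' - w))" for b
    by (rule C2_four_point_bound[OF Ck_on_fderiv[OF f] K, of b]) blast
  then obtain L where L: "\<And>b. L b \<ge> 0"
    "\<And>b z z' w w'. z \<in> K \<Longrightarrow> z' \<in> K \<Longrightarrow> w \<in> K \<Longrightarrow> w' \<in> K \<Longrightarrow>
     norm ((fderiv f z' b - fderiv f z b) - (fderiv f w' b - fderiv f w b))
        \<le> L b * (norm ((z' - z) - (w' - w)) + norm (z - w) * norm (w' - w))" by metis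
  show thesis
  proof
    show "(\<Sum>b\<in>Basis. L b) \<ge> 0" by (simp add: sum_nonneg L)
    fix z z' w w' k assume v: "z \<in> K" "z' \<in> K" "w \<in> K" "w' \<in> K"
    define N where "N = norm ((z' - z) - (w' - w)) + norm (z - w) * norm (w' - w)"
    define e where "e b = (fderiv f z' b - fderiv f z b) - (fderiv f w' b - fderiv f w b)" for b
    have e_le: "norm (e b) \<le> L b * N" for b
      unfolding e_def N_def by (rule L(2)[OF v])
    have "fderiv f u k = (\<Sum>b\<in>Basis. (k \<bullet> b) *\<^sub>R fderiv f u b)" if "u \<in> {z, z', w, w'}" for u
    proof -
      have "u \<in> W" using K(2) v that by auto
      then show ?thesis by (intro fderiv_basis Ck_on_differentiable[OF f])
    qed
    then have "e k = (\<Sum>b\<in>Basis. (k \<bullet> b) *\<^sub>R e b)"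
      by (simp add: e_def sum_subtractf scaleR_diff_right)
    also have "norm \<dots> \<le> (\<Sum>b\<in>Basis. norm k * (L b * N))"
      by (intro sum_norm_le) (auto intro!: mult_mono Basis_le_norm e_le)
    also have "\<dots> = (\<Sum>b\<in>Basis. L b) * N * norm k"
      by (simp add: sum_distrib_left sum_distrib_right mult_ac)
    finally show "norm ((fderiv f z' k - fderiv f z k) - (fderiv f w' k - fderiv f w k))
        \<le> (\<Sum>b\<in>Basis. L b) * (norm ((z' - z) - (w' - w)) + norm (z - w) * norm (w' - w)) * norm k"
      unfolding e_def N_def .
  qed
qed

text \<open>Subtracting \<open>r\<close> times the linear parts turns the total variation of
  \<open>?g\<close> into the difference of the two Taylor remainders. The derivative of
  \<open>?g\<close> is (Df at \<open>?z\<close> minus Df at \<open>z\<close>) applied to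
  \<open>h - k\<close>, plus a four-point difference of Df applied to \<open>k\<close>. Each part is
  small in the distance between the two configurations and carries the powers of the increments that
  appear in the bound.\<close>

lemma C3_taylor_difference_bound:
  fixes f :: "'e::euclidean_space \<Rightarrow> 'f::real_inner"
  assumes f: "Ck_on (Suc (Suc (Suc 0))) W f" and K: "compact K" "K \<subseteq> W" "convex K"
  obtains L where "L \<ge> 0"
    "\<And>z z' w w'. z \<in> K \<Longrightarrow> z' \<in> K \<Longrightarrow> w \<in> K \<Longrightarrow> w' \<in> K \<Longrightarrow>
      norm ((f z' - f z - fderiv f z (z' - z)) - (f w' - f w - fderiv f w (w' - w)))
        \<le> L * (norm ((z' - z) - (w' - w)) * (norm (z' - z) + norm (w' - w))
             + norm (z - w) * norm (w' - w) ^ 2)"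
proof -
  obtain L2 where L2: "L2 \<ge> 0"
    "\<And>v w h. v \<in> K \<Longrightarrow> w \<in> K \<Longrightarrow> norm (fderiv f v h - fderiv f w h) \<le> L2 * norm (v - w) * norm h"
    using C2_fderiv_lipschitz[OF Ck_on_SucD[OF f] K] by blast
  obtain L where L: "L \<ge> 0"
    "\<And>z z' w w' k. z \<in> K \<Longrightarrow> z' \<in> K \<Longrightarrow> w \<in> K \<Longrightarrow> w' \<in> K \<Longrightarrow>
      norm ((fderiv f z' k - fderiv f z k) - (fderiv f w' k - fderiv f w k))
        \<le> L * (norm ((z' - z) - (w' - w)) + norm (z - w) * norm (w' - w)) * norm k"
    using C2_fderiv_four_point_bound[OF f K] by blast
  show thesis
  proof
    show "L2 + L \<ge> 0" using L L2 by simp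
    fix z z' w w' assume in_K: "z \<in> K" "z' \<in> K" "w \<in> K" "w' \<in> K"
    define h k \<rho> where "h = z' - z" and "k = w' - w" and "\<rho> = norm (h - k)"
    let ?g = "\<lambda>r. f (z + r *\<^sub>R h) - f (w + r *\<^sub>R k) - r *\<^sub>R (fderiv f z h - fderiv f w k)"
    have "norm (?g 1 - ?g 0) \<le> L2 * norm h * \<rho> + L * (\<rho> + norm (z - w) * norm k) * norm k"
    proof (rule mvt_unit_interval)
      fix r :: real assume r: "0 \<le> r" "r \<le> 1"
      let ?z = "z + r *\<^sub>R h" and ?w = "w + r *\<^sub>R k"
      let ?g' = "fderiv f ?z h - fderiv f ?w k - (fderiv f z h - fderiv f w k)"
      have zw: "?z \<in> K" "?w \<in> K"
        using segment_in_convex[OF K(3)] in_K r by (auto simp: h_def k_def)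
      then have diff: "f differentiable (at ?z)" "f differentiable (at ?w)" "f differentiable (at z)"
        using Ck_on_differentiable[OF f] K(2) in_K by blast+
      show "(?g has_derivative (\<lambda>d. d *\<^sub>R ?g')) (at r)"
        unfolding scaleR_diff_right using diff
        by (intro has_derivative_diff differentiable_along_segment) (auto intro!: derivative_eq_intros)
      have "?g' = (fderiv f ?z (h - k) - fderiv f z (h - k))
          + ((fderiv f ?z k - fderiv f z k) - (fderiv f ?w k - fderiv f w k))"
        using bounded_linear.linear[OF fderiv_bounded_linear[OF diff(1)]]
          bounded_linear.linear[OF fderiv_bounded_linear[OF diff(3)]] by (simp add: linear_diff)
      also have "norm \<dots> \<le> L2 * norm h * \<rho> + L * (\<rho> + norm (z - w) * norm k) * norm k"
      proof (rule norm_triangle_mono)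
        have "norm (fderiv f ?z (h - k) - fderiv f z (h - k)) \<le> L2 * norm (r *\<^sub>R h) * \<rho>"
          using L2(2)[OF zw(1) in_K(1), of "h - k"] by (simp add: \<rho>_def)
        also have "\<dots> \<le> L2 * norm h * \<rho>"
          using r L2(1) by (auto simp: \<rho>_def mult_left_le_one_le intro!: mult_right_mono mult_left_mono)
        finally show "norm (fderiv f ?z (h - k) - fderiv f z (h - k)) \<le> L2 * norm h * \<rho>" .
        have "norm ((fderiv f ?z k - fderiv f z k) - (fderiv f ?w k - fderiv f w k))
          \<le> L * (norm (r *\<^sub>R (h - k)) + norm (z - w) * norm (r *\<^sub>R k)) * norm k"
          using L(2)[OF in_K(1) zw(1) in_K(3) zw(2), of k] by (simp add: scaleR_diff_right)
        also have "\<dots> \<le> L * (\<rho> + norm (z - w) * norm k) * norm k"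
          using r L(1) by (auto simp: \<rho>_def mult_left_le_one_le
            intro!: mult_right_mono[of _ _ "norm k"] mult_left_mono add_mono)
        finally show "norm ((fderiv f ?z k - fderiv f z k) - (fderiv f ?w k - fderiv f w k))
          \<le> L * (\<rho> + norm (z - w) * norm k) * norm k" .
      qed
      finally show "norm ?g' \<le> L2 * norm h * \<rho> + L * (\<rho> + norm (z - w) * norm k) * norm k" .
    qed
    also have "\<dots> \<le> (L2 + L) * (\<rho> * (norm h + norm k) + norm (z - w) * norm k ^ 2)"
    proof -
      have "0 \<le> L2 * (\<rho> * norm k) + L2 * (norm (z - w) * norm k ^ 2) + L * (\<rho> * norm h)"
        using L L2 by (simp add: \<rho>_def)
      then show ?thesis by (simp add: algebra_simps power2_eq_square)
    qed
    finally show "norm ((f z' - f z - fderiv f z (z' - z)) - (f w' - f w - fderiv f w (w' - w)))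
        \<le> (L2 + L) * (norm ((z' - z) - (w' - w)) * (norm (z' - z) + norm (w' - w))
             + norm (z - w) * norm (w' - w) ^ 2)"
      by (simp add: h_def k_def \<rho>_def algebra_simps)
  qed
qed

section \<open>Expansions along a branched rough path\<close>

lemma sum_forest:
  fixes g :: "'n::finite forest \<Rightarrow> 'b::comm_monoid_add"
  shows "(\<Sum>\<tau>\<in>UNIV. g \<tau>) =
    (\<Sum>\<alpha>\<in>UNIV. g (Vtx \<alpha>)) + (\<Sum>P\<in>UNIV. g (Dots P)) + (\<Sum>\<alpha>\<in>UNIV. \<Sum>\<beta>\<in>UNIV. g (Ladder \<alpha> \<beta>))"
proof -
  have U: "(UNIV :: 'n forest set) = range Vtx \<union> range Dots \<union> range (\<lambda>(a, b). Ladder a b)"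
  proof
    show "(UNIV :: 'n forest set) \<subseteq> range Vtx \<union> range Dots \<union> range (\<lambda>(a, b). Ladder a b)"
    proof
      fix x :: "'n forest"
      show "x \<in> range Vtx \<union> range Dots \<union> range (\<lambda>(a, b). Ladder a b)" by (cases x) auto
    qed
  qed simp
  have "(\<Sum>\<tau>\<in>UNIV. g \<tau>) = sum g (range Vtx) + sum g (range Dots) + sum g (range (\<lambda>(a, b). Ladder a b))"
    unfolding U by (subst sum.union_disjoint; (subst sum.union_disjoint)?) auto
  also have "sum g (range (\<lambda>(a, b). Ladder a b)) = (\<Sum>\<alpha>\<in>UNIV. \<Sum>\<beta>\<in>UNIV. g (Ladder \<alpha> \<beta>))"
    by (subst sum.reindex) (auto simp: inj_on_def sum.cartesian_product case_prod_beta UNIV_Times_UNIV)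
  finally show ?thesis by (simp add: sum.reindex inj_on_def)
qed

text \<open>An unordered pair has two orderings if its entries differ and one otherwise, so
  \<open>1 / sym_factor\<close> is half the number of orderings in both cases. Summing over ordered
  pairs with weight 1/2 removes the symmetry factor.\<close>

lemma sum_uprod:
  fixes h :: "'n::finite uprod \<Rightarrow> 'b::real_vector"
  shows "(\<Sum>P\<in>UNIV. (1 / sym_factor (Dots P)) *\<^sub>R h P)
    = (\<Sum>\<alpha>\<in>UNIV. \<Sum>\<beta>\<in>UNIV. (1 / 2) *\<^sub>R h (Upair \<alpha> \<beta>))"
proof -
  let ?U = "\<lambda>z::'n \<times> 'n. Upair (fst z) (snd z)"
  have "(\<Sum>\<alpha>\<in>UNIV. \<Sum>\<beta>\<in>UNIV. (1 / 2) *\<^sub>R h (Upair \<alpha> \<beta>)) = (\<Sum>z\<in>UNIV. (1 / 2) *\<^sub>R h (?U z))"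
    by (simp add: sum.cartesian_product case_prod_beta UNIV_Times_UNIV)
  also have "\<dots> = (\<Sum>P\<in>UNIV. \<Sum>z\<in>{z\<in>UNIV. ?U z = P}. (1 / 2) *\<^sub>R h (?U z))"
    by (rule sum.group[symmetric]) auto
  also have "\<dots> = (\<Sum>P\<in>UNIV. (1 / sym_factor (Dots P)) *\<^sub>R h P)"
  proof (rule sum.cong[OF refl])
    fix P :: "'n uprod"
    obtain \<alpha> \<beta> where P: "P = Upair \<alpha> \<beta>" by (cases P)
    have *: "{z\<in>UNIV. ?U z = P} = {(\<alpha>, \<beta>), (\<beta>, \<alpha>)}" by (auto simp: P)
    show "(\<Sum>z\<in>{z\<in>UNIV. ?U z = P}. (1 / 2) *\<^sub>R h (?U z)) = (1 / sym_factor (Dots P)) *\<^sub>R h P"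
    proof (cases "\<alpha> = \<beta>")
      case False
      have "h (Upair \<beta> \<alpha>) = h (Upair \<alpha> \<beta>)" by (metis Upair_inject)
      then show ?thesis unfolding * using False by (simp add: P flip: scaleR_left_distrib)
    qed (unfold *, simp add: P)
  qed
  finally show ?thesis by simp
qed

text \<open>The values of \<open>g\<close> lie in an arbitrary vector space, so that one operator
  serves for the fields at a point, for their differences along two curves and for their images
  under a derivative.\<close>

definition level1 :: "('n::finite forest \<Rightarrow> 'z \<Rightarrow> real) \<Rightarrow> 'z \<Rightarrow> ('n \<Rightarrow> 'b) \<Rightarrow> 'b::real_vector"
  where "level1 X r g = (\<Sum>\<alpha>\<in>UNIV. X (Vtx \<alpha>) r *\<^sub>R g \<alpha>)"

definition level2 :: "('n::finite forest \<Rightarrow> 'z \<Rightarrow> real) \<Rightarrow> 'z \<Rightarrow> ('n forest \<Rightarrow> 'b) \<Rightarrow> 'b::real_vector"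
  where "level2 X r g = (\<Sum>\<alpha>\<in>UNIV. \<Sum>\<beta>\<in>UNIV.
    (X (Dot \<alpha> \<beta>) r / 2) *\<^sub>R g (Dot \<alpha> \<beta>) + X (Ladder \<alpha> \<beta>) r *\<^sub>R g (Ladder \<alpha> \<beta>))"

lemma sum_forest_levels:
  fixes g :: "'n::finite forest \<Rightarrow> 'b::real_vector"
  shows "(\<Sum>\<tau>\<in>UNIV. (1 / sym_factor \<tau> * X \<tau> r) *\<^sub>R g \<tau>) = level1 X r (\<lambda>\<alpha>. g (Vtx \<alpha>)) + level2 X r g"
proof -
  have "(\<Sum>P\<in>UNIV. (1 / sym_factor (Dots P) * X (Dots P) r) *\<^sub>R g (Dots P))
      = (\<Sum>P\<in>UNIV. (1 / sym_factor (Dots P)) *\<^sub>R (X (Dots P) r *\<^sub>R g (Dots P)))" by simp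
  also have "\<dots> = (\<Sum>\<alpha>\<in>UNIV. \<Sum>\<beta>\<in>UNIV. (X (Dot \<alpha> \<beta>) r / 2) *\<^sub>R g (Dot \<alpha> \<beta>))"
    by (subst sum_uprod) simp
  finally show ?thesis
    by (simp add: sum_forest level1_def level2_def sum.distrib)
qed

lemma level1_diff: "level1 X r (\<lambda>\<alpha>. g \<alpha> - h \<alpha>) = level1 X r g - level1 X r h"
  by (simp add: level1_def scaleR_diff_right sum_subtractf)

lemma level2_diff: "level2 X r (\<lambda>\<tau>. g \<tau> - h \<tau>) = level2 X r g - level2 X r h"
  by (simp add: level2_def scaleR_diff_right sum_subtractf sum.distrib)

lemma norm_level1_le:
  fixes g :: "'n::finite \<Rightarrow> 'b::real_normed_vector"
  assumes "\<And>\<alpha>. \<bar>X (Vtx \<alpha>) r\<bar> \<le> L" "\<And>\<alpha>. norm (g \<alpha>) \<le> G"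
  shows "norm (level1 X r g) \<le> real CARD('n) * L * G"
proof -
  have "norm (level1 X r g) \<le> (\<Sum>\<alpha>\<in>(UNIV::'n set). L * G)"
    unfolding level1_def
    by (intro sum_norm_le) (auto intro!: mult_mono assms order.trans[OF abs_ge_zero assms(1)])
  then show ?thesis by simp
qed

lemma norm_level2_le:
  fixes g :: "'n::finite forest \<Rightarrow> 'b::real_normed_vector"
  assumes "\<And>\<alpha> \<beta>. \<bar>X (Dot \<alpha> \<beta>) r\<bar> \<le> L" "\<And>\<alpha> \<beta>. \<bar>X (Ladder \<alpha> \<beta>) r\<bar> \<le> L" "\<And>\<tau>. norm (g \<tau>) \<le> G"
  shows "norm (level2 X r g) \<le> 2 * real CARD('n) ^ 2 * L * G"
proof -
  have L: "0 \<le> L" using order.trans[OF abs_ge_zero assms(1)] .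
  have G: "0 \<le> G" using order.trans[OF norm_ge_zero assms(3)] .
  have "norm (level2 X r g) \<le> (\<Sum>\<alpha>\<in>(UNIV::'n set). \<Sum>\<beta>\<in>(UNIV::'n set). 2 * (L * G))"
    unfolding level2_def
  proof (intro sum_norm_le)
    fix \<alpha> \<beta> :: 'n
    have "norm ((X (Dot \<alpha> \<beta>) r / 2) *\<^sub>R g (Dot \<alpha> \<beta>)) \<le> L * G"
      unfolding norm_scaleR using assms(1)[of \<alpha> \<beta>] by (intro mult_mono assms(3) L) auto
    moreover have "norm (X (Ladder \<alpha> \<beta>) r *\<^sub>R g (Ladder \<alpha> \<beta>)) \<le> L * G"
      unfolding norm_scaleR by (intro mult_mono assms L) auto
    ultimately show "norm ((X (Dot \<alpha> \<beta>) r / 2) *\<^sub>R g (Dot \<alpha> \<beta>) + X (Ladder \<alpha> \<beta>) r *\<^sub>R g (Ladder \<alpha> \<beta>))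
        \<le> 2 * (L * G)"
      by (intro norm_triangle_le) linarith
  qed
  then show ?thesis by (simp add: power2_eq_square algebra_simps)
qed

lemma level1_chen:
  assumes "branched_rough_path S T p \<omega> X" "S \<le> s" "s \<le> u" "u \<le> t" "t \<le> T"
  shows "level1 X (s, t) g = level1 X (s, u) g + level1 X (u, t) g"
proof -
  have "X (Vtx \<alpha>) (s, t) = X (Vtx \<alpha>) (s, u) + X (Vtx \<alpha>) (u, t)" for \<alpha>
    using assms unfolding branched_rough_path_def by blast
  then show ?thesis by (simp add: level1_def scaleR_left_distrib sum.distrib)
qed

text \<open>With x and y the first-level increments over [s, u] and [u, t], the product for
  \<open>Dot \<alpha> \<beta>\<close> has the cross terms \<open>x \<alpha> * y \<beta>\<close> and
  \<open>y \<alpha> * x \<beta>\<close>, each with weight 1/2. As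
  \<open>g (Dot \<alpha> \<beta>)\<close> is symmetric, the two sums agree and add up to one with
  full weight. The ladders contribute the same coefficients, hence the sum
  \<open>Dot + Ladder\<close>, which is the right side of admissibility.\<close>

lemma level2_chen:
  fixes g :: "'n::finite forest \<Rightarrow> 'b::real_vector"
  assumes "branched_rough_path S T p \<omega> X" "S \<le> s" "s \<le> u" "u \<le> t" "t \<le> T"
  shows "level2 X (s, t) g = level2 X (s, u) g + level2 X (u, t) g
    + level1 X (u, t) (\<lambda>\<beta>. level1 X (s, u) (\<lambda>\<alpha>. g (Dot \<alpha> \<beta>) + g (Ladder \<alpha> \<beta>)))"
proof -
  let ?x = "\<lambda>\<alpha>. X (Vtx \<alpha>) (s, u)" and ?y = "\<lambda>\<alpha>. X (Vtx \<alpha>) (u, t)"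
  have *: "X (Vtx \<alpha>) (s, t) = X (Vtx \<alpha>) (s, u) + X (Vtx \<alpha>) (u, t)"
       "X (Dot \<alpha> \<beta>) (s, t) = X (Vtx \<alpha>) (s, t) * X (Vtx \<beta>) (s, t)"
       "X (Ladder \<alpha> \<beta>) (s, t) =
         X (Ladder \<alpha> \<beta>) (s, u) + X (Ladder \<alpha> \<beta>) (u, t) + X (Vtx \<alpha>) (s, u) * X (Vtx \<beta>) (u, t)" for \<alpha> \<beta>
    using assms unfolding branched_rough_path_def by blast+
  have **: "X (Dot \<alpha> \<beta>) (s, u) = X (Vtx \<alpha>) (s, u) * X (Vtx \<beta>) (s, u)"
       "X (Dot \<alpha> \<beta>) (u, t) = X (Vtx \<alpha>) (u, t) * X (Vtx \<beta>) (u, t)" for \<alpha> \<beta>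
    using assms unfolding branched_rough_path_def by (meson order.refl order.trans)+
  have dot: "X (Dot \<alpha> \<beta>) (s, t) / 2 = X (Dot \<alpha> \<beta>) (s, u) / 2 + X (Dot \<alpha> \<beta>) (u, t) / 2
       + (?x \<alpha> * ?y \<beta> / 2 + ?y \<alpha> * ?x \<beta> / 2)" for \<alpha> \<beta>
    by (simp add: *(1,2) ** field_simps)
  have "(\<Sum>\<alpha>\<in>UNIV. \<Sum>\<beta>\<in>UNIV. (?y \<alpha> * ?x \<beta> / 2) *\<^sub>R g (Dot \<alpha> \<beta>))
      = (\<Sum>\<alpha>\<in>UNIV. \<Sum>\<beta>\<in>UNIV. (?x \<alpha> * ?y \<beta> / 2) *\<^sub>R g (Dot \<alpha> \<beta>))"
  proof (subst sum.swap, intro sum.cong refl)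
    fix \<alpha> \<beta> :: 'n
    have "Dot \<beta> \<alpha> = Dot \<alpha> \<beta>" by simp
    then show "(?y \<beta> * ?x \<alpha> / 2) *\<^sub>R g (Dot \<beta> \<alpha>) = (?x \<alpha> * ?y \<beta> / 2) *\<^sub>R g (Dot \<alpha> \<beta>)"
      by (simp only: mult.commute)
  qed
  moreover have "(\<Sum>\<alpha>\<in>UNIV. \<Sum>\<beta>\<in>UNIV. (?x \<alpha> * ?y \<beta>) *\<^sub>R g (Dot \<alpha> \<beta>)) =
      (\<Sum>\<alpha>\<in>UNIV. \<Sum>\<beta>\<in>UNIV. (?x \<alpha> * ?y \<beta> / 2) *\<^sub>R g (Dot \<alpha> \<beta>) + (?x \<alpha> * ?y \<beta> / 2) *\<^sub>R g (Dot \<alpha> \<beta>))"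
    by (simp flip: scaleR_left_distrib)
  ultimately have cross: "(\<Sum>\<alpha>\<in>UNIV. \<Sum>\<beta>\<in>UNIV. (?x \<alpha> * ?y \<beta> / 2 + ?y \<alpha> * ?x \<beta> / 2) *\<^sub>R g (Dot \<alpha> \<beta>))
      = (\<Sum>\<alpha>\<in>UNIV. \<Sum>\<beta>\<in>UNIV. (?x \<alpha> * ?y \<beta>) *\<^sub>R g (Dot \<alpha> \<beta>))"
    by (simp only: scaleR_left_distrib sum.distrib)
  have "level1 X (u, t) (\<lambda>\<beta>. level1 X (s, u) (\<lambda>\<alpha>. g (Dot \<alpha> \<beta>) + g (Ladder \<alpha> \<beta>)))
      = (\<Sum>\<alpha>\<in>UNIV. \<Sum>\<beta>\<in>UNIV. (?x \<alpha> * ?y \<beta>) *\<^sub>R (g (Dot \<alpha> \<beta>) + g (Ladder \<alpha> \<beta>)))"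
    unfolding level1_def by (subst sum.swap) (simp add: scaleR_sum_right mult.commute)
  then show ?thesis
    by (simp only: level2_def dot *(3) scaleR_left_distrib scaleR_right_distrib sum.distrib)
      (use cross in \<open>simp add: scaleR_left_distrib sum.distrib\<close>)
qed

section \<open>Control functions\<close>

lemma control_nonneg: "control_function S T \<omega> \<Longrightarrow> S \<le> s \<Longrightarrow> s \<le> t \<Longrightarrow> t \<le> T \<Longrightarrow> 0 \<le> \<omega> (s, t)"
  by (auto simp: control_function_def simplex2_def)

lemma control_mono:
  assumes "control_function S T \<omega>" "S \<le> s" "s \<le> s'" "s' \<le> t'" "t' \<le> t" "t \<le> T"
  shows "\<omega> (s', t') \<le> \<omega> (s, t)"
proof -
  have "\<omega> (s, t) \<ge> \<omega> (s, s') + \<omega> (s', t)" "\<omega> (s', t) \<ge> \<omega> (s', t') + \<omega> (t', t)"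
    using assms unfolding control_function_def by auto
  moreover have "\<omega> (s, s') \<ge> 0" "\<omega> (t', t) \<ge> 0" using assms by (auto intro: control_nonneg)
  ultimately show ?thesis by simp
qed

lemma control_continuous_right:
  assumes "control_function S T \<omega>" "S \<le> s" "t \<le> T"
  shows "continuous_on {s..t} (\<lambda>u. \<omega> (s, u))"
proof -
  have "continuous_on (simplex2 {S..T}) \<omega>" using assms(1) by (simp add: control_function_def)
  then show ?thesis
    by (rule continuous_on_compose2) (use assms in \<open>auto simp: simplex2_def intro!: continuous_intros\<close>)
qed

text \<open>The point halves \<omega> and not time: the intermediate value theorem gives equality on
  the left part, and superadditivity leaves at most half for the right part.\<close>

lemma control_midpoint:
  assumes "control_function S T \<omega>" "S \<le> s" "s \<le> t" "t \<le> T"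
  obtains u where "s \<le> u" "u \<le> t" "\<omega> (s, u) \<le> \<omega> (s, t) / 2" "\<omega> (u, t) \<le> \<omega> (s, t) / 2"
proof -
  have "\<exists>u\<ge>s. u \<le> t \<and> \<omega> (s, u) = \<omega> (s, t) / 2"
  proof (rule IVT')
    show "\<omega> (s, s) \<le> \<omega> (s, t) / 2" "\<omega> (s, t) / 2 \<le> \<omega> (s, t)"
      using assms control_nonneg[OF assms] by (auto simp: control_function_def)
  qed (use assms control_continuous_right in auto)
  then obtain u where u: "s \<le> u" "u \<le> t" "\<omega> (s, u) = \<omega> (s, t) / 2" by blast
  moreover have "\<omega> (s, t) \<ge> \<omega> (s, u) + \<omega> (u, t)"
    using assms u unfolding control_function_def by auto
  ultimately show thesis using that by auto
qed

lemma control_small: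
  assumes "control_function S T \<omega>" "S \<le> a" "a < b" "b \<le> T" "0 < \<delta>"
  obtains c where "a < c" "c \<le> b" "\<omega> (a, c) < \<delta>"
proof -
  have "continuous (at a within {a..b}) (\<lambda>u. \<omega> (a, u))"
    using control_continuous_right[of S T \<omega> a b] assms by (simp add: continuous_on_eq_continuous_within)
  moreover have "\<omega> (a, a) = 0" using assms by (simp add: control_function_def)
  ultimately obtain d where d: "d > 0" "\<And>u. u \<in> {a..b} \<Longrightarrow> dist u a < d \<Longrightarrow> dist (\<omega> (a, u)) 0 < \<delta>"
    using assms(5) unfolding continuous_within_eps_delta by metis
  let ?c = "min b (a + d / 2)"
  have "\<omega> (a, ?c) < \<delta>" using d(2)[of ?c] d(1) assms by (auto simp: dist_real_def min_def)
  then show thesis using that[of ?c] d(1) assms by auto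
qed

text \<open>One constant serves all estimates. Each of them persists when \<open>L\<close> grows, so
  the separate constants, and those of finitely many fields, can be merged by statements of the form
  \<open>eventually ... at_top\<close>.\<close>

definition regular_bound :: "real \<Rightarrow> 'e::real_normed_vector set \<Rightarrow> ('e \<Rightarrow> 'f::real_normed_vector) \<Rightarrow> bool"
  where "regular_bound L K f \<longleftrightarrow>
    (\<forall>v\<in>K. f differentiable (at v)) \<and>
    (\<forall>v\<in>K. norm (f v) \<le> L) \<and>
    (\<forall>v\<in>K. \<forall>w\<in>K. norm (f v - f w) \<le> L * norm (v - w)) \<and>
    (\<forall>v\<in>K. \<forall>h. norm (fderiv f v h) \<le> L * norm h) \<and>
    (\<forall>v\<in>K. \<forall>w\<in>K. \<forall>h. norm (fderiv f v h - fderiv f w h) \<le> L * (norm (v - w) * norm h)) \<and>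
    (\<forall>z\<in>K. \<forall>z'\<in>K. \<forall>w\<in>K. \<forall>w'\<in>K. norm ((f z' - f z) - (f w' - f w))
        \<le> L * (norm ((z' - z) - (w' - w)) + norm (z - w) * norm (w' - w))) \<and>
    (\<forall>z\<in>K. \<forall>z'\<in>K. \<forall>w\<in>K. \<forall>w'\<in>K.
      norm ((f z' - f z - fderiv f z (z' - z)) - (f w' - f w - fderiv f w (w' - w)))
        \<le> L * (norm ((z' - z) - (w' - w)) * (norm (z' - z) + norm (w' - w))
             + norm (z - w) * norm (w' - w) ^ 2))"

lemma eventually_bound_at_top:
  fixes g h :: "'q \<Rightarrow> real"
  assumes "\<And>q. q \<in> A \<Longrightarrow> g q \<le> L0 * h q" "\<And>q. q \<in> A \<Longrightarrow> 0 \<le> h q"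
  shows "eventually (\<lambda>L. \<forall>q\<in>A. g q \<le> L * h q) at_top"
  using eventually_ge_at_top[of L0]
  by eventually_elim (meson assms mult_right_mono order.trans)

lemma eventually_regular_bound:
  fixes f :: "'e::euclidean_space \<Rightarrow> 'f::real_inner"
  assumes f: "Ck_on (Suc (Suc (Suc 0))) W f" and K: "compact K" "K \<subseteq> W" "convex K"
  shows "eventually (\<lambda>L. regular_bound L K f) at_top"
proof -
  have d: "\<forall>v\<in>K. f differentiable (at v)" using Ck_on_differentiable[OF f] K by blast
  have "continuous_on K f"
    using Ck_on_SucD[OF Ck_on_SucD[OF Ck_on_SucD[OF f]]] K by (auto intro: continuous_on_subset)
  then have "bounded (f ` K)" by (intro compact_imp_bounded compact_continuous_image K)
  then obtain B where B: "\<forall>v\<in>K. norm (f v) \<le> B" by (auto simp: bounded_iff)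
  then have 1: "eventually (\<lambda>L. \<forall>v\<in>K. norm (f v) \<le> L) at_top"
    by (intro eventually_mono[OF eventually_ge_at_top[of B]]) (meson order.trans)
  have 2: "eventually (\<lambda>L. \<forall>v\<in>K. \<forall>w\<in>K. norm (f v - f w) \<le> L * norm (v - w)) at_top"
  proof -
    obtain L where "L \<ge> 0" "\<And>v w. v \<in> K \<Longrightarrow> w \<in> K \<Longrightarrow> norm (f v - f w) \<le> L * norm (v - w)"
      using C1_lipschitz[OF Ck_on_SucD[OF Ck_on_SucD[OF f]] K] by blast
    then have "eventually (\<lambda>L. \<forall>(v, w)\<in>K \<times> K. norm (f v - f w) \<le> L * norm (v - w)) at_top"
      unfolding case_prod_beta by (intro eventually_bound_at_top[of _ _ L]) auto
    then show ?thesis by eventually_elim auto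
  qed
  have 3: "eventually (\<lambda>L. \<forall>v\<in>K. \<forall>h. norm (fderiv f v h) \<le> L * norm h) at_top"
  proof -
    obtain L where "L \<ge> 0" "\<And>v h. v \<in> K \<Longrightarrow> norm (fderiv f v h) \<le> L * norm h"
      using C1_fderiv_bound[OF Ck_on_SucD[OF Ck_on_SucD[OF f]] K(1,2)] by blast
    then have "eventually (\<lambda>L. \<forall>(v, h)\<in>K \<times> UNIV. norm (fderiv f v h) \<le> L * norm h) at_top"
      unfolding case_prod_beta by (intro eventually_bound_at_top[of _ _ L]) auto
    then show ?thesis by eventually_elim auto
  qed
  have 4: "eventually (\<lambda>L. \<forall>v\<in>K. \<forall>w\<in>K. \<forall>h.
     norm (fderiv f v h - fderiv f w h) \<le> L * (norm (v - w) * norm h)) at_top"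
  proof -
    obtain L where L: "L \<ge> 0" "\<And>v w h. v \<in> K \<Longrightarrow> w \<in> K \<Longrightarrow>
        norm (fderiv f v h - fderiv f w h) \<le> L * norm (v - w) * norm h"
      using C2_fderiv_lipschitz[OF Ck_on_SucD[OF f] K] by blast
    have "eventually (\<lambda>L. \<forall>(v, w, h)\<in>K \<times> K \<times> UNIV.
       norm (fderiv f v h - fderiv f w h) \<le> L * (norm (v - w) * norm h)) at_top"
      unfolding case_prod_beta
      by (rule eventually_bound_at_top[of _ _ L]) (use L in \<open>auto simp: mult.assoc\<close>)
    then show ?thesis by eventually_elim auto
  qed
  have 5: "eventually (\<lambda>L. \<forall>z\<in>K. \<forall>z'\<in>K. \<forall>w\<in>K. \<forall>w'\<in>K. norm ((f z' - f z) - (f w' - f w))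
        \<le> L * (norm ((z' - z) - (w' - w)) + norm (z - w) * norm (w' - w))) at_top"
  proof -
    obtain L where L: "L \<ge> 0" "\<And>z z' w w'. z \<in> K \<Longrightarrow> z' \<in> K \<Longrightarrow> w \<in> K \<Longrightarrow> w' \<in> K \<Longrightarrow>
      norm ((f z' - f z) - (f w' - f w))
        \<le> L * (norm ((z' - z) - (w' - w)) + norm (z - w) * norm (w' - w))"
      using C2_four_point_bound[OF Ck_on_SucD[OF f] K] by blast
    have "eventually (\<lambda>L. \<forall>(z, z', w, w')\<in>K \<times> K \<times> K \<times> K. norm ((f z' - f z) - (f w' - f w))
        \<le> L * (norm ((z' - z) - (w' - w)) + norm (z - w) * norm (w' - w))) at_top"
      unfolding case_prod_beta
      by (rule eventually_bound_at_top[of _ _ L]) (use L(2) in auto)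
    then show ?thesis by eventually_elim auto
  qed
  have 6: "eventually (\<lambda>L. \<forall>z\<in>K. \<forall>z'\<in>K. \<forall>w\<in>K. \<forall>w'\<in>K.
      norm ((f z' - f z - fderiv f z (z' - z)) - (f w' - f w - fderiv f w (w' - w)))
        \<le> L * (norm ((z' - z) - (w' - w)) * (norm (z' - z) + norm (w' - w))
             + norm (z - w) * norm (w' - w) ^ 2)) at_top"
  proof -
    obtain L where L: "L \<ge> 0" "\<And>z z' w w'. z \<in> K \<Longrightarrow> z' \<in> K \<Longrightarrow> w \<in> K \<Longrightarrow> w' \<in> K \<Longrightarrow>
      norm ((f z' - f z - fderiv f z (z' - z)) - (f w' - f w - fderiv f w (w' - w)))
        \<le> L * (norm ((z' - z) - (w' - w)) * (norm (z' - z) + norm (w' - w))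
             + norm (z - w) * norm (w' - w) ^ 2)"
      using C3_taylor_difference_bound[OF f K] by blast
    have "eventually (\<lambda>L. \<forall>(z, z', w, w')\<in>K \<times> K \<times> K \<times> K.
      norm ((f z' - f z - fderiv f z (z' - z)) - (f w' - f w - fderiv f w (w' - w)))
        \<le> L * (norm ((z' - z) - (w' - w)) * (norm (z' - z) + norm (w' - w))
             + norm (z - w) * norm (w' - w) ^ 2)) at_top"
      unfolding case_prod_beta
      by (rule eventually_bound_at_top[of _ _ L]) (use L(2) in auto)
    then show ?thesis by eventually_elim auto
  qed
  show ?thesis
    using 1 2 3 4 5 6 unfolding regular_bound_def by eventually_elim (use d in blast)
qed

section \<open>Local uniqueness in a chart\<close>

lemma level1_linear: "linear f \<Longrightarrow> level1 X r (\<lambda>\<alpha>. f (g \<alpha>)) = f (level1 X r g)"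
  by (simp add: level1_def linear_sum linear_cmul)

lemma powr_of_nat_divide: "k > 0 \<Longrightarrow> x powr (real k / p) = (x powr (1 / p)) ^ k"
  by (cases "x = 0") (simp_all add: powr_power)

text \<open>The chart is gone: two paths in a convex part of a Euclidean space satisfy the same
  expansion. Everything up to \<open>start\<close> is required of each path alone;
  \<open>start\<close> is what couples them. The bound 1 on \<omega> allows higher powers of
  \<open>e\<close> to be replaced by lower ones.\<close>

locale coupled_solutions =
  fixes S T p :: real and \<omega> :: "real \<times> real \<Rightarrow> real"
    and X :: "'n::finite forest \<Rightarrow> real \<times> real \<Rightarrow> real"
    and F :: "'n forest \<Rightarrow> 'e::euclidean_space \<Rightarrow> 'e"
    and K :: "'e set" and L a b :: real and z w :: "real \<Rightarrow> 'e"
  assumes control: "control_function S T \<omega>"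
    and rough: "branched_rough_path S T p \<omega> X"
    and p: "1 \<le> p" "p < 3"
    and ab: "S \<le> a" "a < b" "b \<le> T"
    and omega_le_1: "\<omega> (a, b) \<le> 1"
    and L: "1 \<le> L"
    and X1: "a \<le> s \<Longrightarrow> s \<le> t \<Longrightarrow> t \<le> b \<Longrightarrow> \<bar>X (Vtx \<alpha>) (s, t)\<bar> \<le> L * \<omega> (s, t) powr (1 / p)"
    and XD: "a \<le> s \<Longrightarrow> s \<le> t \<Longrightarrow> t \<le> b \<Longrightarrow> \<bar>X (Dot \<alpha> \<beta>) (s, t)\<bar> \<le> L * \<omega> (s, t) powr (2 / p)"
    and XL: "a \<le> s \<Longrightarrow> s \<le> t \<Longrightarrow> t \<le> b \<Longrightarrow> \<bar>X (Ladder \<alpha> \<beta>) (s, t)\<bar> \<le> L * \<omega> (s, t) powr (2 / p)"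
    and regular: "\<And>\<tau>. regular_bound L K (F \<tau>)"
    and admissible_on: "v \<in> K \<Longrightarrow>
      fderiv (F (Vtx \<beta>)) v (F (Vtx \<alpha>) v) = F (Dot \<alpha> \<beta>) v + F (Ladder \<alpha> \<beta>) v"
    and in_K: "y \<in> {z, w} \<Longrightarrow> a \<le> t \<Longrightarrow> t \<le> b \<Longrightarrow> y t \<in> K"
    and expansion: "y \<in> {z, w} \<Longrightarrow> a \<le> s \<Longrightarrow> s \<le> t \<Longrightarrow> t \<le> b \<Longrightarrow>
      norm (y t - y s - level1 X (s, t) (\<lambda>\<alpha>. F (Vtx \<alpha>) (y s)) - level2 X (s, t) (\<lambda>\<tau>. F \<tau> (y s)))
        \<le> L * \<omega> (s, t) powr (3 / p)"
    and start: "z a = w a"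
begin

text \<open>The unit of length for a time step: forests with k vertices have increments of order
  \<open>e ^ k\<close>, and the error of an integral curve is of order \<open>e ^ 3\<close>.\<close>

definition e where "e s t = \<omega> (s, t) powr (1 / p)"

definition D where "D t = z t - w t"

definition dF where "dF \<tau> t = F \<tau> (z t) - F \<tau> (w t)"

definition R where
  "R s t = D t - D s - level1 X (s, t) (\<lambda>\<alpha>. dF (Vtx \<alpha>) s) - level2 X (s, t) (\<lambda>\<tau>. dF \<tau> s)"

text \<open>
  The first-level part of the defect of \<open>R\<close>: by admissibility the level-1 term in it is the
  linear part of the increment of \<open>dF (Vtx \<beta>)\<close>, which makes \<open>B\<close> of second order.
\<close>

definition B where
  "B s u \<beta> = dF (Vtx \<beta>) u - dF (Vtx \<beta>) s
    - level1 X (s, u) (\<lambda>\<alpha>. dF (Dot \<alpha> \<beta>) s + dF (Ladder \<alpha> \<beta>) s)"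

definition close where
  "close \<kappa> c \<longleftrightarrow> 0 \<le> \<kappa> \<and> (\<forall>s t. a \<le> s \<longrightarrow> s \<le> t \<longrightarrow> t \<le> c \<longrightarrow> norm (R s t) \<le> \<kappa> * e s t ^ 3)"

text \<open>The part of an increment beyond its first level, of order \<open>e ^ 2\<close>.
  Admissibility turns the cross term of the Chen relation into a derivative in the direction of the
  first level; rewriting that direction as increment minus \<open>tail\<close> makes Taylor
  remainders visible.\<close>

definition tail where "tail y s t = y t - y s - level1 X (s, t) (\<lambda>\<alpha>. F (Vtx \<alpha>) (y s))"

lemma p_pos: "0 < p" using p by simp

lemma e_nonneg: "0 \<le> e s t" by (simp add: e_def)

lemma e_powers: "\<omega> (s, t) powr (2 / p) = e s t ^ 2" "\<omega> (s, t) powr (3 / p) = e s t ^ 3"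
  using powr_of_nat_divide[of 2 "\<omega> (s, t)" p] powr_of_nat_divide[of 3 "\<omega> (s, t)" p] by (simp_all add: e_def)

lemma e_mono:
  assumes "a \<le> s" "s \<le> s'" "s' \<le> t'" "t' \<le> t" "t \<le> b"
  shows "e s' t' \<le> e s t"
  unfolding e_def
proof (rule powr_mono2)
  show "0 \<le> 1 / p" using p_pos by simp
  show "0 \<le> \<omega> (s', t')" using control_nonneg[OF control, of s' t'] assms ab by simp
  show "\<omega> (s', t') \<le> \<omega> (s, t)" using control_mono[OF control, of s s' t' t] assms ab by simp
qed

lemma e_le_1:
  assumes "a \<le> s" "s \<le> t" "t \<le> b"
  shows "e s t \<le> 1"
proof -
  have "e s t \<le> e a b" using assms by (intro e_mono) auto
  also have "\<dots> \<le> 1"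
    unfolding e_def using omega_le_1 control_nonneg[OF control, of a b] ab p_pos
    by (simp add: powr_le1)
  finally show ?thesis .
qed

lemma halving_exponent: "0 \<le> x \<Longrightarrow> x \<le> \<omega> (s, t) / 2 \<Longrightarrow> (x powr (1 / p)) ^ 3 \<le> (1 / 2) powr (3 / p) * e s t ^ 3"
proof -
  assume x: "0 \<le> x" "x \<le> \<omega> (s, t) / 2"
  have "(x powr (1 / p)) ^ 3 = x powr (3 / p)" using powr_of_nat_divide[of 3 x p] by simp
  also have "\<dots> \<le> (1 / 2 * \<omega> (s, t)) powr (3 / p)" using x p_pos by (intro powr_mono2) auto
  also have "\<dots> = (1 / 2) powr (3 / p) * \<omega> (s, t) powr (3 / p)" using x by (simp add: powr_mult[symmetric])
  finally show ?thesis by (simp add: e_powers)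
qed

lemma level1_bound:
  fixes g :: "'n \<Rightarrow> 'e"
  assumes "a \<le> s" "s \<le> t" "t \<le> b" "e s t \<le> \<eta>" "\<And>\<alpha>. norm (g \<alpha>) \<le> G"
  shows "norm (level1 X (s, t) g) \<le> real CARD('n) * (L * \<eta>) * G"
proof (rule norm_level1_le)
  fix \<alpha>
  have "L * e s t \<le> L * \<eta>" using assms L by (simp add: mult_left_mono)
  then show "\<bar>X (Vtx \<alpha>) (s, t)\<bar> \<le> L * \<eta>"
    using X1[OF assms(1-3), of \<alpha>] by (simp add: e_def)
qed (rule assms)

lemma level2_bound:
  fixes g :: "'n forest \<Rightarrow> 'e"
  assumes "a \<le> s" "s \<le> t" "t \<le> b" "e s t \<le> \<eta>" "\<And>\<tau>. norm (g \<tau>) \<le> G"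
  shows "norm (level2 X (s, t) g) \<le> 2 * real CARD('n) ^ 2 * (L * \<eta> ^ 2) * G"
proof (rule norm_level2_le)
  have *: "L * e s t ^ 2 \<le> L * \<eta> ^ 2" using assms L e_nonneg[of s t] by (simp add: mult_left_mono power_mono)
  fix \<alpha> \<beta>
  show "\<bar>X (Dot \<alpha> \<beta>) (s, t)\<bar> \<le> L * \<eta> ^ 2"
    using XD[OF assms(1-3), of \<alpha> \<beta>] * by (simp add: e_powers)
  show "\<bar>X (Ladder \<alpha> \<beta>) (s, t)\<bar> \<le> L * \<eta> ^ 2"
    using XL[OF assms(1-3), of \<alpha> \<beta>] * by (simp add: e_powers)
qed (rule assms)

lemma differentiable: "v \<in> K \<Longrightarrow> F \<tau> differentiable (at v)"
  and norm_F: "v \<in> K \<Longrightarrow> norm (F \<tau> v) \<le> L"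
  and lipschitz: "v \<in> K \<Longrightarrow> v' \<in> K \<Longrightarrow> norm (F \<tau> v - F \<tau> v') \<le> L * norm (v - v')"
  and norm_fderiv: "v \<in> K \<Longrightarrow> norm (fderiv (F \<tau>) v h) \<le> L * norm h"
  and fderiv_lipschitz: "v \<in> K \<Longrightarrow> v' \<in> K \<Longrightarrow>
    norm (fderiv (F \<tau>) v h - fderiv (F \<tau>) v' h) \<le> L * (norm (v - v') * norm h)"
  and four_point: "x \<in> K \<Longrightarrow> x' \<in> K \<Longrightarrow> v \<in> K \<Longrightarrow> v' \<in> K \<Longrightarrow>
    norm ((F \<tau> x' - F \<tau> x) - (F \<tau> v' - F \<tau> v))
        \<le> L * (norm ((x' - x) - (v' - v)) + norm (x - v) * norm (v' - v))"
  and taylor: "x \<in> K \<Longrightarrow> x' \<in> K \<Longrightarrow> v \<in> K \<Longrightarrow> v' \<in> K \<Longrightarrow>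
    norm ((F \<tau> x' - F \<tau> x - fderiv (F \<tau>) x (x' - x)) - (F \<tau> v' - F \<tau> v - fderiv (F \<tau>) v (v' - v)))
        \<le> L * (norm ((x' - x) - (v' - v)) * (norm (x' - x) + norm (v' - v))
             + norm (x - v) * norm (v' - v) ^ 2)"
  using regular[of \<tau>] unfolding regular_bound_def by blast+

text \<open>The terms linear in \<open>D\<close> telescope. The Chen cross term of the second level
  lives on [u, t] in its outer sum, so it combines with the change of the level-1 coefficients
  between s and u, and the result is \<open>B\<close>.\<close>

lemma R_split:
  assumes "a \<le> s" "s \<le> u" "u \<le> t" "t \<le> b"
  shows "R s t = R s u + R u t + level1 X (u, t) (B s u) + level2 X (u, t) (\<lambda>\<tau>. dF \<tau> u - dF \<tau> s)"
proof -
  have st: "S \<le> s" "s \<le> u" "u \<le> t" "t \<le> T" using assms ab by auto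
  have "level1 X (u, t) (B s u) = level1 X (u, t) (\<lambda>\<beta>. dF (Vtx \<beta>) u) - level1 X (u, t) (\<lambda>\<beta>. dF (Vtx \<beta>) s)
     - level1 X (u, t) (\<lambda>\<beta>. level1 X (s, u) (\<lambda>\<alpha>. dF (Dot \<alpha> \<beta>) s + dF (Ladder \<alpha> \<beta>) s))"
    unfolding B_def by (simp only: level1_diff)
  then show ?thesis
    unfolding R_def level1_chen[OF rough st] level2_chen[OF rough st] level2_diff
    by (simp add: algebra_simps)
qed

text \<open>Admissibility replaces \<open>Dot + Ladder\<close> by the derivative of \<open>G\<close>
  along the first level, at both curves. What remains is a difference of Taylor remainders, a
  derivative applied to the difference of the tails, and a difference of derivatives applied to one
  tail. Each of these is linear in the distance of the curves and of second order in the
  step.\<close>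

lemma B_eq:
  fixes \<beta> s u
  assumes "a \<le> s" "s \<le> u" "u \<le> b"
  defines "G \<equiv> F (Vtx \<beta>)"
  shows "B s u \<beta> = ((G (z u) - G (z s) - fderiv G (z s) (z u - z s))
        - (G (w u) - G (w s) - fderiv G (w s) (w u - w s)))
      + fderiv G (z s) (tail z s u - tail w s u)
      + (fderiv G (z s) (tail w s u) - fderiv G (w s) (tail w s u))"
proof -
  have K: "z s \<in> K" "w s \<in> K" using in_K assms by auto
  then have lin: "linear (fderiv G (z s))" "linear (fderiv G (w s))"
    unfolding G_def by (auto intro!: bounded_linear.linear fderiv_bounded_linear differentiable)
  have "level1 X (s, u) (\<lambda>\<alpha>. dF (Dot \<alpha> \<beta>) s + dF (Ladder \<alpha> \<beta>) s)
      = level1 X (s, u) (\<lambda>\<alpha>. fderiv G (z s) (F (Vtx \<alpha>) (z s)) - fderiv G (w s) (F (Vtx \<alpha>) (w s)))"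
    using K by (simp add: G_def dF_def admissible_on algebra_simps)
  also have "\<dots> = fderiv G (z s) (z u - z s - tail z s u) - fderiv G (w s) (w u - w s - tail w s u)"
    by (simp add: level1_diff level1_linear[OF lin(1)] level1_linear[OF lin(2)] tail_def)
  finally show ?thesis
    unfolding B_def dF_def G_def[symmetric] by (simp add: linear_diff[OF lin(1)] linear_diff[OF lin(2)])
qed

lemma close_initial: "close (2 * L) b"
  unfolding close_def
proof (intro conjI allI impI)
  fix s t assume st: "a \<le> s" "s \<le> t" "t \<le> b"
  let ?E = "\<lambda>y. y t - y s - level1 X (s, t) (\<lambda>\<alpha>. F (Vtx \<alpha>) (y s)) - level2 X (s, t) (\<lambda>\<tau>. F \<tau> (y s))"
  have "R s t = ?E z - ?E w"
    unfolding R_def D_def dF_def level1_diff level2_diff by (simp add: algebra_simps)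
  also have "norm \<dots> \<le> norm (?E z) + norm (?E w)" by (rule norm_triangle_ineq4)
  also have "\<dots> \<le> 2 * L * e s t ^ 3"
    using expansion[of z, OF _ st] expansion[of w, OF _ st] by (simp add: e_powers)
  finally show "norm (R s t) \<le> 2 * L * e s t ^ 3" .
qed (use L in simp)

lemma R_from_start: "R a t = D t"
  by (simp add: R_def D_def dF_def start level1_def level2_def)

text \<open>The bound is stated for any \<eta> between \<open>e s t\<close> and 1, so that it can be
  used on the part [s, u] with the scale of the whole step [s, t].\<close>

lemma tail_bound:
  obtains M where "0 \<le> M" "\<And>y s t \<eta>. y \<in> {z, w} \<Longrightarrow> a \<le> s \<Longrightarrow> s \<le> t \<Longrightarrow> t \<le> b \<Longrightarrow> e s t \<le> \<eta> \<Longrightarrow> \<eta> \<le> 1 \<Longrightarrow>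
    norm (tail y s t) \<le> M * \<eta> ^ 2 \<and> norm (y t - y s) \<le> M * \<eta>"
proof
  define M0 where "M0 = 2 * real CARD('n) ^ 2 * L * L + L"
  have M0: "0 \<le> M0" using L by (simp add: M0_def)
  show "0 \<le> real CARD('n) * L * L + M0" using L M0 by simp
  fix y s t \<eta> assume y: "y \<in> {z, w}" and st: "a \<le> s" "s \<le> t" "t \<le> b" and \<eta>: "e s t \<le> \<eta>" "\<eta> \<le> 1"
  have \<eta>0: "0 \<le> \<eta>" using \<eta>(1) e_nonneg[of s t] by simp
  let ?l2 = "level2 X (s, t) (\<lambda>\<tau>. F \<tau> (y s))" and ?l1 = "level1 X (s, t) (\<lambda>\<alpha>. F (Vtx \<alpha>) (y s))"
  have ys: "y s \<in> K" using in_K[OF y] st by simp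
  have "norm (tail y s t) \<le> norm (tail y s t - ?l2) + norm ?l2"
    using norm_triangle_ineq[of "tail y s t - ?l2" ?l2] by simp
  also have "norm (tail y s t - ?l2) \<le> L * \<eta> ^ 2"
  proof -
    have "norm (tail y s t - ?l2) \<le> L * e s t ^ 3"
      using expansion[OF y st] by (simp add: tail_def e_powers)
    also have "\<dots> \<le> L * \<eta> ^ 3" using L \<eta> e_nonneg[of s t] by (simp add: mult_left_mono power_mono)
    also have "\<dots> \<le> L * \<eta> ^ 2" using L \<eta> \<eta>0 by (intro mult_left_mono power_decreasing) auto
    finally show ?thesis .
  qed
  also have "norm ?l2 \<le> 2 * real CARD('n) ^ 2 * (L * \<eta> ^ 2) * L"
    by (rule level2_bound[OF st \<eta>(1)]) (rule norm_F[OF ys])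
  finally have t: "norm (tail y s t) \<le> M0 * \<eta> ^ 2" by (simp add: M0_def algebra_simps)
  also have "\<dots> \<le> (real CARD('n) * L * L + M0) * \<eta> ^ 2" using L by (simp add: mult_right_mono)
  finally have 1: "norm (tail y s t) \<le> (real CARD('n) * L * L + M0) * \<eta> ^ 2" .
  have "norm (y t - y s) \<le> norm (tail y s t) + norm ?l1"
    using norm_triangle_ineq[of "tail y s t" ?l1] by (simp add: tail_def)
  also have "norm ?l1 \<le> real CARD('n) * (L * \<eta>) * L"
    by (rule level1_bound[OF st \<eta>(1)]) (rule norm_F[OF ys])
  also have "norm (tail y s t) \<le> M0 * \<eta>"
  proof -
    have "\<eta> ^ 2 \<le> \<eta>" using \<eta> \<eta>0 by (simp add: power2_eq_square mult_left_le)
    then have "M0 * \<eta> ^ 2 \<le> M0 * \<eta>" using M0 by (simp add: mult_left_mono)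
    then show ?thesis using t by simp
  qed
  finally show "norm (tail y s t) \<le> (real CARD('n) * L * L + M0) * \<eta> ^ 2 \<and>
     norm (y t - y s) \<le> (real CARD('n) * L * L + M0) * \<eta>"
    using 1 by (simp add: algebra_simps)
qed

text \<open>Two halves of \<omega> contribute \<open>(1 / 2) powr (3 / p)\<close> each. The other
  terms of \<open>R_split\<close> are estimated through \<open>q\<close>, a bound for the distance
  of the curves on [a, c], which contains \<kappa> and the small factor \<epsilon>.\<close>

lemma contraction:
  obtains M where "0 \<le> M" "\<And>c \<kappa>. a \<le> c \<Longrightarrow> c \<le> b \<Longrightarrow> close \<kappa> c \<Longrightarrow>
    close ((2 * (1 / 2) powr (3 / p) + M * e a c) * \<kappa>) c"
proof -
  obtain M4 where M4: "0 \<le> M4" "\<And>y s t \<eta>. y \<in> {z, w} \<Longrightarrow> a \<le> s \<Longrightarrow> s \<le> t \<Longrightarrow> t \<le> b \<Longrightarrow> e s t \<le> \<eta> \<Longrightarrow> \<eta> \<le> 1 \<Longrightarrow>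
    norm (tail y s t) \<le> M4 * \<eta> ^ 2 \<and> norm (y t - y s) \<le> M4 * \<eta>"
    using tail_bound by blast
  define N where "N = real CARD('n)"
  \<comment> \<open>In units of powers of \<eta> times \<open>q\<close>: \<open>M5\<close> bounds
    the difference of the tails (order 2), \<open>M6\<close> that of the increments (order 1),
    \<open>M7\<close> the change of \<open>dF\<close> (order 1) and \<open>M8\<close> the
    coefficient \<open>B\<close> (order 2). \<open>M\<close> collects the level-1 sum of
    \<open>B\<close> and the level-2 sum of the changes of \<open>dF\<close>, both of order
    3.\<close>
  define M5 where "M5 = 2 * N ^ 2 * L * L + 1"
  define M6 where "M6 = N * L * L + M5"
  define M7 where "M7 = L * (M6 + M4)"
  define M8 where "M8 = L * (2 * M6 * M4 + M4 ^ 2) + L * M5 + L * M4"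
  define M where "M = N * L * M8 + 2 * N ^ 2 * L * M7"
  have pos: "0 \<le> N" "0 \<le> L" "0 \<le> M4" "0 \<le> M5" "0 \<le> M6" "0 \<le> M7" "0 \<le> M8" "0 \<le> M"
    using L M4(1) by (simp_all add: N_def M5_def M6_def M7_def M8_def M_def)
  show thesis
  proof
    show "0 \<le> M" by (rule pos)
    fix c \<kappa> assume c: "a \<le> c" "c \<le> b" and close: "close \<kappa> c"
    define \<epsilon> where "\<epsilon> = e a c"
    have \<epsilon>: "0 \<le> \<epsilon>" "\<epsilon> \<le> 1" using e_nonneg e_le_1[of a c] c by (auto simp: \<epsilon>_def)
    have \<kappa>: "0 \<le> \<kappa>" and R: "\<And>s t. a \<le> s \<Longrightarrow> s \<le> t \<Longrightarrow> t \<le> c \<Longrightarrow> norm (R s t) \<le> \<kappa> * e s t ^ 3"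
      using close by (auto simp: close_def)
    \<comment> \<open>Starting from the common point, the distance is at most \<kappa>\<epsilon>^3.
      One power of \<epsilon> is kept, which already suffices for a contraction.\<close>
    define q where "q = \<kappa> * \<epsilon>"
    have q: "0 \<le> q" using \<kappa> \<epsilon> by (simp add: q_def)
    have norm_D: "norm (D s) \<le> q" if "a \<le> s" "s \<le> c" for s
    proof -
      have "norm (D s) \<le> \<kappa> * e a s ^ 3" using R[of a s] that by (simp add: R_from_start)
      also have "e a s ^ 3 \<le> \<epsilon> ^ 3"
        unfolding \<epsilon>_def using that c by (intro power_mono e_mono e_nonneg) auto
      also have "\<epsilon> ^ 3 \<le> \<epsilon>" using \<epsilon> power_decreasing[of 1 3 \<epsilon>] by simp
      finally show ?thesis using \<kappa> by (simp add: q_def mult_left_mono)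
    qed
    have norm_dF: "norm (dF \<tau> s) \<le> L * q" if "a \<le> s" "s \<le> c" for s \<tau>
    proof -
      have "norm (dF \<tau> s) \<le> L * norm (D s)"
        unfolding dF_def D_def by (rule lipschitz) (use in_K that c in auto)
      also have "\<dots> \<le> L * q" using norm_D[OF that] pos by (simp add: mult_left_mono)
      finally show ?thesis .
    qed
    have step: "norm (R s t) \<le> (2 * (1 / 2) powr (3 / p) + M * \<epsilon>) * \<kappa> * e s t ^ 3"
      if st: "a \<le> s" "s \<le> t" "t \<le> c" for s t
    proof -
      define \<eta> where "\<eta> = e s t"
      have \<eta>: "0 \<le> \<eta>" "\<eta> \<le> \<epsilon>" "\<eta> \<le> 1"
        using e_nonneg[of s t] e_mono[of a s t c] e_le_1[of s t] st c by (auto simp: \<eta>_def \<epsilon>_def)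
      obtain u where u: "s \<le> u" "u \<le> t" "\<omega> (s, u) \<le> \<omega> (s, t) / 2" "\<omega> (u, t) \<le> \<omega> (s, t) / 2"
        using control_midpoint[OF control, of s t] st c ab by auto
      have su: "a \<le> s" "s \<le> u" "u \<le> b" and ut: "a \<le> u" "u \<le> t" "t \<le> b" and cu: "s \<le> c" "u \<le> c"
        using st u c by auto
      have e_su: "e s u \<le> \<eta>" and e_ut: "e u t \<le> \<eta>"
        unfolding \<eta>_def using st u c by (auto intro!: e_mono)
      have K: "z s \<in> K" "w s \<in> K" "z u \<in> K" "w u \<in> K" using in_K st u c by auto
      define h k where "h = z u - z s" and "k = w u - w s"
      have h: "norm h \<le> M4 * \<eta>" and k: "norm k \<le> M4 * \<eta>" and tw: "norm (tail w s u) \<le> M4 * \<eta> ^ 2"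
        using M4(2)[OF _ su e_su \<eta>(3)] by (auto simp: h_def k_def)
      have hk: "h - k = D u - D s" by (simp add: h_def k_def D_def)
      have tail_diff: "tail z s u - tail w s u = level2 X (s, u) (\<lambda>\<tau>. dF \<tau> s) + R s u"
        unfolding tail_def R_def dF_def D_def level1_diff by (simp add: algebra_simps)
      have norm_tail_diff: "norm (tail z s u - tail w s u) \<le> M5 * (q * \<eta> ^ 2)"
      proof -
        have "norm (level2 X (s, u) (\<lambda>\<tau>. dF \<tau> s)) \<le> 2 * N ^ 2 * (L * \<eta> ^ 2) * (L * q)"
          unfolding N_def by (rule level2_bound[OF su e_su]) (rule norm_dF[OF st(1) cu(1)])
        moreover have "norm (R s u) \<le> q * \<eta> ^ 2"
        proof -
          have "norm (R s u) \<le> \<kappa> * e s u ^ 3" by (rule R[OF st(1) u(1) cu(2)])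
          also have "\<dots> \<le> \<kappa> * \<eta> ^ 3" using e_su e_nonneg[of s u] \<kappa> by (simp add: mult_left_mono power_mono)
          \<comment> \<open>One of the three powers of \<eta> is traded for \<epsilon>, by
            \<open>\<eta> \<le> \<epsilon>\<close>; this puts the remainder in the form
            \<open>q * \<eta> ^ 2\<close> of the other terms.\<close>
          also have "\<dots> = \<kappa> * \<eta> * \<eta> ^ 2" by (simp add: power3_eq_cube power2_eq_square)
          also have "\<dots> \<le> q * \<eta> ^ 2"
            unfolding q_def using \<eta> \<kappa> by (intro mult_right_mono mult_left_mono) auto
          finally show ?thesis .
        qed
        ultimately have "norm (tail z s u - tail w s u) \<le> 2 * N ^ 2 * (L * \<eta> ^ 2) * (L * q) + q * \<eta> ^ 2"
          unfolding tail_diff by (rule norm_triangle_mono)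
        then show ?thesis by (simp add: M5_def algebra_simps)
      qed
      have norm_hk: "norm (h - k) \<le> M6 * (q * \<eta>)"
      proof -
        have "h - k = level1 X (s, u) (\<lambda>\<alpha>. dF (Vtx \<alpha>) s) + (tail z s u - tail w s u)"
          unfolding h_def k_def tail_def dF_def level1_diff by (simp add: algebra_simps)
        moreover have "norm (level1 X (s, u) (\<lambda>\<alpha>. dF (Vtx \<alpha>) s)) \<le> N * (L * \<eta>) * (L * q)"
          unfolding N_def by (rule level1_bound[OF su e_su]) (rule norm_dF[OF st(1) cu(1)])
        ultimately have "norm (h - k) \<le> N * (L * \<eta>) * (L * q) + M5 * (q * \<eta> ^ 2)"
          using norm_tail_diff norm_triangle_mono by metis
        moreover have "M5 * (q * \<eta> ^ 2) \<le> M5 * (q * \<eta>)"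
          using \<eta> pos q by (intro mult_left_mono) (auto simp: power2_eq_square mult_left_le)
        ultimately show ?thesis by (simp add: M6_def algebra_simps)
      qed
      have q_k: "norm (z s - w s) * norm k \<le> q * (M4 * \<eta>)"
        using norm_D[OF st(1) cu(1)] k by (intro mult_mono) (auto simp: D_def q)
      have norm_dF_diff: "norm (dF \<tau> u - dF \<tau> s) \<le> M7 * (q * \<eta>)" for \<tau>
      proof -
        have "dF \<tau> u - dF \<tau> s = (F \<tau> (z u) - F \<tau> (z s)) - (F \<tau> (w u) - F \<tau> (w s))"
          by (simp add: dF_def)
        then have "norm (dF \<tau> u - dF \<tau> s) \<le> L * (norm (h - k) + norm (z s - w s) * norm k)"
          using four_point[OF K(1,3,2,4), of \<tau>] by (simp add: h_def k_def)
        also have "\<dots> \<le> L * (M6 * (q * \<eta>) + q * (M4 * \<eta>))"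
          using norm_hk q_k pos by (intro mult_left_mono add_mono)
        finally show ?thesis by (simp add: M7_def algebra_simps)
      qed
      have norm_B: "norm (B s u \<beta>) \<le> M8 * (q * \<eta> ^ 2)" for \<beta>
      proof -
        let ?G = "F (Vtx \<beta>)"
        have "norm ((?G (z u) - ?G (z s) - fderiv ?G (z s) (z u - z s))
            - (?G (w u) - ?G (w s) - fderiv ?G (w s) (w u - w s)))
            \<le> L * (norm (h - k) * (norm h + norm k) + norm (z s - w s) * norm k ^ 2)"
          unfolding h_def k_def by (rule taylor) (rule K)+
        also have "\<dots> \<le> L * (M6 * (q * \<eta>) * (M4 * \<eta> + M4 * \<eta>) + q * (M4 * \<eta>) ^ 2)"
          using norm_hk h k norm_D[OF st(1) cu(1)] pos q \<eta>
          by (intro mult_left_mono add_mono mult_mono power_mono) (auto simp: D_def)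
        finally have 1: "norm ((?G (z u) - ?G (z s) - fderiv ?G (z s) (z u - z s))
            - (?G (w u) - ?G (w s) - fderiv ?G (w s) (w u - w s))) \<le> \<dots>" .
        have "norm (fderiv ?G (z s) (tail z s u - tail w s u)) \<le> L * norm (tail z s u - tail w s u)"
          by (rule norm_fderiv[OF K(1)])
        also have "\<dots> \<le> L * (M5 * (q * \<eta> ^ 2))"
          using norm_tail_diff pos by (intro mult_left_mono)
        finally have 2: "norm (fderiv ?G (z s) (tail z s u - tail w s u)) \<le> \<dots>" .
        have "norm (fderiv ?G (z s) (tail w s u) - fderiv ?G (w s) (tail w s u))
            \<le> L * (norm (z s - w s) * norm (tail w s u))"
          by (rule fderiv_lipschitz[OF K(1,2)])
        also have "\<dots> \<le> L * (q * (M4 * \<eta> ^ 2))"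
          using norm_D[OF st(1) cu(1)] tw pos q by (intro mult_left_mono mult_mono) (auto simp: D_def)
        finally have 3: "norm (fderiv ?G (z s) (tail w s u) - fderiv ?G (w s) (tail w s u)) \<le> \<dots>" .
        have "norm (B s u \<beta>) \<le> L * (M6 * (q * \<eta>) * (M4 * \<eta> + M4 * \<eta>) + q * (M4 * \<eta>) ^ 2)
            + L * (M5 * (q * \<eta> ^ 2)) + L * (q * (M4 * \<eta> ^ 2))"
          unfolding B_eq[OF su] by (intro norm_triangle_mono 1 2 3)
        then show ?thesis by (simp add: M8_def algebra_simps power2_eq_square)
      qed
      have level: "norm (level1 X (u, t) (B s u)) \<le> N * (L * \<eta>) * (M8 * (q * \<eta> ^ 2))"
        "norm (level2 X (u, t) (\<lambda>\<tau>. dF \<tau> u - dF \<tau> s)) \<le> 2 * N ^ 2 * (L * \<eta> ^ 2) * (M7 * (q * \<eta>))"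
        unfolding N_def by (rule level1_bound[OF ut e_ut norm_B], rule level2_bound[OF ut e_ut norm_dF_diff])
      have half: "norm (R s' t') \<le> \<kappa> * ((1 / 2) powr (3 / p) * \<eta> ^ 3)"
        if "a \<le> s'" "s' \<le> t'" "t' \<le> c" "\<omega> (s', t') \<le> \<omega> (s, t) / 2" for s' t'
      proof -
        have "e s' t' ^ 3 \<le> (1 / 2) powr (3 / p) * \<eta> ^ 3"
          unfolding \<eta>_def e_def[of s' t'] using that c ab
          by (intro halving_exponent control_nonneg[OF control]) auto
        then show ?thesis using R[OF that(1-3)] \<kappa> mult_left_mono order.trans by blast
      qed
      have "norm (R s t) \<le> \<kappa> * ((1 / 2) powr (3 / p) * \<eta> ^ 3) + \<kappa> * ((1 / 2) powr (3 / p) * \<eta> ^ 3)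
          + N * (L * \<eta>) * (M8 * (q * \<eta> ^ 2)) + 2 * N ^ 2 * (L * \<eta> ^ 2) * (M7 * (q * \<eta>))"
        unfolding R_split[OF st(1) u(1,2) ut(3)]
        by (intro norm_triangle_mono level half) (use st u cu in auto)
      also have "\<dots> = (2 * (1 / 2) powr (3 / p) + M * \<epsilon>) * \<kappa> * \<eta> ^ 3"
        by (simp add: M_def q_def algebra_simps power2_eq_square power3_eq_cube)
      finally show ?thesis by (simp add: \<eta>_def)
    qed
    show "close ((2 * (1 / 2) powr (3 / p) + M * e a c) * \<kappa>) c"
      using step pos \<kappa> \<epsilon> unfolding close_def \<epsilon>_def by simp
  qed
qed

text \<open>On a short enough interval the factor of the contraction is below 1. Iteration there
  drives the admissible constant to 0, and the remainder taken from \<open>a\<close> is the distance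
  of the curves itself.\<close>

lemma coincide_near_start: "\<exists>c. a < c \<and> c \<le> b \<and> (\<forall>t\<in>{a..c}. z t = w t)"
proof -
  obtain M where M: "0 \<le> M" "\<And>c \<kappa>. a \<le> c \<Longrightarrow> c \<le> b \<Longrightarrow> close \<kappa> c \<Longrightarrow>
      close ((2 * (1 / 2) powr (3 / p) + M * e a c) * \<kappa>) c"
    using contraction by blast
  have "(1 / 2) powr (3 / p) < (1 / 2 :: real) powr 1"
    using p by (intro powr_less_mono') auto
  then have gap: "0 < 1 - 2 * (1 / 2) powr (3 / p)" by simp
  \<comment> \<open>Chosen so that \<open>(M + 1) * d\<close> is half the distance of
    \<open>2 * (1 / 2) powr (3 / p)\<close> from 1; the factor \<rho> then misses 1 by at least the
    other half. Using \<open>M + 1\<close> keeps the denominator positive when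
    \<open>M = 0\<close>.\<close>
  define d where "d = (1 - 2 * (1 / 2) powr (3 / p)) / (2 * (M + 1))"
  have d: "0 < d" using gap M by (simp add: d_def)
  obtain c where c: "a < c" "c \<le> b" "\<omega> (a, c) < d powr p"
    using control_small[OF control ab, of "d powr p"] d by auto
  define \<rho> where "\<rho> = 2 * (1 / 2) powr (3 / p) + M * e a c"
  have "e a c \<le> d"
  proof -
    have "e a c \<le> (d powr p) powr (1 / p)"
      unfolding e_def using c ab p_pos control_nonneg[OF control, of a c] by (intro powr_mono2) auto
    then show ?thesis using d p_pos by (simp add: powr_powr)
  qed
  then have "M * e a c \<le> (M + 1) * d" using M(1) d e_nonneg[of a c] by (intro mult_mono) auto
  also have "\<dots> = (1 - 2 * (1 / 2) powr (3 / p)) / 2"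
    unfolding d_def using M(1) by (auto simp: field_simps)
  finally have \<rho>: "0 \<le> \<rho>" "\<rho> < 1" using gap M(1) e_nonneg[of a c] by (auto simp: \<rho>_def)
  have iter: "close (\<rho> ^ n * (2 * L)) c" for n
  proof (induction n)
    case 0
    then show ?case using close_initial c by (auto simp: close_def)
  next
    case (Suc n)
    from M(2)[OF _ c(2) this] c(1) show ?case by (simp add: \<rho>_def mult.assoc)
  qed
  have "z t = w t" if t: "t \<in> {a..c}" for t
  proof -
    have "norm (D t) \<le> \<rho> ^ n * (2 * L) * e a t ^ 3" for n
      using iter[of n] t unfolding close_def by (metis R_from_start atLeastAtMost_iff order.refl)
    moreover have "(\<lambda>n. \<rho> ^ n * (2 * L) * e a t ^ 3) \<longlonglongrightarrow> 0 * (2 * L) * e a t ^ 3"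
      using \<rho> by (intro tendsto_mult LIMSEQ_realpow_zero tendsto_const)
    ultimately have "norm (D t) \<le> 0 * (2 * L) * e a t ^ 3"
      by (intro Lim_bounded2) auto
    then show ?thesis by (simp add: D_def)
  qed
  with c show ?thesis by blast
qed

end

section \<open>The second-order chain rule\<close>

text \<open>The inner derivative is in direction \<open>k\<close> and the outer one in direction
  \<open>h\<close>, the order of the indices in \<open>jet2\<close>.\<close>

definition second_fderiv ::
    "('e::real_normed_vector \<Rightarrow> 'f::real_normed_vector) \<Rightarrow> 'e \<Rightarrow> 'e \<Rightarrow> 'e \<Rightarrow> 'f"
  where "second_fderiv f v h k = fderiv (\<lambda>u. fderiv f u k) v h"

lemma has_derivative_cong_nhds:
  assumes "eventually (\<lambda>u. f u = g u) (nhds v)" "(f has_derivative f') (at v)"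
  shows "(g has_derivative f') (at v)"
proof -
  obtain A where "open A" "v \<in> A" "\<And>u. u \<in> A \<Longrightarrow> f u = g u"
    using assms(1) by (auto simp: eventually_nhds)
  then show ?thesis using has_derivative_transform_within_open[OF assms(2)] by blast
qed

text \<open>Functions that agree near a point have the same set of derivatives there, so the choice
  operator in \<open>frechet_derivative\<close> returns the same value, even where this set is
  empty.\<close>

lemma fderiv_cong_nhds:
  assumes "eventually (\<lambda>u. f u = g u) (nhds v)"
  shows "fderiv f v = fderiv g v"
proof -
  have "(f has_derivative f') (at v) \<longleftrightarrow> (g has_derivative f') (at v)" for f'
    using has_derivative_cong_nhds[OF assms] has_derivative_cong_nhds[of g f v] assms
    by (auto simp: eq_commute)
  then show ?thesis by (simp add: frechet_derivative_def)
qed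

lemma eventually_fderiv_cong:
  assumes "eventually (\<lambda>u. f u = g u) (nhds v)"
  shows "eventually (\<lambda>u. fderiv f u = fderiv g u) (nhds v)"
proof -
  have "eventually (\<lambda>u. eventually (\<lambda>u. f u = g u) (nhds u)) (nhds v)"
    using assms by (simp add: eventually_eventually)
  then show ?thesis by eventually_elim (rule fderiv_cong_nhds)
qed

section \<open>Symmetry of second derivatives\<close>

lemma second_difference_mvt:
  fixes f :: "'e::real_normed_vector \<Rightarrow> real"
  assumes f: "Ck_on (Suc (Suc 0)) W f" and s: "0 < s"
    and W: "\<And>r r'. 0 \<le> r \<Longrightarrow> r \<le> s \<Longrightarrow> 0 \<le> r' \<Longrightarrow> r' \<le> s \<Longrightarrow> v + r *\<^sub>R h + r' *\<^sub>R k \<in> W"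
  obtains r r' where "0 < r" "r < s" "0 < r'" "r' < s"
    "f (v + s *\<^sub>R h + s *\<^sub>R k) - f (v + s *\<^sub>R h) - f (v + s *\<^sub>R k) + f v
      = s ^ 2 * second_fderiv f (v + r *\<^sub>R h + r' *\<^sub>R k) k h"
proof -
  let ?g = "\<lambda>r. f (v + s *\<^sub>R k + r *\<^sub>R h) - f (v + r *\<^sub>R h)"
  have W': "v + s *\<^sub>R k + r *\<^sub>R h \<in> W" "v + r *\<^sub>R h \<in> W" if "0 \<le> r" "r \<le> s" for r
    using W[of r s] W[of r 0] that s by (auto simp: algebra_simps)
  have "\<exists>r>0. r < s \<and> ?g s - ?g 0 = (s - 0) * (fderiv f (v + s *\<^sub>R k + r *\<^sub>R h) h - fderiv f (v + r *\<^sub>R h) h)"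
  proof (rule MVT2[OF s])
    fix r assume "0 \<le> r" "r \<le> s"
    then have "f differentiable (at (v + s *\<^sub>R k + r *\<^sub>R h))" "f differentiable (at (v + r *\<^sub>R h))"
      using W' Ck_on_differentiable[OF f] by auto
    from has_derivative_diff[OF this[THEN differentiable_along_segment]]
    show "(?g has_real_derivative fderiv f (v + s *\<^sub>R k + r *\<^sub>R h) h - fderiv f (v + r *\<^sub>R h) h) (at r)"
      unfolding has_field_derivative_def real_scaleR_def right_diff_distrib[symmetric]
      by (simp only: mult_commute_abs)
  qed
  then obtain r where r: "0 < r" "r < s"
    "?g s - ?g 0 = s * (fderiv f (v + s *\<^sub>R k + r *\<^sub>R h) h - fderiv f (v + r *\<^sub>R h) h)" by auto
  let ?k = "\<lambda>r'. fderiv f (v + r *\<^sub>R h + r' *\<^sub>R k) h"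
  have "\<exists>r'>0. r' < s \<and> ?k s - ?k 0 = (s - 0) * second_fderiv f (v + r *\<^sub>R h + r' *\<^sub>R k) k h"
  proof (rule MVT2[OF s])
    fix r' assume "0 \<le> r'" "r' \<le> s"
    then have "(\<lambda>u. fderiv f u h) differentiable (at (v + r *\<^sub>R h + r' *\<^sub>R k))"
      using W[of r r'] Ck_on_differentiable[OF Ck_on_fderiv[OF f]] r by auto
    from differentiable_along_segment[OF this]
    show "(?k has_real_derivative second_fderiv f (v + r *\<^sub>R h + r' *\<^sub>R k) k h) (at r')"
      unfolding has_field_derivative_def second_fderiv_def real_scaleR_def
      by (simp only: mult_commute_abs)
  qed
  then obtain r' where r': "0 < r'" "r' < s"
    "?k s - ?k 0 = s * second_fderiv f (v + r *\<^sub>R h + r' *\<^sub>R k) k h" by auto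
  have "f (v + s *\<^sub>R h + s *\<^sub>R k) - f (v + s *\<^sub>R h) - f (v + s *\<^sub>R k) + f v = ?g s - ?g 0"
    by (simp add: algebra_simps)
  also have "\<dots> = s * (?k s - ?k 0)"
    unfolding r(3) by (simp add: add.assoc add.commute[of "s *\<^sub>R k"])
  also have "\<dots> = s ^ 2 * second_fderiv f (v + r *\<^sub>R h + r' *\<^sub>R k) k h"
    unfolding r'(3) by (simp add: power2_eq_square)
  finally show thesis using that r r' by blast
qed

text \<open>The second difference over a small parallelogram is symmetric in \<open>h\<close> and
  \<open>k\<close>. Two applications of the mean value theorem identify it with either mixed
  derivative at some point of the parallelogram, and continuity carries both values to the
  corner.\<close>

lemma second_fderiv_symmetric_real:
  fixes f :: "'e::real_normed_vector \<Rightarrow> real"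
  assumes f: "Ck_on (Suc (Suc 0)) W f" and W: "open W" "v \<in> W"
  shows "second_fderiv f v h k = second_fderiv f v k h"
proof (rule ccontr)
  assume neq: "second_fderiv f v h k \<noteq> second_fderiv f v k h"
  define \<epsilon> where "\<epsilon> = \<bar>second_fderiv f v h k - second_fderiv f v k h\<bar> / 2"
  have \<epsilon>: "\<epsilon> > 0" using neq by (simp add: \<epsilon>_def)
  have "\<exists>d>0. \<forall>u. dist u v < d \<longrightarrow> u \<in> W \<and> \<bar>second_fderiv f u h' k' - second_fderiv f v h' k'\<bar> < \<epsilon>" for h' k'
  proof -
    have "continuous_on W (\<lambda>u. second_fderiv f u h' k')"
      using Ck_on_fderiv[OF Ck_on_fderiv[OF f]] by (simp add: second_fderiv_def)
    then have "eventually (\<lambda>u. dist (second_fderiv f u h' k') (second_fderiv f v h' k') < \<epsilon>) (at v)"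
      using W \<epsilon> by (auto simp: continuous_on_eq_continuous_at continuous_at dest: tendstoD)
    then have "eventually (\<lambda>u. dist (second_fderiv f u h' k') (second_fderiv f v h' k') < \<epsilon>) (nhds v)"
      by (rule eventually_nhds_conv_at[THEN iffD2, OF conjI]) (simp add: \<epsilon>)
    moreover have "eventually (\<lambda>u. u \<in> W) (nhds v)" using W by (rule eventually_nhds_in_open)
    ultimately have "eventually (\<lambda>u. u \<in> W \<and> \<bar>second_fderiv f u h' k' - second_fderiv f v h' k'\<bar> < \<epsilon>) (nhds v)"
      by eventually_elim (simp add: dist_real_def)
    then show ?thesis by (simp add: eventually_nhds_metric)
  qed
  from this[of h k] this[of k h] obtain d1 d2 where
    "d1 > 0" "d2 > 0"
    "\<And>u. dist u v < d1 \<Longrightarrow> u \<in> W \<and> \<bar>second_fderiv f u h k - second_fderiv f v h k\<bar> < \<epsilon>"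
    "\<And>u. dist u v < d2 \<Longrightarrow> u \<in> W \<and> \<bar>second_fderiv f u k h - second_fderiv f v k h\<bar> < \<epsilon>" by metis
  then obtain d where d: "d > 0"
    "\<And>u. dist u v < d \<Longrightarrow> u \<in> W \<and> \<bar>second_fderiv f u h k - second_fderiv f v h k\<bar> < \<epsilon>
      \<and> \<bar>second_fderiv f u k h - second_fderiv f v k h\<bar> < \<epsilon>"
    by (metis min_less_iff_conj)
  \<comment> \<open>Small enough that the whole parallelogram stays within distance \<open>d\<close>
    of \<open>v\<close>; the summand 1 covers \<open>h = k = 0\<close>.\<close>
  define s where "s = d / (2 * (norm h + norm k + 1))"
  have "norm h + norm k + 1 > 0" by (simp add: add_nonneg_pos)
  then have s: "s > 0" "s * (norm h + norm k) < d"
    using d(1) by (auto simp: s_def field_simps) (smt (verit) mult_nonneg_nonneg norm_ge_zero)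
  have near: "dist (v + r *\<^sub>R h + r' *\<^sub>R k) v < d" if "0 \<le> r" "r \<le> s" "0 \<le> r'" "r' \<le> s" for r r'
  proof -
    have "dist (v + r *\<^sub>R h + r' *\<^sub>R k) v \<le> norm (r *\<^sub>R h) + norm (r' *\<^sub>R k)"
      by (simp add: dist_norm algebra_simps norm_triangle_ineq del: norm_scaleR)
    also have "\<dots> \<le> s * norm h + s * norm k" using that by (intro add_mono) (auto simp: mult_right_mono)
    also have "\<dots> < d" using s by (simp add: algebra_simps)
    finally show ?thesis .
  qed
  obtain r1 r1' where 1: "0 < r1" "r1 < s" "0 < r1'" "r1' < s"
    "f (v + s *\<^sub>R h + s *\<^sub>R k) - f (v + s *\<^sub>R h) - f (v + s *\<^sub>R k) + f v
      = s ^ 2 * second_fderiv f (v + r1 *\<^sub>R h + r1' *\<^sub>R k) k h"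
    using second_difference_mvt[OF f s(1), of v h k] d(2) near by blast
  obtain r2 r2' where 2: "0 < r2" "r2 < s" "0 < r2'" "r2' < s"
    "f (v + s *\<^sub>R k + s *\<^sub>R h) - f (v + s *\<^sub>R k) - f (v + s *\<^sub>R h) + f v
      = s ^ 2 * second_fderiv f (v + r2 *\<^sub>R k + r2' *\<^sub>R h) h k"
  proof (rule second_difference_mvt[OF f s(1), of v k h])
    fix r r' assume "0 \<le> r" "r \<le> s" "0 \<le> r'" "r' \<le> s"
    then have "v + r' *\<^sub>R h + r *\<^sub>R k \<in> W" using d(2) near by blast
    then show "v + r *\<^sub>R k + r' *\<^sub>R h \<in> W" by (simp only: add.assoc add.commute[of "r *\<^sub>R k"])
  qed blast
  have swap: "v + x *\<^sub>R k + y *\<^sub>R h = v + y *\<^sub>R h + x *\<^sub>R k" for x y by simp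
  have "s ^ 2 * second_fderiv f (v + r1 *\<^sub>R h + r1' *\<^sub>R k) k h
      = s ^ 2 * second_fderiv f (v + r2' *\<^sub>R h + r2 *\<^sub>R k) h k"
    unfolding 1(5)[symmetric] 2(5)[symmetric, unfolded swap] by simp
  then have "second_fderiv f (v + r1 *\<^sub>R h + r1' *\<^sub>R k) k h = second_fderiv f (v + r2' *\<^sub>R h + r2 *\<^sub>R k) h k"
    using s by simp
  moreover have "\<bar>second_fderiv f (v + r1 *\<^sub>R h + r1' *\<^sub>R k) k h - second_fderiv f v k h\<bar> < \<epsilon>"
    using d(2)[OF near[of r1 r1']] 1 by simp
  moreover have "\<bar>second_fderiv f (v + r2' *\<^sub>R h + r2 *\<^sub>R k) h k - second_fderiv f v h k\<bar> < \<epsilon>"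
    using d(2)[OF near[of r2' r2]] 2 by simp
  moreover have False if "\<bar>C - A\<bar> < \<bar>B - A\<bar> / 2" "\<bar>C - B\<bar> < \<bar>B - A\<bar> / 2" for A B C :: real
    using that abs_triangle_ineq4[of "C - A" "C - B"] by simp
  ultimately show False unfolding \<epsilon>_def by simp
qed

lemma second_fderiv_symmetric:
  fixes f :: "'e::real_normed_vector \<Rightarrow> 'f::euclidean_space"
  assumes f: "Ck_on (Suc (Suc 0)) W f" and W: "open W" "v \<in> W"
  shows "second_fderiv f v h k = second_fderiv f v k h"
proof (rule euclidean_eqI)
  fix b :: 'f assume "b \<in> Basis"
  have B: "bounded_linear (\<lambda>x. x \<bullet> b)" by (rule bounded_linear_inner_left)
  have inner: "fderiv (\<lambda>u. g u \<bullet> b) u h = fderiv g u h \<bullet> b" if "g differentiable (at u)" for g :: "'e \<Rightarrow> 'f" and u h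
    using that by (intro fderiv_eqI bounded_linear.has_derivative[OF B]) (simp add: frechet_derivative_works)
  have "second_fderiv (\<lambda>u. f u \<bullet> b) v h k = second_fderiv f v h k \<bullet> b" for h k
  proof -
    have "eventually (\<lambda>u. u \<in> W) (nhds v)" using W by (rule eventually_nhds_in_open)
    then have "eventually (\<lambda>u. fderiv (\<lambda>u. f u \<bullet> b) u k = fderiv f u k \<bullet> b) (nhds v)"
      by eventually_elim (intro inner Ck_on_differentiable[OF f])
    then have "second_fderiv (\<lambda>u. f u \<bullet> b) v h k = fderiv (\<lambda>u. fderiv f u k \<bullet> b) v h"
      unfolding second_fderiv_def by (simp add: fderiv_cong_nhds)
    also have "\<dots> = second_fderiv f v h k \<bullet> b"
      unfolding second_fderiv_def by (intro inner Ck_on_differentiable[OF Ck_on_fderiv[OF f]] W)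
    finally show ?thesis .
  qed
  moreover have "Ck_on (Suc (Suc 0)) W (\<lambda>u. f u \<bullet> b)" by (rule Ck_on_bounded_linear[OF W(1) B f])
  ultimately show "second_fderiv f v h k \<bullet> b = second_fderiv f v k h \<bullet> b"
    using second_fderiv_symmetric_real W by metis
qed

text \<open>A condition at one point that is stable under composition, so the chain rule can be used
  without tracking domains. It carries the symmetry along, since this is what \<open>jet_act\<close>
  requires of a jet.\<close>

definition twice_differentiable ::
    "('e::real_normed_vector \<Rightarrow> 'f::real_normed_vector) \<Rightarrow> 'e \<Rightarrow> bool"
  where "twice_differentiable f v \<longleftrightarrow>
    eventually (\<lambda>u. f differentiable (at u)) (nhds v) \<and>
    (\<forall>k. (\<lambda>u. fderiv f u k) differentiable (at v)) \<and>
    (\<forall>h k. second_fderiv f v h k = second_fderiv f v k h)"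

lemma twice_differentiableD:
  assumes "twice_differentiable f v"
  shows "f differentiable (at v)" "(\<lambda>u. fderiv f u k) differentiable (at v)"
  using assms eventually_nhds_x_imp_x[of "\<lambda>u. f differentiable (at u)" v]
  unfolding twice_differentiable_def by blast+

lemma C2_twice_differentiable:
  fixes f :: "'e::real_normed_vector \<Rightarrow> 'f::euclidean_space"
  assumes "Ck_on (Suc (Suc 0)) W f" "open W" "v \<in> W"
  shows "twice_differentiable f v"
  unfolding twice_differentiable_def
proof (intro conjI allI)
  have "eventually (\<lambda>u. u \<in> W) (nhds v)" using assms by (intro eventually_nhds_in_open)
  then show "eventually (\<lambda>u. f differentiable (at u)) (nhds v)"
    by eventually_elim (rule Ck_on_differentiable[OF assms(1)])
  show "(\<lambda>u. fderiv f u k) differentiable (at v)" for k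
    by (rule Ck_on_differentiable[OF Ck_on_fderiv[OF assms(1)] assms(3)])
  show "second_fderiv f v h k = second_fderiv f v k h" for h k
    by (rule second_fderiv_symmetric[OF assms])
qed

text \<open>A product rule for a derivative whose base point and direction both move. Expanding the
  direction in \<open>Basis\<close> reduces it to finitely many products of a scalar and a vector.
  It serves the chain rule, with a moving Dq, and the differentiation of a transformed vector field,
  with \<open>q\<close> the identity.\<close>

lemma has_derivative_fderiv_apply:
  fixes f :: "'e::euclidean_space \<Rightarrow> 'f::euclidean_space"
  assumes f: "twice_differentiable f (q v)" and q: "q differentiable (at v)" and g: "g differentiable (at v)"
  shows "((\<lambda>u. fderiv f (q u) (g u)) has_derivative
    (\<lambda>h. second_fderiv f (q v) (fderiv q v h) (g v) + fderiv f (q v) (fderiv g v h))) (at v)"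
proof -
  have ev: "eventually (\<lambda>u. f differentiable (at (q u))) (nhds v)"
  proof -
    have "isCont q v" using q by (rule differentiable_imp_continuous_within)
    then have "filterlim q (nhds (q v)) (nhds v)" by (simp add: isCont_def tendsto_at_iff_tendsto_nhds)
    then show ?thesis
      using f by (auto simp: twice_differentiable_def filterlim_iff)
  qed
  have expand: "eventually (\<lambda>u. (\<Sum>b\<in>Basis. (k u \<bullet> b) *\<^sub>R fderiv f (q u) b) = fderiv f (q u) (k u)) (nhds v)" for k
    using ev by eventually_elim (rule fderiv_basis[symmetric])
  have D: "((\<lambda>u. fderiv f (q u) b) has_derivative (\<lambda>h. second_fderiv f (q v) (fderiv q v h) b)) (at v)" for b
    unfolding second_fderiv_def
    by (rule has_derivative_compose[of q "fderiv q v" v UNIV "\<lambda>u. fderiv f u b"])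
      (use q twice_differentiableD(2)[OF f] in \<open>simp_all add: frechet_derivative_works\<close>)
  have second_expand: "second_fderiv f (q v) x k = (\<Sum>b\<in>Basis. (k \<bullet> b) *\<^sub>R second_fderiv f (q v) x b)" for x k
  proof -
    have "eventually (\<lambda>u. (\<Sum>b\<in>Basis. (k \<bullet> b) *\<^sub>R fderiv f u b) = fderiv f u k) (nhds (q v))"
      using f unfolding twice_differentiable_def by (auto elim!: eventually_mono intro: fderiv_basis[symmetric])
    then have "second_fderiv f (q v) x k = fderiv (\<lambda>u. \<Sum>b\<in>Basis. (k \<bullet> b) *\<^sub>R fderiv f u b) (q v) x"
      unfolding second_fderiv_def by (simp add: fderiv_cong_nhds)
    also have "\<dots> = (\<Sum>b\<in>Basis. (k \<bullet> b) *\<^sub>R second_fderiv f (q v) x b)"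
      unfolding second_fderiv_def
      by (intro fderiv_eqI has_derivative_sum has_derivative_scaleR_right)
        (use twice_differentiableD(2)[OF f] in \<open>simp add: frechet_derivative_works\<close>)
    finally show ?thesis .
  qed
  have "((\<lambda>u. \<Sum>b\<in>Basis. (g u \<bullet> b) *\<^sub>R fderiv f (q u) b) has_derivative
      (\<lambda>h. \<Sum>b\<in>Basis. (g v \<bullet> b) *\<^sub>R second_fderiv f (q v) (fderiv q v h) b
        + (fderiv g v h \<bullet> b) *\<^sub>R fderiv f (q v) b)) (at v)"
    using g by (intro has_derivative_sum has_derivative_scaleR has_derivative_inner_left D)
      (simp add: frechet_derivative_works)
  then have "((\<lambda>u. \<Sum>b\<in>Basis. (g u \<bullet> b) *\<^sub>R fderiv f (q u) b) has_derivative
      (\<lambda>h. second_fderiv f (q v) (fderiv q v h) (g v) + fderiv f (q v) (fderiv g v h))) (at v)"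
    unfolding sum.distrib second_expand[symmetric] fderiv_basis[OF twice_differentiableD(1)[OF f], symmetric] .
  then show ?thesis by (rule has_derivative_cong_nhds[OF expand])
qed

text \<open>This is the composition law of 2-jets. Its second formula also shows that symmetry
  passes from the factors to the composition.\<close>

lemma second_order_chain_rule:
  fixes f :: "'e::euclidean_space \<Rightarrow> 'f::euclidean_space" and q :: "'d::euclidean_space \<Rightarrow> 'e"
  assumes f: "twice_differentiable f (q v)" and q: "twice_differentiable q v"
  shows "fderiv (f \<circ> q) v h = fderiv f (q v) (fderiv q v h)"
    and "second_fderiv (f \<circ> q) v h k =
      fderiv f (q v) (second_fderiv q v h k) + second_fderiv f (q v) (fderiv q v h) (fderiv q v k)"
    and "twice_differentiable (f \<circ> q) v"
proof -
  have chain: "((f \<circ> q) has_derivative (fderiv f (q u) \<circ> fderiv q u)) (at u)"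
    if "f differentiable (at (q u))" "q differentiable (at u)" for u
    using that by (intro diff_chain_at) (simp_all add: frechet_derivative_works)
  show "fderiv (f \<circ> q) v h = fderiv f (q v) (fderiv q v h)"
    using fderiv_eqI[OF chain] twice_differentiableD(1)[OF f] twice_differentiableD(1)[OF q] by simp
  have "isCont q v" using twice_differentiableD(1)[OF q] by (rule differentiable_imp_continuous_within)
  then have "filterlim q (nhds (q v)) (nhds v)" by (simp add: isCont_def tendsto_at_iff_tendsto_nhds)
  then have "eventually (\<lambda>u. f differentiable (at (q u))) (nhds v)"
    using f by (auto simp: twice_differentiable_def filterlim_iff)
  moreover have "eventually (\<lambda>u. q differentiable (at u)) (nhds v)"
    using q by (simp add: twice_differentiable_def)
  ultimately have ev: "eventually (\<lambda>u. (f \<circ> q) differentiable (at u) \<and>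
      (\<forall>k. fderiv f (q u) (fderiv q u k) = fderiv (f \<circ> q) u k)) (nhds v)"
    by eventually_elim (use chain fderiv_eqI[OF chain] in \<open>auto simp: differentiable_def\<close>)
  have D: "((\<lambda>u. fderiv (f \<circ> q) u k) has_derivative
      (\<lambda>h. second_fderiv f (q v) (fderiv q v h) (fderiv q v k) + fderiv f (q v) (second_fderiv q v h k))) (at v)" for k
    unfolding second_fderiv_def[of q]
  proof (rule has_derivative_cong_nhds)
    show "((\<lambda>u. fderiv f (q u) (fderiv q u k)) has_derivative
      (\<lambda>h. second_fderiv f (q v) (fderiv q v h) (fderiv q v k) + fderiv f (q v) (fderiv (\<lambda>u. fderiv q u k) v h))) (at v)"
      by (intro has_derivative_fderiv_apply f twice_differentiableD[OF q])
    show "eventually (\<lambda>u. fderiv f (q u) (fderiv q u k) = fderiv (f \<circ> q) u k) (nhds v)"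
      using ev by eventually_elim blast
  qed
  then show second: "second_fderiv (f \<circ> q) v h k =
      fderiv f (q v) (second_fderiv q v h k) + second_fderiv f (q v) (fderiv q v h) (fderiv q v k)" for h k
    by (simp add: second_fderiv_def[of "f \<circ> q"] fderiv_eqI[OF D])
  have "second_fderiv (f \<circ> q) v h k = second_fderiv (f \<circ> q) v k h" for h k
    unfolding second using f q by (simp add: twice_differentiable_def)
  moreover have "(\<lambda>u. fderiv (f \<circ> q) u k) differentiable (at v)" for k
    using D by (auto simp: differentiable_def)
  moreover have "eventually (\<lambda>u. (f \<circ> q) differentiable (at u)) (nhds v)"
    using ev by eventually_elim blast
  ultimately show "twice_differentiable (f \<circ> q) v" unfolding twice_differentiable_def by blast
qed

section \<open>Change of charts on the rough velocity bundle\<close>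

lemma linear_vec_expand:
  fixes f :: "real^'m::finite \<Rightarrow> 'b::real_vector"
  assumes "linear f"
  shows "f x = (\<Sum>j\<in>UNIV. (x $ j) *\<^sub>R f (axis j 1))"
proof -
  have "f x = f (\<Sum>j\<in>UNIV. (x $ j) *\<^sub>R axis j 1)"
    using basis_expansion[of x] by (simp add: scalar_mult_eq_scaleR)
  then show ?thesis using assms by (simp add: linear_sum linear_cmul)
qed

lemma fderiv_nth:
  fixes f :: "'e::real_normed_vector \<Rightarrow> real^'m::finite"
  assumes "f differentiable (at v)"
  shows "fderiv (\<lambda>u. f u $ i) v h = fderiv f v h $ i"
  using assms
  by (intro fderiv_eqI bounded_linear.has_derivative[OF bounded_linear_vec_nth]) (simp add: frechet_derivative_works)

text \<open>In the outer direction linearity is that of a derivative; symmetry transfers it to the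
  inner direction.\<close>

lemma twice_differentiable_linear:
  assumes "twice_differentiable f v"
  shows "linear (fderiv f v)" "linear (second_fderiv f v h)"
    "linear (\<lambda>k. second_fderiv f v k h)"
proof -
  show "linear (fderiv f v)"
    by (intro bounded_linear.linear fderiv_bounded_linear twice_differentiableD(1)[OF assms])
  have "linear (\<lambda>k. second_fderiv f v k h)"
    unfolding second_fderiv_def
    by (intro bounded_linear.linear fderiv_bounded_linear twice_differentiableD(2)[OF assms])
  moreover have "(\<lambda>k. second_fderiv f v k h) = second_fderiv f v h"
    using assms unfolding twice_differentiable_def by blast
  ultimately show "linear (second_fderiv f v h)" "linear (\<lambda>k. second_fderiv f v k h)" by simp_all
qed

lemma jet2_eq:
  fixes \<phi> :: "real^'m::finite \<Rightarrow> real^'m"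
  assumes "twice_differentiable \<phi> 0"
  shows "fst (jet2 \<phi>) $ i $ j = fderiv \<phi> 0 (axis j 1) $ i"
    and "snd (jet2 \<phi>) $ i $ j $ k = second_fderiv \<phi> 0 (axis j 1) (axis k 1) $ i"
proof -
  show "fst (jet2 \<phi>) $ i $ j = fderiv \<phi> 0 (axis j 1) $ i"
    using fderiv_nth[OF twice_differentiableD(1)[OF assms]] by (simp add: jet2_def pderiv_at_def)
  have "eventually (\<lambda>u. \<phi> differentiable (at u)) (nhds 0)"
    using assms by (simp add: twice_differentiable_def)
  then have "eventually (\<lambda>u. fderiv (\<lambda>v. \<phi> v $ i) u (axis k 1) = fderiv \<phi> u (axis k 1) $ i) (nhds 0)"
    by eventually_elim (rule fderiv_nth)
  then have "fderiv (\<lambda>u. fderiv (\<lambda>v. \<phi> v $ i) u (axis k 1)) 0 = fderiv (\<lambda>u. fderiv \<phi> u (axis k 1) $ i) 0"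
    by (rule fderiv_cong_nhds)
  then show "snd (jet2 \<phi>) $ i $ j $ k = second_fderiv \<phi> 0 (axis j 1) (axis k 1) $ i"
    using fderiv_nth[OF twice_differentiableD(2)[OF assms]]
    by (simp add: jet2_def pderiv_at_def[abs_def] second_fderiv_def)
qed

lemma jet2_cong_nhds:
  fixes \<phi> \<psi> :: "real^'m::finite \<Rightarrow> real^'m"
  assumes "eventually (\<lambda>u. \<phi> u = \<psi> u) (nhds 0)"
  shows "jet2 \<phi> = jet2 \<psi>"
proof -
  have *: "eventually (\<lambda>u. \<phi> u $ i = \<psi> u $ i) (nhds 0)" for i
    using assms by eventually_elim simp
  have "eventually (\<lambda>u. fderiv (\<lambda>v. \<phi> v $ i) u (axis k 1) = fderiv (\<lambda>v. \<psi> v $ i) u (axis k 1)) (nhds 0)" for i k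
    using eventually_fderiv_cong[OF *[of i]] by (rule eventually_mono) simp
  then have "fderiv (\<lambda>u. fderiv (\<lambda>v. \<phi> v $ i) u (axis k 1)) 0 = fderiv (\<lambda>u. fderiv (\<lambda>v. \<psi> v $ i) u (axis k 1)) 0" for i k
    by (rule fderiv_cong_nhds)
  then show ?thesis
    by (simp add: jet2_def pderiv_at_def[abs_def] fderiv_cong_nhds[OF *])
qed

text \<open>Fixing the forest gives a vector of the model space; in terms of these vectors the jet
  action involves only first and second derivatives as maps, without indices.\<close>

definition fiber_column :: "('m::finite, 'n::finite) rv_fiber \<Rightarrow> 'n forest \<Rightarrow> real^'m"
  where "fiber_column g \<tau> = (\<chi> i. g $ i $ \<tau>)"

lemma fiber_eqI:
  assumes "\<And>\<alpha>. fiber_column g (Vtx \<alpha>) = fiber_column h (Vtx \<alpha>)"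
    and "\<And>\<alpha> \<beta>. fiber_column g (Dot \<alpha> \<beta>) = fiber_column h (Dot \<alpha> \<beta>)"
    and "\<And>\<alpha> \<beta>. fiber_column g (Ladder \<alpha> \<beta>) = fiber_column h (Ladder \<alpha> \<beta>)"
  shows "g = h"
proof -
  have "fiber_column g \<tau> = fiber_column h \<tau>" for \<tau>
  proof (cases \<tau>)
    case (Dots P)
    then show ?thesis using assms(2) by (cases P) auto
  qed (use assms in auto)
  then show ?thesis by (simp add: fiber_column_def vec_eq_iff)
qed

lemma jet_act_columns:
  fixes \<phi> :: "real^'m::finite \<Rightarrow> real^'m" and g :: "('m, 'n::finite) rv_fiber"
  assumes \<phi>: "twice_differentiable \<phi> 0"
  defines "c \<equiv> fiber_column g"
  shows "fiber_column (jet_act (jet2 \<phi>) g) (Vtx \<alpha>) = fderiv \<phi> 0 (c (Vtx \<alpha>))"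
    and "fiber_column (jet_act (jet2 \<phi>) g) (Dot \<alpha> \<beta>) =
      fderiv \<phi> 0 (c (Dot \<alpha> \<beta>)) + second_fderiv \<phi> 0 (c (Vtx \<alpha>)) (c (Vtx \<beta>))"
    and "fiber_column (jet_act (jet2 \<phi>) g) (Ladder \<alpha> \<beta>) = fderiv \<phi> 0 (c (Ladder \<alpha> \<beta>))"
proof -
  have sym: "snd (jet2 \<phi>) $ i $ j $ k = snd (jet2 \<phi>) $ i $ k $ j" for i j k
    using \<phi> by (simp add: jet2_eq twice_differentiable_def)
  have 1: "fderiv \<phi> 0 (c \<tau>) $ i = (\<Sum>j\<in>UNIV. fst (jet2 \<phi>) $ i $ j * g $ j $ \<tau>)" for i \<tau>
    by (subst linear_vec_expand[OF twice_differentiable_linear(1)[OF \<phi>]])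
      (simp add: jet2_eq[OF \<phi>] c_def fiber_column_def mult.commute)
  have expand: "second_fderiv \<phi> 0 x y = (\<Sum>j\<in>UNIV. \<Sum>k\<in>UNIV. (x $ j * y $ k) *\<^sub>R second_fderiv \<phi> 0 (axis j 1) (axis k 1))" for x y
  proof -
    have lin: "linear (\<lambda>x. second_fderiv \<phi> 0 x y)" for y
      by (rule twice_differentiable_linear(3)[OF \<phi>])
    have "second_fderiv \<phi> 0 x y = (\<Sum>j\<in>UNIV. (x $ j) *\<^sub>R second_fderiv \<phi> 0 (axis j 1) y)"
      by (rule linear_vec_expand[OF lin])
    also have "\<dots> = (\<Sum>j\<in>UNIV. (x $ j) *\<^sub>R (\<Sum>k\<in>UNIV. (y $ k) *\<^sub>R second_fderiv \<phi> 0 (axis j 1) (axis k 1)))"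
      by (subst linear_vec_expand[OF twice_differentiable_linear(2)[OF \<phi>], of _ y]) simp
    finally show ?thesis by (simp add: scaleR_sum_right)
  qed
  have 2: "second_fderiv \<phi> 0 (c (Vtx \<alpha>)) (c (Vtx \<beta>)) $ i =
      (\<Sum>j\<in>UNIV. \<Sum>k\<in>UNIV. snd (jet2 \<phi>) $ i $ j $ k * g $ j $ Vtx \<alpha> * g $ k $ Vtx \<beta>)" for i
    by (subst expand) (simp add: jet2_eq[OF \<phi>] c_def fiber_column_def mult_ac)
  show "fiber_column (jet_act (jet2 \<phi>) g) (Vtx \<alpha>) = fderiv \<phi> 0 (c (Vtx \<alpha>))"
    "fiber_column (jet_act (jet2 \<phi>) g) (Dot \<alpha> \<beta>) =
      fderiv \<phi> 0 (c (Dot \<alpha> \<beta>)) + second_fderiv \<phi> 0 (c (Vtx \<alpha>)) (c (Vtx \<beta>))"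
    "fiber_column (jet_act (jet2 \<phi>) g) (Ladder \<alpha> \<beta>) = fderiv \<phi> 0 (c (Ladder \<alpha> \<beta>))"
    by (simp_all add: vec_eq_iff fiber_column_def[of "jet_act _ _"] jet_act[OF sym] 1 2)
qed

text \<open>For a pair \<open>Dot \<alpha> \<beta>\<close> both sides contain the second derivative
  of the inner map pushed forward and that of the outer map on transformed vectors: these are the
  two terms of the second-order chain rule.\<close>

lemma jet_act_compose:
  fixes \<phi> \<theta> :: "real^'m::finite \<Rightarrow> real^'m" and g :: "('m, 'n::finite) rv_fiber"
  assumes \<phi>: "twice_differentiable \<phi> 0" and \<theta>: "twice_differentiable \<theta> 0" "\<theta> 0 = 0"
  shows "jet_act (jet2 (\<phi> \<circ> \<theta>)) g = jet_act (jet2 \<phi>) (jet_act (jet2 \<theta>) g)"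
proof -
  have \<phi>': "twice_differentiable \<phi> (\<theta> 0)" using \<phi> \<theta> by simp
  note chain = second_order_chain_rule[OF \<phi>' \<theta>(1)]
  show ?thesis
    by (rule fiber_eqI)
      (simp_all add: jet_act_columns[OF chain(3)] jet_act_columns[OF \<phi>] jet_act_columns[OF \<theta>(1)] chain(1,2) \<theta>(2)
        linear_add[OF twice_differentiable_linear(1)[OF \<phi>]])
qed

section \<open>Well-definedness of fiber coordinates\<close>

lemma Ck_on_const: "Ck_on k W (\<lambda>v. c)"
  by (induction k arbitrary: c) (simp_all add: frechet_derivative_const)

lemma smooth_on_id: "smooth_on UNIV id"
proof -
  have "Ck_on k UNIV (id :: 'a \<Rightarrow> 'a)" for k
    by (cases k) (auto simp: Ck_on_const frechet_derivative_id[unfolded id_def] id_def)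
  then show ?thesis by (simp add: smooth_on_def)
qed

lemma smooth_twice_differentiable:
  fixes f :: "'e::real_normed_vector \<Rightarrow> 'f::euclidean_space"
  shows "smooth_on W f \<Longrightarrow> v \<in> W \<Longrightarrow> twice_differentiable f v"
  by (metis C2_twice_differentiable smooth_on_def)

lemma pointed_germ_twice_differentiable: "pointed_germ \<theta> \<Longrightarrow> twice_differentiable \<theta> 0"
  by (auto simp: pointed_germ_def intro: smooth_twice_differentiable)

lemma pointed_germ_id: "pointed_germ id"
  using smooth_on_id by (auto simp: pointed_germ_def)

lemma jet_act_id:
  fixes g :: "('m::finite, 'n::finite) rv_fiber"
  shows "jet_act (jet2 id) g = g"
proof (rule fiber_eqI)
  have *: "second_fderiv id 0 h k = 0" for h k :: "real^'m" by (simp add: second_fderiv_def)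
  note jet_act_columns[OF pointed_germ_twice_differentiable[OF pointed_germ_id], of g]
  then show "fiber_column (jet_act (jet2 id) g) (Vtx \<alpha>) = fiber_column g (Vtx \<alpha>)"
    "fiber_column (jet_act (jet2 id) g) (Dot \<alpha> \<beta>) = fiber_column g (Dot \<alpha> \<beta>)"
    "fiber_column (jet_act (jet2 id) g) (Ladder \<alpha> \<beta>) = fiber_column g (Ladder \<alpha> \<beta>)" for \<alpha> \<beta>
    by (simp_all add: *)
qed

lemma local_diffeo_chart:
  assumes "local_diffeo M \<psi>" "(U, x) \<in> charts M" "\<psi> 0 \<in> U"
  shows "twice_differentiable (x \<circ> \<psi>) 0" "eventually (\<lambda>u. \<psi> u \<in> U) (nhds 0)"
proof -
  obtain W where W: "0 \<in> W" "smooth_on (W \<inter> \<psi> -` U) (x \<circ> \<psi>)"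
    using assms unfolding local_diffeo_def by blast
  then show "twice_differentiable (x \<circ> \<psi>) 0" using assms(3) by (auto intro: smooth_twice_differentiable)
  have "open (W \<inter> \<psi> -` U)" using W by (simp add: smooth_on_def)
  then have "eventually (\<lambda>u. u \<in> W \<inter> \<psi> -` U) (nhds 0)"
    using W assms(3) by (intro eventually_nhds_in_open) auto
  then show "eventually (\<lambda>u. \<psi> u \<in> U) (nhds 0)" by eventually_elim simp
qed

lemma frame_jet_self: "local_diffeo M \<psi> \<Longrightarrow> \<psi> \<in> frame_jet M \<psi>"
  by (auto simp: frame_jet_def)

lemma frame_jet_memD:
  assumes "\<phi> \<in> frame_jet M \<psi>"
  shows "\<phi> 0 = \<psi> 0" "(U, x) \<in> charts M \<Longrightarrow> \<psi> 0 \<in> U \<Longrightarrow> jet2 (x \<circ> \<phi>) = jet2 (x \<circ> \<psi>)"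
  using assms unfolding frame_jet_def by auto

text \<open>A class is the image of one generator, so each of its members arises from the generator
  by a germ \<theta>. By \<open>jet_act_compose\<close> the change of frame and the change of fiber
  vector cancel in every chart, which gives the uniqueness needed to evaluate both definite
  descriptions.\<close>

lemma fiber_coords_representative:
  fixes M :: "('a, 'm::finite) manifold" and c :: "('a, 'm, 'n::finite) rough_velocity"
  assumes "c \<in> rv_bundle M"
  obtains \<psi> g where "local_diffeo M \<psi>" "rv_proj M c = \<psi> 0"
    "\<And>U x. (U, x) \<in> charts M \<Longrightarrow> \<psi> 0 \<in> U \<Longrightarrow> fiber_coords M x c = jet_act (jet2 (x \<circ> \<psi>)) g"
proof -
  obtain \<psi> g where \<psi>: "local_diffeo M \<psi>" and c: "c = rv_rel M `` {(frame_jet M \<psi>, g)}"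
    using assms unfolding rv_bundle_def frame_bundle_def quotient_def by auto
  have mem: "(frame_jet M \<psi>, g) \<in> c"
  proof -
    have "pointed_germ (id :: real^'m \<Rightarrow> real^'m)" by (rule pointed_germ_id)
    moreover have "jet2 (id :: real^'m \<Rightarrow> real^'m) \<in> jet_group"
      unfolding jet_group_def using pointed_germ_id by force
    ultimately have "((frame_jet M \<psi>, g), (frame_jet M (\<psi> \<circ> id), g)) \<in> rv_rel M"
      unfolding rv_rel_def using \<psi> jet_act_id by blast
    then show ?thesis by (simp add: c)
  qed
  have unique: "\<psi>' 0 = \<psi> 0 \<and> (\<forall>(U, x)\<in>charts M. \<psi> 0 \<in> U \<longrightarrow>
      jet_act (jet2 (x \<circ> \<psi>')) g' = jet_act (jet2 (x \<circ> \<psi>)) g)"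
    if \<psi>': "local_diffeo M \<psi>'" "(frame_jet M \<psi>', g') \<in> c" for \<psi>' g'
  proof -
    have "((frame_jet M \<psi>, g), (frame_jet M \<psi>', g')) \<in> rv_rel M" using \<psi>'(2) by (simp add: c)
    then obtain \<psi>1 \<theta> where *: "frame_jet M \<psi> = frame_jet M \<psi>1" "frame_jet M \<psi>' = frame_jet M (\<psi>1 \<circ> \<theta>)"
      "local_diffeo M \<psi>1" "pointed_germ \<theta>" "jet_act (jet2 \<theta>) g' = g"
      unfolding rv_rel_def by auto
    \<comment> \<open>Frames are sets of germs. Since each contains its own germ, equality of two
      frames becomes a membership, which yields equal base points and equal jets in charts.\<close>
    have m': "\<psi>' \<in> frame_jet M (\<psi>1 \<circ> \<theta>)" using frame_jet_self[OF \<psi>'(1)] * by simp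
    have m: "\<psi>1 \<in> frame_jet M \<psi>" using frame_jet_self[OF *(3)] * by simp
    have \<theta>0: "\<theta> 0 = 0" using *(4) by (simp add: pointed_germ_def)
    have 0: "\<psi>1 0 = \<psi> 0" by (rule frame_jet_memD(1)[OF m])
    have "jet_act (jet2 (x \<circ> \<psi>')) g' = jet_act (jet2 (x \<circ> \<psi>)) g"
      if U: "(U, x) \<in> charts M" "\<psi> 0 \<in> U" for U x
    proof -
      have "jet2 (x \<circ> \<psi>') = jet2 ((x \<circ> \<psi>1) \<circ> \<theta>)"
        using frame_jet_memD(2)[OF m' U(1)] U(2) 0 \<theta>0 by (simp add: comp_assoc)
      then have "jet_act (jet2 (x \<circ> \<psi>')) g' = jet_act (jet2 (x \<circ> \<psi>1)) (jet_act (jet2 \<theta>) g')"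
        using jet_act_compose[OF local_diffeo_chart(1)[OF *(3) U(1)] pointed_germ_twice_differentiable[OF *(4)] \<theta>0] U 0
        by simp
      also have "\<dots> = jet_act (jet2 (x \<circ> \<psi>)) g"
        using frame_jet_memD(2)[OF m U] *(5) by simp
      finally show ?thesis .
    qed
    then show ?thesis using frame_jet_memD(1)[OF m'] 0 \<theta>0 by auto
  qed
  show thesis
  proof
    show "local_diffeo M \<psi>" by (rule \<psi>)
    show "rv_proj M c = \<psi> 0"
      unfolding rv_proj_def by (rule the_equality) (use \<psi> mem unique in blast)+
    show "fiber_coords M x c = jet_act (jet2 (x \<circ> \<psi>)) g" if "(U, x) \<in> charts M" "\<psi> 0 \<in> U" for U x
      unfolding fiber_coords_def by (rule the_equality) (use \<psi> mem unique that in blast)+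
  qed
qed

lemma chart_properties:
  assumes "smooth_manifold M" "(U, x) \<in> charts M"
  shows "inj_on x U" "openin (mtop M) U" "open (x ` U)" "U \<subseteq> topspace (mtop M)"
    and "homeomorphic_map (subtopology (mtop M) U) (top_of_set (x ` U)) x"
proof -
  have t: "topological_chart (mtop M) (U, x)" using assms unfolding smooth_manifold_def by blast
  then show o: "openin (mtop M) U" and "open (x ` U)"
    and h: "homeomorphic_map (subtopology (mtop M) U) (top_of_set (x ` U)) x"
    by (auto simp: topological_chart_def)
  show s: "U \<subseteq> topspace (mtop M)" using o by (rule openin_subset)
  show "inj_on x U"
    using homeomorphic_imp_injective_map[OF h] s by (simp add: topspace_subtopology inf.absorb2)
qed

lemma transition_smooth:
  assumes "smooth_manifold M" "(U, x) \<in> charts M" "(V, y) \<in> charts M"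
  shows "smooth_on (x ` (U \<inter> V)) (y \<circ> inv_into U x)"
  using assms unfolding smooth_manifold_def smooth_compatible_def by blast

text \<open>Near 0 the germ in the second chart is \<phi> after the germ in the first. As
  \<open>x \<circ> \<psi>\<close> sends 0 to \<open>v\<close>, which may differ from 0, the chain
  rule is applied directly instead of the composition law for pointed jets.\<close>

lemma fiber_coords_change:
  fixes M :: "('a, 'm::finite) manifold" and c :: "('a, 'm, 'n::finite) rough_velocity"
  assumes M: "smooth_manifold M" and U: "(U, x) \<in> charts M" and V: "(V, y) \<in> charts M"
    and c: "c \<in> rv_bundle M" "rv_proj M c \<in> U \<inter> V"
  defines "\<phi> \<equiv> y \<circ> inv_into U x" and "v \<equiv> x (rv_proj M c)"
  defines "C \<equiv> fiber_column (fiber_coords M x c)" and "C' \<equiv> fiber_column (fiber_coords M y c)"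
  shows "C' (Vtx \<alpha>) = fderiv \<phi> v (C (Vtx \<alpha>))"
    and "C' (Dot \<alpha> \<beta>) = fderiv \<phi> v (C (Dot \<alpha> \<beta>)) + second_fderiv \<phi> v (C (Vtx \<alpha>)) (C (Vtx \<beta>))"
    and "C' (Ladder \<alpha> \<beta>) = fderiv \<phi> v (C (Ladder \<alpha> \<beta>))"
proof -
  obtain \<psi> g where \<psi>: "local_diffeo M \<psi>" "rv_proj M c = \<psi> 0"
    and coords: "\<And>U x. (U, x) \<in> charts M \<Longrightarrow> \<psi> 0 \<in> U \<Longrightarrow> fiber_coords M x c = jet_act (jet2 (x \<circ> \<psi>)) g"
    using fiber_coords_representative[OF c(1)] by blast
  have 0: "\<psi> 0 \<in> U" "\<psi> 0 \<in> V" using c(2) \<psi>(2) by auto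
  have x: "twice_differentiable (x \<circ> \<psi>) 0" by (rule local_diffeo_chart(1)[OF \<psi>(1) U 0(1)])
  have v: "v = (x \<circ> \<psi>) 0" by (simp add: v_def \<psi>(2))
  have \<phi>: "twice_differentiable \<phi> ((x \<circ> \<psi>) 0)"
    unfolding \<phi>_def using 0 by (intro smooth_twice_differentiable[OF transition_smooth[OF M U V]]) auto
  have inj: "inj_on x U" by (rule chart_properties(1)[OF M U])
  have "eventually (\<lambda>u. (y \<circ> \<psi>) u = (\<phi> \<circ> (x \<circ> \<psi>)) u) (nhds 0)"
    using local_diffeo_chart(2)[OF \<psi>(1) U 0(1)]
    by eventually_elim (simp add: \<phi>_def inv_into_f_f[OF inj])
  then have "jet2 (y \<circ> \<psi>) = jet2 (\<phi> \<circ> (x \<circ> \<psi>))" by (rule jet2_cong_nhds)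
  then have y: "fiber_coords M y c = jet_act (jet2 (\<phi> \<circ> (x \<circ> \<psi>))) g" using coords[OF V 0(2)] by simp
  note chain = second_order_chain_rule[OF \<phi> x]
  note simps = C_def C'_def y coords[OF U 0(1)] v jet_act_columns[OF chain(3)] jet_act_columns[OF x] chain(1,2)
    linear_add[OF twice_differentiable_linear(1)[OF \<phi>]]
  show "C' (Vtx \<alpha>) = fderiv \<phi> v (C (Vtx \<alpha>))"
    "C' (Dot \<alpha> \<beta>) = fderiv \<phi> v (C (Dot \<alpha> \<beta>)) + second_fderiv \<phi> v (C (Vtx \<alpha>)) (C (Vtx \<beta>))"
    "C' (Ladder \<alpha> \<beta>) = fderiv \<phi> v (C (Ladder \<alpha> \<beta>))"
    by (simp_all only: simps add.assoc)
qed

definition chart_field ::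
    "('a, 'm::finite) manifold \<Rightarrow> ('a \<Rightarrow> ('a, 'm, 'n::finite) rough_velocity) \<Rightarrow> 'a set \<Rightarrow> ('a \<Rightarrow> real^'m)
      \<Rightarrow> 'n forest \<Rightarrow> real^'m \<Rightarrow> real^'m"
  where "chart_field M f U x \<tau> v = fiber_column (fiber_coords M x (f (inv_into U x v))) \<tau>"

lemma Ck_on_chart_field:
  fixes f :: "'a \<Rightarrow> ('a, 'm::finite, 'n::finite) rough_velocity"
  assumes "rough_velocity_field M f" "(U, x) \<in> charts M"
  shows "Ck_on k (x ` U) (chart_field M f U x \<tau>)"
proof -
  have s: "smooth_on (x ` U) (\<lambda>v. fiber_coords M x (f (inv_into U x v)))"
    using assms unfolding rough_velocity_field_def by blast
  have "linear (\<lambda>g::('m, 'n) rv_fiber. fiber_column g \<tau>)"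
    by (rule linearI) (simp_all add: fiber_column_def vec_eq_iff)
  then have "bounded_linear (\<lambda>g::('m, 'n) rv_fiber. fiber_column g \<tau>)" by (rule linear_conv_bounded_linear[THEN iffD1])
  then show ?thesis
    unfolding chart_field_def[abs_def] using s by (auto simp: smooth_on_def intro: Ck_on_bounded_linear)
qed

text \<open>The law for vertices reads G(\<phi>(u)) = D\<phi>(u) F(u) near the point.
  Differentiating it in direction \<open>F (Vtx \<alpha>)\<close> produces a second derivative of
  \<phi>, which is exactly the extra term in the law for \<open>Dot \<alpha> \<beta>\<close>.
  Admissibility in the given chart thus becomes admissibility in the other one, up to the injective
  map D\<phi>.\<close>

lemma admissible_in_chart:
  fixes f :: "'a \<Rightarrow> ('a, 'm::finite, 'n::finite) rough_velocity"
  assumes M: "smooth_manifold M" and f: "rough_velocity_field M f" "admissible M f"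
    and U: "(U, x) \<in> charts M" and q: "q \<in> U"
  defines "F \<equiv> chart_field M f U x"
  shows "fderiv (F (Vtx \<beta>)) (x q) (F (Vtx \<alpha>) (x q)) = F (Dot \<alpha> \<beta>) (x q) + F (Ladder \<alpha> \<beta>) (x q)"
proof -
  have "q \<in> topspace (mtop M)" using chart_properties(4)[OF M U] q by blast
  then obtain V y where V: "(V, y) \<in> charts M" "q \<in> V"
    and adm: "\<And>i \<alpha> \<beta>. (\<Sum>j\<in>UNIV. pderiv_at j (\<lambda>v. fiber_coords M y (f (inv_into V y v)) $ i $ Vtx \<beta>) (y q)
                   * fiber_coords M y (f q) $ j $ Vtx \<alpha>)
        = fiber_coords M y (f q) $ i $ Dot \<alpha> \<beta> + fiber_coords M y (f q) $ i $ Ladder \<alpha> \<beta>"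
    using f(2) unfolding admissible_def by blast
  define G where "G = chart_field M f V y"
  define \<phi> where "\<phi> = y \<circ> inv_into U x"
  have inj: "inj_on x U" "inj_on y V" using chart_properties(1)[OF M] U V by auto
  have F_eq: "F \<tau> (x q') = fiber_column (fiber_coords M x (f q')) \<tau>" if "q' \<in> U" for \<tau> q'
    by (simp add: F_def chart_field_def inv_into_f_f[OF inj(1) that])
  have G_eq: "G \<tau> (y q') = fiber_column (fiber_coords M y (f q')) \<tau>" if "q' \<in> V" for \<tau> q'
    by (simp add: G_def chart_field_def inv_into_f_f[OF inj(2) that])
  have \<phi>_eq: "\<phi> (x q') = y q'" if "q' \<in> U" for q'
    by (simp add: \<phi>_def inv_into_f_f[OF inj(1) that])
  have in_bundle: "f q' \<in> rv_bundle M" "rv_proj M (f q') = q'" if "q' \<in> U" for q'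
    using f(1) chart_properties(4)[OF M U] that unfolding rough_velocity_field_def by auto
  have change: "G (Vtx \<alpha>) (y q') = fderiv \<phi> (x q') (F (Vtx \<alpha>) (x q'))"
    "G (Dot \<alpha> \<beta>) (y q') = fderiv \<phi> (x q') (F (Dot \<alpha> \<beta>) (x q'))
       + second_fderiv \<phi> (x q') (F (Vtx \<alpha>) (x q')) (F (Vtx \<beta>) (x q'))"
    "G (Ladder \<alpha> \<beta>) (y q') = fderiv \<phi> (x q') (F (Ladder \<alpha> \<beta>) (x q'))"
    if "q' \<in> U \<inter> V" for q' \<alpha> \<beta>
    using that fiber_coords_change[OF M U V(1) in_bundle(1)[of q']] in_bundle(2)[of q']
    by (simp_all add: F_eq G_eq \<phi>_def)
  have F_diff: "F \<tau> differentiable (at (x q))" for \<tau>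
    using Ck_on_chart_field[OF f(1) U, of "Suc 0" \<tau>] q by (simp add: F_def)
  have G_diff: "G \<tau> differentiable (at (y q))" for \<tau>
    using Ck_on_chart_field[OF f(1) V(1), of "Suc 0" \<tau>] V(2) by (simp add: G_def)
  have admG: "fderiv (G (Vtx \<beta>)) (y q) (G (Vtx \<alpha>) (y q)) = G (Dot \<alpha> \<beta>) (y q) + G (Ladder \<alpha> \<beta>) (y q)"
  proof -
    have "fderiv (G (Vtx \<beta>)) (y q) (G (Vtx \<alpha>) (y q)) $ i = G (Dot \<alpha> \<beta>) (y q) $ i + G (Ladder \<alpha> \<beta>) (y q) $ i" for i
    proof -
      have "fderiv (G (Vtx \<beta>)) (y q) (G (Vtx \<alpha>) (y q)) $ i
          = (\<Sum>j\<in>UNIV. G (Vtx \<alpha>) (y q) $ j * fderiv (G (Vtx \<beta>)) (y q) (axis j 1) $ i)"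
        by (subst linear_vec_expand[OF bounded_linear.linear[OF fderiv_bounded_linear[OF G_diff]]]) simp
      also have "\<dots> = (\<Sum>j\<in>UNIV. pderiv_at j (\<lambda>v. fiber_coords M y (f (inv_into V y v)) $ i $ Vtx \<beta>) (y q)
                   * fiber_coords M y (f q) $ j $ Vtx \<alpha>)"
        unfolding pderiv_at_def fderiv_nth[OF G_diff, symmetric] G_eq[OF V(2)]
        by (simp add: G_def chart_field_def fiber_column_def mult.commute)
      finally show ?thesis unfolding adm by (simp add: G_eq[OF V(2)] fiber_column_def)
    qed
    then show ?thesis by (simp add: vec_eq_iff)
  qed
  have smooth: "smooth_on (x ` (U \<inter> V)) \<phi>" "smooth_on (y ` (V \<inter> U)) (x \<circ> inv_into V y)"
    unfolding \<phi>_def by (rule transition_smooth[OF M U V(1)], rule transition_smooth[OF M V(1) U])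
  have \<phi>: "twice_differentiable \<phi> (x q)"
    using smooth(1) q V(2) by (intro smooth_twice_differentiable) auto
  have near: "eventually (\<lambda>u. u \<in> x ` (U \<inter> V)) (nhds (x q))"
    using smooth(1) q V(2) by (intro eventually_nhds_in_open) (auto simp: smooth_on_def)
  have left: "((\<lambda>u. G (Vtx \<beta>) (\<phi> u)) has_derivative (\<lambda>h. fderiv (G (Vtx \<beta>)) (y q) (fderiv \<phi> (x q) h))) (at (x q))"
    by (rule has_derivative_compose[of \<phi> "fderiv \<phi> (x q)" "x q" UNIV "G (Vtx \<beta>)"])
      (use twice_differentiableD(1)[OF \<phi>] G_diff \<phi>_eq[OF q] in \<open>simp_all add: frechet_derivative_works\<close>)
  have "((\<lambda>u. fderiv \<phi> u (F (Vtx \<beta>) u)) has_derivative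
      (\<lambda>h. second_fderiv \<phi> (x q) (fderiv (\<lambda>u. u) (x q) h) (F (Vtx \<beta>) (x q))
         + fderiv \<phi> (x q) (fderiv (F (Vtx \<beta>)) (x q) h))) (at (x q))"
    by (rule has_derivative_fderiv_apply) (use \<phi> F_diff in auto)
  then have "((\<lambda>u. G (Vtx \<beta>) (\<phi> u)) has_derivative
      (\<lambda>h. second_fderiv \<phi> (x q) h (F (Vtx \<beta>) (x q)) + fderiv \<phi> (x q) (fderiv (F (Vtx \<beta>)) (x q) h))) (at (x q))"
    unfolding frechet_derivative_ident
    by (rule has_derivative_cong_nhds[rotated])
      (rule eventually_mono[OF near], auto simp: change(1) \<phi>_eq)
  from has_derivative_unique[OF left this]
  have "fderiv (G (Vtx \<beta>)) (y q) (fderiv \<phi> (x q) h)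
      = second_fderiv \<phi> (x q) h (F (Vtx \<beta>) (x q)) + fderiv \<phi> (x q) (fderiv (F (Vtx \<beta>)) (x q) h)" for h
    by (simp add: fun_eq_iff)
  \<comment> \<open>The second derivatives of \<phi> on both sides are equal and cancel.\<close>
  then have eq: "fderiv \<phi> (x q) (fderiv (F (Vtx \<beta>)) (x q) (F (Vtx \<alpha>) (x q)))
      = fderiv \<phi> (x q) (F (Dot \<alpha> \<beta>) (x q) + F (Ladder \<alpha> \<beta>) (x q))"
    using admG q V(2) change
    by (simp add: linear_add[OF twice_differentiable_linear(1)[OF \<phi>]])
  \<comment> \<open>The opposite transition map: its derivative is a left inverse of D\<phi> and
    removes it from \<open>eq\<close>.\<close>
  define \<xi> where "\<xi> = x \<circ> inv_into V y"
  have \<xi>: "\<xi> differentiable (at (\<phi> (x q)))"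
    unfolding \<xi>_def using q V(2) \<phi>_eq[OF q]
    by (intro twice_differentiableD(1) smooth_twice_differentiable[OF smooth(2)]) auto
  have inverse: "fderiv \<xi> (\<phi> (x q)) (fderiv \<phi> (x q) h) = h" for h
  proof -
    have "((\<lambda>u. \<xi> (\<phi> u)) has_derivative (\<lambda>h. fderiv \<xi> (\<phi> (x q)) (fderiv \<phi> (x q) h))) (at (x q))"
      by (rule has_derivative_compose[of \<phi> "fderiv \<phi> (x q)" "x q" UNIV \<xi>])
        (use twice_differentiableD(1)[OF \<phi>] \<xi> in \<open>simp_all add: frechet_derivative_works\<close>)
    then have "((\<lambda>u. u) has_derivative (\<lambda>h. fderiv \<xi> (\<phi> (x q)) (fderiv \<phi> (x q) h))) (at (x q))"
      by (rule has_derivative_cong_nhds[rotated])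
        (rule eventually_mono[OF near], auto simp: \<xi>_def \<phi>_eq inv_into_f_f[OF inj(2)])
    from has_derivative_unique[OF this has_derivative_ident] show ?thesis by (simp add: fun_eq_iff)
  qed
  show ?thesis using arg_cong[OF eq, of "fderiv \<xi> (\<phi> (x q))"] by (simp only: inverse)
qed

section \<open>Uniqueness of integral curves\<close>

lemma local_uniqueness:
  fixes F :: "'n::finite forest \<Rightarrow> 'e::euclidean_space \<Rightarrow> 'e" and z w :: "real \<Rightarrow> 'e"
  assumes control: "control_function S T \<omega>" and rough: "branched_rough_path S T p \<omega> X"
    and p: "1 \<le> p" "p < 3" and ab: "S \<le> a" "a < b" "b \<le> T"
    and F: "\<And>\<tau>. Ck_on (Suc (Suc (Suc 0))) W (F \<tau>)"
    and K: "compact K" "K \<subseteq> W" "convex K"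
    and adm: "\<And>v \<alpha> \<beta>. v \<in> K \<Longrightarrow>
      fderiv (F (Vtx \<beta>)) v (F (Vtx \<alpha>) v) = F (Dot \<alpha> \<beta>) v + F (Ladder \<alpha> \<beta>) v"
    and in_K: "\<And>y t. y \<in> {z, w} \<Longrightarrow> t \<in> {a..b} \<Longrightarrow> y t \<in> K"
    and expansion: "\<And>y. y \<in> {z, w} \<Longrightarrow> \<exists>C. \<forall>(s, t)\<in>simplex2 {a..b}.
      norm (y t - y s - (\<Sum>\<tau>\<in>UNIV. (1 / sym_factor \<tau> * X \<tau> (s, t)) *\<^sub>R F \<tau> (y s))) \<le> C * \<omega> (s, t) powr (3 / p)"
    and start: "z a = w a"
  shows "\<exists>c. a < c \<and> c \<le> b \<and> (\<forall>t\<in>{a..c}. z t = w t)"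
proof -
  obtain b' where b': "a < b'" "b' \<le> b" "\<omega> (a, b') < 1"
    using control_small[OF control ab, of 1] by auto
  obtain C0 where C0: "\<forall>\<alpha> \<beta>. \<forall>r \<in> simplex2 {S..T}.
       \<bar>X (Vtx \<alpha>) r\<bar> \<le> C0 * \<omega> r powr (1 / p) \<and>
       \<bar>X (Dot \<alpha> \<beta>) r\<bar> \<le> C0 * \<omega> r powr (2 / p) \<and>
       \<bar>X (Ladder \<alpha> \<beta>) r\<bar> \<le> C0 * \<omega> r powr (2 / p)"
    using rough unfolding branched_rough_path_def by blast
  obtain Cz where Cz: "\<forall>(s, t)\<in>simplex2 {a..b}.
      norm (z t - z s - (\<Sum>\<tau>\<in>UNIV. (1 / sym_factor \<tau> * X \<tau> (s, t)) *\<^sub>R F \<tau> (z s))) \<le> Cz * \<omega> (s, t) powr (3 / p)"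
    using expansion[of z] by blast
  obtain Cw where Cw: "\<forall>(s, t)\<in>simplex2 {a..b}.
      norm (w t - w s - (\<Sum>\<tau>\<in>UNIV. (1 / sym_factor \<tau> * X \<tau> (s, t)) *\<^sub>R F \<tau> (w s))) \<le> Cw * \<omega> (s, t) powr (3 / p)"
    using expansion[of w] by blast
  \<comment> \<open>All requirements on \<open>L\<close> are lower bounds, so they hold together
    eventually; one value then dominates the constants of the fields, of the rough path and of both
    curves.\<close>
  have "eventually (\<lambda>L. \<forall>\<tau>\<in>UNIV. regular_bound L K (F \<tau>)) at_top"
    by (intro eventually_ball_finite ballI eventually_regular_bound[OF F K]) simp
  then have "eventually (\<lambda>L. (\<forall>\<tau>. regular_bound L K (F \<tau>)) \<and> 1 \<le> L \<and> C0 \<le> L \<and> Cz \<le> L \<and> Cw \<le> L) at_top"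
    using eventually_ge_at_top[of 1] eventually_ge_at_top[of C0] eventually_ge_at_top[of Cz] eventually_ge_at_top[of Cw]
    by eventually_elim auto
  then obtain L where L: "\<And>\<tau>. regular_bound L K (F \<tau>)" "1 \<le> L" "C0 \<le> L" "Cz \<le> L" "Cw \<le> L"
    using eventually_happens'[OF trivial_limit_at_top_linorder] by blast
  have scale: "r \<le> L * x powr y" if "r \<le> C * x powr y" "C \<le> L" for r C x y :: real
    using that(1) mult_right_mono[OF that(2), of "x powr y"] by simp
  interpret coupled_solutions S T p \<omega> X F K L a b' z w
  proof unfold_locales
    show "control_function S T \<omega>" "branched_rough_path S T p \<omega> X" "1 \<le> p" "p < 3"
      "S \<le> a" "a < b'" "b' \<le> T" "\<omega> (a, b') \<le> 1" "1 \<le> L" "regular_bound L K (F \<tau>)" "z a = w a" for \<tau>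
      using control rough p ab b' L start by auto
    show "fderiv (F (Vtx \<beta>)) v (F (Vtx \<alpha>) v) = F (Dot \<alpha> \<beta>) v + F (Ladder \<alpha> \<beta>) v" if "v \<in> K" for v \<alpha> \<beta>
      by (rule adm[OF that])
    show "y t \<in> K" if "y \<in> {z, w}" "a \<le> t" "t \<le> b'" for y t
      using in_K[of y t] that b' by simp
    fix s t assume st: "a \<le> s" "s \<le> t" "t \<le> b'"
    have S: "(s, t) \<in> simplex2 {S..T}" "(s, t) \<in> simplex2 {a..b}" using st b' ab by (auto simp: simplex2_def)
    show "\<bar>X (Vtx \<alpha>) (s, t)\<bar> \<le> L * \<omega> (s, t) powr (1 / p)"
      "\<bar>X (Dot \<alpha> \<beta>) (s, t)\<bar> \<le> L * \<omega> (s, t) powr (2 / p)"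
      "\<bar>X (Ladder \<alpha> \<beta>) (s, t)\<bar> \<le> L * \<omega> (s, t) powr (2 / p)" for \<alpha> \<beta>
      using C0 S(1) scale[OF _ L(3)] by blast+
    have levels: "v' - v - level1 X (s, t) (\<lambda>\<alpha>. F (Vtx \<alpha>) v) - level2 X (s, t) (\<lambda>\<tau>. F \<tau> v)
        = v' - v - (\<Sum>\<tau>\<in>UNIV. (1 / sym_factor \<tau> * X \<tau> (s, t)) *\<^sub>R F \<tau> v)" for v v'
      by (simp only: sum_forest_levels[where X = X and g = "\<lambda>\<tau>. F \<tau> v"] diff_diff_add add.assoc)
    show "norm (y t - y s - level1 X (s, t) (\<lambda>\<alpha>. F (Vtx \<alpha>) (y s)) - level2 X (s, t) (\<lambda>\<tau>. F \<tau> (y s)))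
        \<le> L * \<omega> (s, t) powr (3 / p)" if "y \<in> {z, w}" for y
      unfolding levels using that scale[OF _ L(4)] scale[OF _ L(5)] Cz Cw S(2) by blast
  qed
  show ?thesis using coincide_near_start b' by (meson order.trans)
qed

lemma curve_stays_in_chart_ball:
  assumes M: "smooth_manifold M" and U: "(U, x) \<in> charts M"
    and Y: "continuous_map (top_of_set {S..T}) (mtop M) Y"
    and a: "a \<in> {S..T}" "Y a \<in> U" and r: "0 < r"
  obtains d where "0 < d" "\<And>t. t \<in> {S..T} \<Longrightarrow> dist t a < d \<Longrightarrow> Y t \<in> U \<and> x (Y t) \<in> ball (x (Y a)) r"
proof -
  have "continuous_map (subtopology (mtop M) U) euclidean x"
    using homeomorphic_imp_continuous_map[OF chart_properties(5)[OF M U]] continuous_map_into_fulltopology by blast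
  then have "openin (subtopology (mtop M) U) {q \<in> topspace (subtopology (mtop M) U). x q \<in> ball (x (Y a)) r}"
    by (rule openin_continuous_map_preimage) simp
  moreover have "topspace (subtopology (mtop M) U) = U"
    using chart_properties(4)[OF M U] by (simp add: topspace_subtopology inf.absorb2)
  ultimately have "openin (subtopology (mtop M) U) {q \<in> U. x q \<in> ball (x (Y a)) r}" by (simp only:)
  then have "openin (mtop M) {q \<in> U. x q \<in> ball (x (Y a)) r}"
    unfolding openin_open_subtopology[OF chart_properties(2)[OF M U]] by (rule conjunct1)
  from openin_continuous_map_preimage[OF Y this]
  have "openin (top_of_set {S..T}) {t \<in> {S..T}. Y t \<in> U \<and> x (Y t) \<in> ball (x (Y a)) r}" by simp
  moreover have "a \<in> {t \<in> {S..T}. Y t \<in> U \<and> x (Y t) \<in> ball (x (Y a)) r}" using a r by simp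
  ultimately obtain d where "0 < d"
    "\<forall>t\<in>{S..T}. dist t a < d \<longrightarrow> t \<in> {t \<in> {S..T}. Y t \<in> U \<and> x (Y t) \<in> ball (x (Y a)) r}"
    unfolding openin_euclidean_subtopology_iff by blast
  then show thesis using that[of d] by blast
qed

lemma integral_curve_expansion:
  fixes f :: "'a \<Rightarrow> ('a, 'm::finite, 'n::finite) rough_velocity"
  assumes M: "smooth_manifold M" and U: "(U, x) \<in> charts M"
    and Y: "integral_curve M S T p \<omega> X f Y" and ab: "{a..b} \<subseteq> {S..T}" "Y ` {a..b} \<subseteq> U"
  shows "\<exists>C. \<forall>(s, t)\<in>simplex2 {a..b}. norm (x (Y t) - x (Y s)
      - (\<Sum>\<tau>\<in>UNIV. (1 / sym_factor \<tau> * X \<tau> (s, t)) *\<^sub>R chart_field M f U x \<tau> (x (Y s)))) \<le> C * \<omega> (s, t) powr (3 / p)"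
proof -
  obtain C where C: "\<forall>i. \<forall>(s, t) \<in> simplex2 {a..b}.
          \<bar>x (Y t) $ i - x (Y s) $ i
             - (\<Sum>\<tau>\<in>UNIV. 1 / sym_factor \<tau> * fiber_coords M x (f (Y s)) $ i $ \<tau> * X \<tau> (s, t))\<bar>
          \<le> C * \<omega> (s, t) powr (3 / p)"
    using Y U ab unfolding integral_curve_def by blast
  have "norm (x (Y t) - x (Y s)
      - (\<Sum>\<tau>\<in>UNIV. (1 / sym_factor \<tau> * X \<tau> (s, t)) *\<^sub>R chart_field M f U x \<tau> (x (Y s))))
      \<le> (real CARD('m) * C) * \<omega> (s, t) powr (3 / p)" (is "norm ?v \<le> _")
    if st: "(s, t) \<in> simplex2 {a..b}" for s t
  proof -
    have "Y s \<in> U" using st ab(2) by (auto simp: simplex2_def)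
    then have "inv_into U x (x (Y s)) = Y s" by (rule inv_into_f_f[OF chart_properties(1)[OF M U]])
    then have "?v $ i = x (Y t) $ i - x (Y s) $ i
             - (\<Sum>\<tau>\<in>UNIV. 1 / sym_factor \<tau> * fiber_coords M x (f (Y s)) $ i $ \<tau> * X \<tau> (s, t))" for i
      by (simp add: chart_field_def fiber_column_def mult_ac)
    then have "\<bar>?v $ i\<bar> \<le> C * \<omega> (s, t) powr (3 / p)" for i using C st by auto
    \<comment> \<open>Integral curves are bounded coordinate by coordinate; the l1 norm converts
      this into a norm bound at the price of the dimension.\<close>
    then have "(\<Sum>i\<in>UNIV. \<bar>?v $ i\<bar>) \<le> (\<Sum>i\<in>(UNIV::'m set). C * \<omega> (s, t) powr (3 / p))"
      by (intro sum_mono)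
    then show ?thesis using norm_le_l1_cart[of ?v] by simp
  qed
  then show ?thesis by blast
qed

lemma integral_curves_locally_unique:
  fixes f :: "'a \<Rightarrow> ('a, 'm::finite, 'n::finite) rough_velocity"
  assumes p: "1 \<le> p" "p < 3" and control: "control_function S T \<omega>" and rough: "branched_rough_path S T p \<omega> X"
    and M: "smooth_manifold M" and f: "rough_velocity_field M f" "admissible M f"
    and Y1: "integral_curve M S T p \<omega> X f Y1" and Y2: "integral_curve M S T p \<omega> X f Y2"
    and a: "S \<le> a" "a < T" "Y1 a = Y2 a"
  shows "\<exists>c. a < c \<and> c \<le> T \<and> (\<forall>t\<in>{a..c}. Y1 t = Y2 t)"
proof -
  have cont: "continuous_map (top_of_set {S..T}) (mtop M) Y1" "continuous_map (top_of_set {S..T}) (mtop M) Y2"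
    using Y1 Y2 by (auto simp: integral_curve_def)
  have a_in: "a \<in> {S..T}" using a by simp
  then have "Y1 a \<in> topspace (mtop M)" using cont(1) by (auto simp: continuous_map_def)
  then obtain U x where U: "(U, x) \<in> charts M" "Y1 a \<in> U"
    using M unfolding smooth_manifold_def by blast
  have "open (x ` U)" by (rule chart_properties(3)[OF M U(1)])
  then obtain r where r: "0 < r" "cball (x (Y1 a)) r \<subseteq> x ` U"
    using U(2) unfolding open_contains_cball by blast
  \<comment> \<open>A closed ball in the image of the chart is compact and convex, as the mean value
    estimates require.\<close>
  define K where "K = cball (x (Y1 a)) r"
  obtain d1 where d1: "0 < d1"
    "\<And>t. t \<in> {S..T} \<Longrightarrow> dist t a < d1 \<Longrightarrow> Y1 t \<in> U \<and> x (Y1 t) \<in> ball (x (Y1 a)) r"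
    using curve_stays_in_chart_ball[OF M U(1) cont(1) a_in U(2) r(1)] by blast
  obtain d2 where d2: "0 < d2"
    "\<And>t. t \<in> {S..T} \<Longrightarrow> dist t a < d2 \<Longrightarrow> Y2 t \<in> U \<and> x (Y2 t) \<in> ball (x (Y1 a)) r"
    using curve_stays_in_chart_ball[OF M U(1) cont(2) a_in _ r(1)] U(2) a(3) by metis
  \<comment> \<open>Half of the smaller radius keeps the right endpoint strictly within both
    distances.\<close>
  define b where "b = min T (a + min d1 d2 / 2)"
  have b: "a < b" "b \<le> T" using a d1(1) d2(1) by (auto simp: b_def)
  have near: "t \<in> {S..T}" "dist t a < d1" "dist t a < d2" if "t \<in> {a..b}" for t
    using that a d1(1) d2(1) by (auto simp: b_def dist_real_def)
  have in_U: "Y1 t \<in> U" "Y2 t \<in> U" "x (Y1 t) \<in> K" "x (Y2 t) \<in> K" if "t \<in> {a..b}" for t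
    using d1(2)[of t] d2(2)[of t] near[OF that] by (auto simp: K_def)
  have ab: "{a..b} \<subseteq> {S..T}" using a b by auto
  have "\<exists>c. a < c \<and> c \<le> b \<and> (\<forall>t\<in>{a..c}. (\<lambda>t. x (Y1 t)) t = (\<lambda>t. x (Y2 t)) t)"
  proof (rule local_uniqueness[OF control rough p a(1) b, where F = "chart_field M f U x" and W = "x ` U" and K = K])
    show "Ck_on (Suc (Suc (Suc 0))) (x ` U) (chart_field M f U x \<tau>)" for \<tau>
      by (rule Ck_on_chart_field[OF f(1) U(1)])
    show "compact K" "K \<subseteq> x ` U" "convex K" using r(2) by (auto simp: K_def)
    show "fderiv (chart_field M f U x (Vtx \<beta>)) v (chart_field M f U x (Vtx \<alpha>) v)
        = chart_field M f U x (Dot \<alpha> \<beta>) v + chart_field M f U x (Ladder \<alpha> \<beta>) v" if "v \<in> K" for v \<alpha> \<beta>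
      using that r(2) admissible_in_chart[OF M f U(1)] by (auto simp: K_def)
    show "y t \<in> K" if "y \<in> {\<lambda>t. x (Y1 t), \<lambda>t. x (Y2 t)}" "t \<in> {a..b}" for y t
      using that in_U by auto
    show "\<exists>C. \<forall>(s, t)\<in>simplex2 {a..b}. norm (y t - y s
      - (\<Sum>\<tau>\<in>UNIV. (1 / sym_factor \<tau> * X \<tau> (s, t)) *\<^sub>R chart_field M f U x \<tau> (y s))) \<le> C * \<omega> (s, t) powr (3 / p)"
      if "y \<in> {\<lambda>t. x (Y1 t), \<lambda>t. x (Y2 t)}" for y
      using that integral_curve_expansion[OF M U(1) Y1 ab] integral_curve_expansion[OF M U(1) Y2 ab] in_U
      by blast
    show "x (Y1 a) = x (Y2 a)" by (simp add: a(3))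
  qed
  then obtain c where c: "a < c" "c \<le> b" "\<And>t. t \<in> {a..c} \<Longrightarrow> x (Y1 t) = x (Y2 t)" by auto
  have "Y1 t = Y2 t" if "t \<in> {a..c}" for t
    using c(3)[OF that] in_U[of t] that c(2) inj_onD[OF chart_properties(1)[OF M U(1)]] by auto
  then show ?thesis using c b by (meson order.trans)
qed

theorem theorem4p25:
  fixes S T p :: real
    and \<omega> :: "real \<times> real \<Rightarrow> real"
    and X :: "'n::finite forest \<Rightarrow> real \<times> real \<Rightarrow> real"
    and M :: "('a, 'm::finite) manifold"
    and f :: "'a \<Rightarrow> ('a, 'm, 'n) rough_velocity"
    and Y1 Y2 :: "real \<Rightarrow> 'a"
  assumes "S \<le> T"
    and "1 \<le> p" and "p < 3"
    and "control_function S T \<omega>"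
    and "branched_rough_path S T p \<omega> X"
    and "smooth_manifold M"
    and "rough_velocity_field M f"
    and "admissible M f"
    and "integral_curve M S T p \<omega> X f Y1"
    and "integral_curve M S T p \<omega> X f Y2"
    and "Y1 S = Y2 S"
  shows "\<forall>t \<in> {S..T}. Y1 t = Y2 t"
proof -
  \<comment> \<open>Agreement is demanded on all of [S, c], so membership of a later time yields
    agreement at every earlier one.\<close>
  define A where "A = {c \<in> {S..T}. \<forall>t\<in>{S..c}. Y1 t = Y2 t}"
  define c where "c = Sup A"
  have A: "S \<in> A" "bdd_above A" using assms(1,11) by (auto simp: A_def)
  have c: "S \<le> c" "c \<le> T"
    unfolding c_def using A by (auto intro!: cSup_upper) (rule cSup_least, auto simp: A_def)
  have below: "Y1 t = Y2 t" if t: "S \<le> t" "t < c" for t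
  proof -
    obtain c' where "c' \<in> A" "t < c'" using t A less_cSup_iff[of A t] by (auto simp: c_def)
    then show ?thesis using t by (auto simp: A_def)
  qed
  have closed: "closedin (top_of_set {S..T}) {t \<in> topspace (top_of_set {S..T}). Y1 t = Y2 t}"
    using assms(6,9,10) by (intro closedin_continuous_maps_eq) (auto simp: smooth_manifold_def integral_curve_def)
  have at_c: "Y1 c = Y2 c"
  proof (cases "c = S")
    case False
    \<comment> \<open>For \<open>c \<noteq> S\<close> the point \<open>c\<close> lies in the closure
      of [S, c), so agreement before \<open>c\<close> extends to \<open>c\<close> itself.\<close>
    have "closed {t \<in> {S..T}. Y1 t = Y2 t}"
      using closed closedin_closed_trans[of "{S..T}"] by simp
    moreover have "{S..<c} \<subseteq> {t \<in> {S..T}. Y1 t = Y2 t}" using below c by auto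
    ultimately have "closure {S..<c} \<subseteq> {t \<in> {S..T}. Y1 t = Y2 t}" by (rule closure_minimal[rotated])
    then show ?thesis using False c by (auto simp: closure_atLeastLessThan subset_iff)
  qed (use assms(11) in simp)
  have "\<not> c < T"
  proof
    assume "c < T"
    \<comment> \<open>Local uniqueness restarted at \<open>c\<close> would put a later time into
      \<open>A\<close>, against the choice of \<open>c\<close> as supremum.\<close>
    then obtain c' where c': "c < c'" "c' \<le> T" "\<forall>t\<in>{c..c'}. Y1 t = Y2 t"
      using integral_curves_locally_unique[OF assms(2-10) c(1) _ at_c] by blast
    then have "c' \<in> A" using below c by (auto simp: A_def)
    then have "c' \<le> c" unfolding c_def using A(2) by (rule cSup_upper)
    with c' show False by simp
  qed
  then show ?thesis using below at_c c by (metis atLeastAtMost_iff less_eq_real_def order_antisym_conv)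
qed

end
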